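(* Let $\mathscr{R}$ be a finite von Neumann algebra with a faithful normal tracial state $\tau$, and let $\Delta$ denote the Fuglede-Kadison determinant on $\mathscr{R}$ associated with $\tau$. Let $\Phi:\mathscr{R}\to\mathscr{R}$ be a trace-preserving unital positive map. Then for every positive operator $A$ in $\mathscr{R}$, $$\Delta(A)\le\Delta(\Phi(A)).$$ Further, if $A$ is also regular, then $$\Delta(\Phi(A^{-1})^{-1})\le\Delta(A).$$
   Context: A unital positive map is a linear map sending positive operators to positive operators with $\Phi(I)=I$; it is trace-preserving if $\tau(\Phi(X))=\tau(X)$ for all $X\in\mathscr{R}$. "Regular" means invertible (with bounded inverse). Fuglede-Kadison determinant (analytic extension): for regular $A\in\mathscr{R}$, $\Delta(A)=\exp(\tau(\log (A^*A)^{1/2}))$; for general $A\in\mathscr{R}$ with spectral decomposition $(A^*A)^{1/2}=\int\lambda\,dE_\lambda$, $\Delta(A)=\exp\left(\int\log\lambda\,d\tau(E_\lambda)\right)$, with $\Delta(A)=0$ if $\int\log\lambda\,d\tau(E_\lambda)=-\infty$. *)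

theory Defs
  imports "HOL-Analysis.Analysis"
begin

section \<open>Complex Hilbert spaces\<close>

class complex_vector = real_vector +
  fixes scaleC :: "complex \<Rightarrow> 'a \<Rightarrow> 'a" (infixr "*\<^sub>C" 75)
  assumes scaleC_add_right: "c *\<^sub>C (x + y) = c *\<^sub>C x + c *\<^sub>C y"
    and scaleC_add_left: "(c + d) *\<^sub>C x = c *\<^sub>C x + d *\<^sub>C x"
    and scaleC_scaleC: "c *\<^sub>C d *\<^sub>C x = (c * d) *\<^sub>C x"
    and scaleC_one: "1 *\<^sub>C x = x"
    and scaleR_scaleC: "r *\<^sub>R x = complex_of_real r *\<^sub>C x"

text \<open>The inner product is conjugate-linear in its first argument.  Its real part is the real inner
  product of \<open>real_inner\<close>, which ties norm and topology to it.\<close>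

class complex_inner = complex_vector + real_inner +
  fixes cinner :: "'a \<Rightarrow> 'a \<Rightarrow> complex"
  assumes cinner_commute: "cinner x y = cnj (cinner y x)"
    and cinner_add_right: "cinner x (y + z) = cinner x y + cinner x z"
    and cinner_scaleC_right: "cinner x (c *\<^sub>C y) = c * cinner x y"
    and inner_eq_Re_cinner: "inner x y = Re (cinner x y)"

class chilbert_space = complex_inner + complete_space

instantiation complex :: chilbert_space
begin
definition "scaleC_complex = ((*) :: complex \<Rightarrow> complex \<Rightarrow> complex)"
definition "cinner_complex (x::complex) y = cnj x * y"
instance
  by standard (simp_all add: scaleC_complex_def cinner_complex_def algebra_simps
      scaleR_conv_of_real inner_complex_def)
end

lemma norm_scaleC: "norm (c *\<^sub>C (x::'a::complex_inner)) = cmod c * norm x"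
proof -
  have left: "cinner (c *\<^sub>C x) y = cnj c * cinner x y" for y
    by (metis cinner_commute cinner_scaleC_right complex_cnj_cnj complex_cnj_mult)
  have "cinner (c *\<^sub>C x) (c *\<^sub>C x) = of_real ((cmod c)\<^sup>2) * cinner x x"
    by (simp add: left cinner_scaleC_right complex_norm_square mult_ac del: of_real_power)
  then have "inner (c *\<^sub>C x) (c *\<^sub>C x) = (cmod c)\<^sup>2 * inner x x"
    by (simp add: inner_eq_Re_cinner)
  then show ?thesis
    by (simp add: norm_eq_sqrt_inner real_sqrt_mult)
qed

instantiation blinfun :: (real_normed_vector, complex_inner) complex_vector
begin

lift_definition scaleC_blinfun :: "complex \<Rightarrow> 'a \<Rightarrow>\<^sub>L 'b \<Rightarrow> 'a \<Rightarrow>\<^sub>L 'b" is "\<lambda>c f x. c *\<^sub>C f x"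
proof -
  fix c :: complex and f :: "'a \<Rightarrow> 'b"
  assume f: "bounded_linear f"
  have comm: "c *\<^sub>C r *\<^sub>R y = r *\<^sub>R c *\<^sub>C y" for r and y :: 'b
    by (simp add: scaleR_scaleC scaleC_scaleC mult.commute)
  have "bounded_linear (\<lambda>y::'b. c *\<^sub>C y)"
    by (rule bounded_linear_intro[where K = "cmod c"])
      (simp_all add: scaleC_add_right comm norm_scaleC mult.commute)
  then show "bounded_linear (\<lambda>x. c *\<^sub>C f x)"
    using f by (rule bounded_linear_compose)
qed

instance
  by standard (transfer, simp add: fun_eq_iff scaleC_add_right scaleC_add_left scaleC_scaleC
      scaleC_one scaleR_scaleC)+

end


section \<open>Operators\<close>

definition clinear_on :: "'a set \<Rightarrow> ('a::complex_vector \<Rightarrow> 'b::complex_vector) \<Rightarrow> bool" where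
  "clinear_on S f \<longleftrightarrow>
     (\<forall>x\<in>S. \<forall>y\<in>S. f (x + y) = f x + f y) \<and> (\<forall>c. \<forall>x\<in>S. f (c *\<^sub>C x) = c *\<^sub>C f x)"

text \<open>Elements of \<open>'h \<Rightarrow>\<^sub>L 'h\<close> are only real-linear; the operators on the complex Hilbert space \<open>'h\<close>
  are those satisfying the following predicate.\<close>

definition clinear_op :: "'h::chilbert_space \<Rightarrow>\<^sub>L 'h \<Rightarrow> bool" where
  "clinear_op A \<longleftrightarrow> clinear_on UNIV (blinfun_apply A)"

definition adj :: "'h::chilbert_space \<Rightarrow>\<^sub>L 'h \<Rightarrow> 'h \<Rightarrow>\<^sub>L 'h" where
  "adj A = (THE B :: 'h \<Rightarrow>\<^sub>L 'h. \<forall>x y. cinner (A x) y = cinner x (B y))"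

definition positive_op :: "'h::chilbert_space \<Rightarrow>\<^sub>L 'h \<Rightarrow> bool" where
  "positive_op A \<longleftrightarrow> clinear_op A \<and> (\<forall>x. cinner x (A x) \<in> \<real>\<^sub>\<ge>\<^sub>0)"

definition op_le :: "'h::chilbert_space \<Rightarrow>\<^sub>L 'h \<Rightarrow> 'h \<Rightarrow>\<^sub>L 'h \<Rightarrow> bool" where
  "op_le A B \<longleftrightarrow> positive_op (B - A)"

definition regular_op :: "'h::chilbert_space \<Rightarrow>\<^sub>L 'h \<Rightarrow> bool" where
  "regular_op A \<longleftrightarrow> (\<exists>B. A o\<^sub>L B = id_blinfun \<and> B o\<^sub>L A = id_blinfun)"

definition inv_op :: "'h::chilbert_space \<Rightarrow>\<^sub>L 'h \<Rightarrow> 'h \<Rightarrow>\<^sub>L 'h" where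
  "inv_op A = (THE B. A o\<^sub>L B = id_blinfun \<and> B o\<^sub>L A = id_blinfun)"

text \<open>\<open>abs_op A\<close> is the positive square root of \<open>A\<^sup>*A\<close>.\<close>

definition abs_op :: "'h::chilbert_space \<Rightarrow>\<^sub>L 'h \<Rightarrow> 'h \<Rightarrow>\<^sub>L 'h" where
  "abs_op A = (THE B. positive_op B \<and> B o\<^sub>L B = adj A o\<^sub>L A)"

definition projection_op :: "'h::chilbert_space \<Rightarrow>\<^sub>L 'h \<Rightarrow> bool" where
  "projection_op P \<longleftrightarrow> clinear_op P \<and> adj P = P \<and> P o\<^sub>L P = P"


section \<open>Spectral decomposition\<close>

text \<open>\<open>has_spectral_integral E f L\<close> states \<open>L = \<integral> f(\<lambda>) dE\<^sub>\<lambda>\<close>, i.e. that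
  \<open>\<langle>x, L x\<rangle> = \<integral> f(\<lambda>) d\<langle>x, E\<^sub>\<lambda> x\<rangle>\<close> as a Lebesgue--Stieltjes integral, for every \<open>x\<close>.\<close>

definition has_spectral_integral ::
    "(real \<Rightarrow> 'h::chilbert_space \<Rightarrow>\<^sub>L 'h) \<Rightarrow> (real \<Rightarrow> real) \<Rightarrow> 'h \<Rightarrow>\<^sub>L 'h \<Rightarrow> bool" where
  "has_spectral_integral E f L \<longleftrightarrow> clinear_op L \<and>
     (\<forall>x. cinner x (L x) =
            complex_of_real (\<integral>s. f s \<partial>interval_measure (\<lambda>s. Re (cinner x (E s x)))))"

text \<open>A resolution of the identity for the self-adjoint operator \<open>T\<close>: a bounded, increasing family of
  projections that is right-continuous in the strong operator topology, with \<open>T = \<integral> \<lambda> dE\<^sub>\<lambda>\<close>.\<close>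

definition spectral_decomposition ::
    "'h::chilbert_space \<Rightarrow>\<^sub>L 'h \<Rightarrow> (real \<Rightarrow> 'h \<Rightarrow>\<^sub>L 'h) \<Rightarrow> bool" where
  "spectral_decomposition T E \<longleftrightarrow>
     (\<forall>s. projection_op (E s)) \<and>
     (\<forall>s t. s \<le> t \<longrightarrow> op_le (E s) (E t)) \<and>
     (\<forall>s x. ((\<lambda>t. E t x) \<longlongrightarrow> E s x) (at_right s)) \<and>
     (\<forall>s. s < - norm T \<longrightarrow> E s = 0) \<and>
     (\<forall>s. s \<ge> norm T \<longrightarrow> E s = id_blinfun) \<and>
     has_spectral_integral E (\<lambda>s. s) T"

text \<open>The choice is immaterial: a self-adjoint operator has exactly one such family.\<close>

definition resolution :: "'h::chilbert_space \<Rightarrow>\<^sub>L 'h \<Rightarrow> real \<Rightarrow> 'h \<Rightarrow>\<^sub>L 'h" where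
  "resolution T = (SOME E. spectral_decomposition T E)"

text \<open>Functional calculus for the logarithm, meant for regular positive \<open>T\<close>, where \<open>ln\<close> is bounded on
  the spectrum.\<close>

definition log_op :: "'h::chilbert_space \<Rightarrow>\<^sub>L 'h \<Rightarrow> 'h \<Rightarrow>\<^sub>L 'h" where
  "log_op T = (THE L. has_spectral_integral (resolution T) ln L)"


section \<open>Finite von Neumann algebras and traces\<close>

definition von_neumann_algebra :: "('h::chilbert_space \<Rightarrow>\<^sub>L 'h) set \<Rightarrow> bool" where
  "von_neumann_algebra R \<longleftrightarrow>
     (\<forall>A\<in>R. clinear_op A) \<and>
     id_blinfun \<in> R \<and>
     (\<forall>A\<in>R. \<forall>B\<in>R. A + B \<in> R) \<and>
     (\<forall>c. \<forall>A\<in>R. c *\<^sub>C A \<in> R) \<and>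
     (\<forall>A\<in>R. \<forall>B\<in>R. A o\<^sub>L B \<in> R) \<and>
     (\<forall>A\<in>R. adj A \<in> R) \<and>
     closedin strong_operator_topology R"

text \<open>Finiteness: the identity is not equivalent to a proper subprojection, i.e. every isometry
  in the algebra is unitary.\<close>

definition finite_von_neumann_algebra :: "('h::chilbert_space \<Rightarrow>\<^sub>L 'h) set \<Rightarrow> bool" where
  "finite_von_neumann_algebra R \<longleftrightarrow> von_neumann_algebra R \<and>
     (\<forall>V\<in>R. adj V o\<^sub>L V = id_blinfun \<longrightarrow> V o\<^sub>L adj V = id_blinfun)"

definition selfadjoint_part :: "('h::chilbert_space \<Rightarrow>\<^sub>L 'h) set \<Rightarrow> ('h \<Rightarrow>\<^sub>L 'h) set" where
  "selfadjoint_part R = {A \<in> R. adj A = A}"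

definition state_on :: "('h::chilbert_space \<Rightarrow>\<^sub>L 'h) set \<Rightarrow> ('h \<Rightarrow>\<^sub>L 'h \<Rightarrow> complex) \<Rightarrow> bool" where
  "state_on R \<tau> \<longleftrightarrow> clinear_on R \<tau> \<and> (\<forall>A\<in>R. positive_op A \<longrightarrow> \<tau> A \<in> \<real>\<^sub>\<ge>\<^sub>0) \<and> \<tau> id_blinfun = 1"

definition directed_op :: "('h::chilbert_space \<Rightarrow>\<^sub>L 'h) set \<Rightarrow> bool" where
  "directed_op D \<longleftrightarrow> D \<noteq> {} \<and> (\<forall>S\<in>D. \<forall>T\<in>D. \<exists>U\<in>D. op_le S U \<and> op_le T U)"

definition is_lub_op ::
    "('h::chilbert_space \<Rightarrow>\<^sub>L 'h) set \<Rightarrow> ('h \<Rightarrow>\<^sub>L 'h) set \<Rightarrow> 'h \<Rightarrow>\<^sub>L 'h \<Rightarrow> bool" where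
  "is_lub_op R D A \<longleftrightarrow> A \<in> selfadjoint_part R \<and> (\<forall>S\<in>D. op_le S A) \<and>
     (\<forall>B\<in>selfadjoint_part R. (\<forall>S\<in>D. op_le S B) \<longrightarrow> op_le A B)"

text \<open>Normality: \<open>\<tau>\<close> preserves least upper bounds of increasing nets of self-adjoint elements.
  Such nets are represented by their (directed) ranges.\<close>

definition normal_on :: "('h::chilbert_space \<Rightarrow>\<^sub>L 'h) set \<Rightarrow> ('h \<Rightarrow>\<^sub>L 'h \<Rightarrow> complex) \<Rightarrow> bool" where
  "normal_on R \<tau> \<longleftrightarrow> (\<forall>D A. D \<subseteq> selfadjoint_part R \<and> directed_op D \<and> is_lub_op R D A \<longrightarrow>
     Re (\<tau> A) = (SUP S\<in>D. Re (\<tau> S)))"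

definition faithful_normal_tracial_state ::
    "('h::chilbert_space \<Rightarrow>\<^sub>L 'h) set \<Rightarrow> ('h \<Rightarrow>\<^sub>L 'h \<Rightarrow> complex) \<Rightarrow> bool" where
  "faithful_normal_tracial_state R \<tau> \<longleftrightarrow>
     state_on R \<tau> \<and>
     (\<forall>A\<in>R. positive_op A \<and> \<tau> A = 0 \<longrightarrow> A = 0) \<and>
     normal_on R \<tau> \<and>
     (\<forall>A\<in>R. \<forall>B\<in>R. \<tau> (A o\<^sub>L B) = \<tau> (B o\<^sub>L A))"

definition unital_positive_map ::
    "('h::chilbert_space \<Rightarrow>\<^sub>L 'h) set \<Rightarrow> ('h \<Rightarrow>\<^sub>L 'h \<Rightarrow> 'h \<Rightarrow>\<^sub>L 'h) \<Rightarrow> bool" where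
  "unital_positive_map R \<Phi> \<longleftrightarrow>
     \<Phi> \<in> R \<rightarrow> R \<and> clinear_on R \<Phi> \<and> (\<forall>A\<in>R. positive_op A \<longrightarrow> positive_op (\<Phi> A)) \<and>
     \<Phi> id_blinfun = id_blinfun"

definition trace_preserving ::
    "('h::chilbert_space \<Rightarrow>\<^sub>L 'h) set \<Rightarrow> ('h \<Rightarrow>\<^sub>L 'h \<Rightarrow> complex) \<Rightarrow> ('h \<Rightarrow>\<^sub>L 'h \<Rightarrow> 'h \<Rightarrow>\<^sub>L 'h) \<Rightarrow> bool" where
  "trace_preserving R \<tau> \<Phi> \<longleftrightarrow> (\<forall>X\<in>R. \<tau> (\<Phi> X) = \<tau> X)"


section \<open>The Fuglede--Kadison determinant\<close>

definition elog :: "real \<Rightarrow> ereal" where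
  "elog s = (if s \<le> 0 then -\<infinity> else ereal (ln s))"

text \<open>\<open>\<integral> log \<lambda> d\<tau>(E\<^sub>\<lambda>)\<close>, as the integral of the positive part minus that of the negative part
  (\<open>e2ennreal\<close> truncates at 0).  The former is finite when \<open>E\<close> is bounded, so the value can be
  \<open>-\<infinity>\<close> but not \<open>\<infinity>\<close>.\<close>

definition log_integral ::
    "('h::chilbert_space \<Rightarrow>\<^sub>L 'h \<Rightarrow> complex) \<Rightarrow> (real \<Rightarrow> 'h \<Rightarrow>\<^sub>L 'h) \<Rightarrow> ereal" where
  "log_integral \<tau> E = (let \<mu> = interval_measure (\<lambda>s. Re (\<tau> (E s))) in
     enn2ereal (\<integral>\<^sup>+ s. e2ennreal (elog s) \<partial>\<mu>) - enn2ereal (\<integral>\<^sup>+ s. e2ennreal (- elog s) \<partial>\<mu>))"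

definition fk_det :: "('h::chilbert_space \<Rightarrow>\<^sub>L 'h \<Rightarrow> complex) \<Rightarrow> 'h \<Rightarrow>\<^sub>L 'h \<Rightarrow> real" where
  "fk_det \<tau> A =
     (if regular_op A then exp (Re (\<tau> (log_op (abs_op A))))
      else let I = log_integral \<tau> (resolution (abs_op A)) in
        if I = -\<infinity> then 0 else exp (real_of_ereal I))"

end

theory Submission
  imports Defs
begin

text \<open>Since \<open>\<Phi>\<close> is positive, unital and trace-preserving, compressing with one spectral projection of
  \<open>\<Phi> A\<close> shows \<open>\<tau>((c - \<Phi> A)\<^sub>+) \<le> \<tau>((c - A)\<^sub>+)\<close> for every real \<open>c\<close>.  On \<open>[0, M]\<close> one has
  \<open>ln x = ln M + x / M - 1 - \<integral>\<^sub>0\<^sup>M (c - x)\<^sub>+ / c\<^sup>2 dc\<close>, so by Tonelli's theorem and \<open>\<tau> (\<Phi> A) = \<tau> A\<close>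
  the logarithmic integral of \<open>A\<close> is at most that of \<open>\<Phi> A\<close>, regular or not.  The second
  inequality is the first one for \<open>A\<^sup>-\<^sup>1\<close>, inverted.

  The spectral theorem is obtained without polynomial approximation: \<open>E\<^sub>s\<close> is the projection onto the
  kernel of \<open>\<bar>T - s\<bar> + (T - s)\<close>, absolute values and kernel projections being strong limits of
  monotone sequences.\<close>

section \<open>Symmetric and nonnegative operators on real Hilbert spaces\<close>

definition symmetric_op :: "('a::real_inner \<Rightarrow>\<^sub>L 'a) \<Rightarrow> bool" where
  "symmetric_op X \<longleftrightarrow> (\<forall>x y. inner (X x) y = inner x (X y))"

definition nonneg_op :: "('a::real_inner \<Rightarrow>\<^sub>L 'a) \<Rightarrow> bool" where
  "nonneg_op X \<longleftrightarrow> symmetric_op X \<and> (\<forall>x. 0 \<le> inner x (X x))"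

definition orth_projection :: "('a::real_inner \<Rightarrow>\<^sub>L 'a) \<Rightarrow> bool" where
  "orth_projection P \<longleftrightarrow> symmetric_op P \<and> P o\<^sub>L P = P"

lemma symmetric_opD: "symmetric_op X \<Longrightarrow> inner (X x) y = inner x (X y)"
  by (simp add: symmetric_op_def)

lemma nonneg_op_symmetric: "nonneg_op X \<Longrightarrow> symmetric_op X"
  by (simp add: nonneg_op_def)

lemma nonneg_opD: "nonneg_op X \<Longrightarrow> 0 \<le> inner x (X x)"
  by (simp add: nonneg_op_def)

lemma symmetric_op_id [simp]: "symmetric_op id_blinfun"
  and symmetric_op_zero [simp]: "symmetric_op 0"
  and symmetric_op_add: "symmetric_op X \<Longrightarrow> symmetric_op Y \<Longrightarrow> symmetric_op (X + Y)"
  and symmetric_op_diff: "symmetric_op X \<Longrightarrow> symmetric_op Y \<Longrightarrow> symmetric_op (X - Y)"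
  and symmetric_op_minus: "symmetric_op X \<Longrightarrow> symmetric_op (- X)"
  and symmetric_op_scaleR: "symmetric_op X \<Longrightarrow> symmetric_op (r *\<^sub>R X)"
  by (auto simp: symmetric_op_def blinfun.bilinear_simps inner_simps)

lemma commute_apply: "X o\<^sub>L Y = Y o\<^sub>L X \<Longrightarrow> X (Y x) = Y (X x)"
  by (metis blinfun_apply_blinfun_compose)

lemma symmetric_op_compose:
  assumes "symmetric_op X" "symmetric_op Y" "X o\<^sub>L Y = Y o\<^sub>L X"
  shows "symmetric_op (X o\<^sub>L Y)"
  using assms(1,2) commute_apply[OF assms(3)] by (auto simp: symmetric_op_def)

lemmas symmetric_op_intros =
  symmetric_op_add symmetric_op_diff symmetric_op_minus symmetric_op_scaleR

lemma nonneg_op_id [simp]: "nonneg_op id_blinfun"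
  and nonneg_op_zero [simp]: "nonneg_op 0"
  and nonneg_op_add: "nonneg_op X \<Longrightarrow> nonneg_op Y \<Longrightarrow> nonneg_op (X + Y)"
  and nonneg_op_scaleR: "nonneg_op X \<Longrightarrow> 0 \<le> r \<Longrightarrow> nonneg_op (r *\<^sub>R X)"
  by (auto simp: nonneg_op_def blinfun.bilinear_simps inner_simps symmetric_op_add symmetric_op_scaleR)

lemma nonneg_op_sandwich:
  assumes "nonneg_op A" "symmetric_op S"
  shows "nonneg_op (S o\<^sub>L (A o\<^sub>L S))"
  using assms unfolding nonneg_op_def symmetric_op_def
  by (metis blinfun_apply_blinfun_compose)

lemma nonneg_op_square: "symmetric_op S \<Longrightarrow> nonneg_op (S o\<^sub>L S)"
  by (auto simp: nonneg_op_def symmetric_op_compose) (metis inner_ge_zero symmetric_opD)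

lemma orth_projection_symmetric: "orth_projection P \<Longrightarrow> symmetric_op P"
  and orth_projection_idem: "orth_projection P \<Longrightarrow> P o\<^sub>L P = P"
  and orth_projection_idem_apply: "orth_projection P \<Longrightarrow> P (P x) = P x"
  by (auto simp: orth_projection_def) (metis blinfun_apply_blinfun_compose)

lemma orth_projection_nonneg: "orth_projection P \<Longrightarrow> nonneg_op P"
  using nonneg_op_square[of P] by (simp add: orth_projection_def)

lemma orth_projection_compl:
  assumes "orth_projection P" shows "orth_projection (id_blinfun - P)"
  unfolding orth_projection_def
  by (auto intro!: symmetric_op_intros orth_projection_symmetric[OF assms] blinfun_eqI
      simp: blinfun.bilinear_simps orth_projection_idem_apply[OF assms])

lemma orth_projection_compose:
  assumes "orth_projection P" "orth_projection Q" "P o\<^sub>L Q = Q o\<^sub>L P"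
  shows "orth_projection (P o\<^sub>L Q)"
  unfolding orth_projection_def
proof
  show "symmetric_op (P o\<^sub>L Q)"
    by (intro symmetric_op_compose orth_projection_symmetric assms)
  show "P o\<^sub>L Q o\<^sub>L (P o\<^sub>L Q) = P o\<^sub>L Q"
    by (rule blinfun_eqI)
      (simp add: commute_apply[OF assms(3), symmetric] orth_projection_idem_apply assms(1,2))
qed

lemma symmetric_op_eq_0I:
  assumes "symmetric_op X" "\<And>x. inner x (X x) = 0"
  shows "X = 0"
proof (rule blinfun_eqI)
  fix x :: 'a
  have "inner (x + X x) (X (x + X x)) = 2 * inner (X x) (X x)"
    using assms(2)[of x] assms(2)[of "X x"]
    by (simp add: blinfun.bilinear_simps inner_simps flip: symmetric_opD[OF assms(1)])
  then show "blinfun_apply X x = blinfun_apply 0 x"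
    using assms(2)[of "x + X x"] by simp
qed

lemma nonneg_op_antisym: "nonneg_op X \<Longrightarrow> nonneg_op (- X) \<Longrightarrow> X = 0"
  by (rule symmetric_op_eq_0I)
    (auto simp: nonneg_op_symmetric blinfun.bilinear_simps dest!: nonneg_opD intro!: antisym)

lemma nonneg_op_trans: "nonneg_op (Y - X) \<Longrightarrow> nonneg_op (Z - Y) \<Longrightarrow> nonneg_op (Z - X)"
  using nonneg_op_add[of "Y - X" "Z - Y"] by simp

lemma norm_bound_symmetric_op:
  assumes "symmetric_op X" "norm X \<le> c"
  shows "nonneg_op (c *\<^sub>R id_blinfun - X)" "nonneg_op (c *\<^sub>R id_blinfun + X)"
proof -
  have "\<bar>inner x (X x)\<bar> \<le> c * inner x x" for x
  proof -
    have "\<bar>inner x (X x)\<bar> \<le> norm x * norm (X x)"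
      by (rule Cauchy_Schwarz_ineq2)
    also have "\<dots> \<le> norm x * (c * norm x)"
      by (intro mult_left_mono order_trans[OF norm_blinfun] mult_right_mono assms) auto
    finally show ?thesis
      by (simp add: power2_norm_eq_inner[symmetric] power2_eq_square mult_ac)
  qed
  note * = abs_le_D1[OF this] abs_le_D2[OF this]
  show "nonneg_op (c *\<^sub>R id_blinfun - X)" "nonneg_op (c *\<^sub>R id_blinfun + X)"
    using * by (auto simp: nonneg_op_def blinfun.bilinear_simps inner_simps algebra_simps
        intro!: symmetric_op_intros assms) (smt (verit))
qed

text \<open>Riesz--Nagy: for \<open>0 \<le> N \<le> 1\<close> the recursion \<open>K\<^sub>0 = N\<close>, \<open>K\<^sub>n\<^sub>+\<^sub>1 = K\<^sub>n - K\<^sub>n\<^sup>2\<close> writes \<open>N\<close> as the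
  strongly convergent sum of the squares \<open>K\<^sub>n\<^sup>2\<close>, and \<open>\<langle>x, A K\<^sub>n\<^sup>2 x\<rangle> = \<langle>K\<^sub>n x, A K\<^sub>n x\<rangle> \<ge> 0\<close>.\<close>

lemma nonneg_op_compose:
  assumes N: "nonneg_op N" and A: "nonneg_op A" and comm: "N o\<^sub>L A = A o\<^sub>L N"
  shows "nonneg_op (N o\<^sub>L A)"
proof -
  define c where "c = norm N + 1"
  have c: "c > 0" by (simp add: c_def add_nonneg_pos)
  define K where "K = rec_nat ((1 / c) *\<^sub>R N) (\<lambda>_ X. X - (X o\<^sub>L X))"
  have K0: "K 0 = (1 / c) *\<^sub>R N" and KSuc: "K (Suc n) = K n - (K n o\<^sub>L K n)" for n
    by (simp_all add: K_def)
  have K: "nonneg_op (K n) \<and> nonneg_op (id_blinfun - K n) \<and> K n o\<^sub>L A = A o\<^sub>L K n" for n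
  proof (induction n)
    case 0
    have "id_blinfun - K 0 = (1 / c) *\<^sub>R (c *\<^sub>R id_blinfun - N)"
      using c by (simp add: K0 scaleR_diff_right)
    moreover have "nonneg_op (c *\<^sub>R id_blinfun - N)"
      by (rule norm_bound_symmetric_op) (auto simp: N nonneg_op_symmetric c_def)
    ultimately show ?case
      using c N comm
      by (auto simp: K0 intro!: nonneg_op_scaleR blinfun_eqI
          simp: blinfun.bilinear_simps commute_apply[OF comm])
  next
    case (Suc n)
    let ?K = "K n" and ?J = "id_blinfun - K n"
    have K: "nonneg_op ?K" and J: "nonneg_op ?J" and cA: "?K o\<^sub>L A = A o\<^sub>L ?K"
      using Suc.IH by auto
    have "K (Suc n) = (?K o\<^sub>L (?J o\<^sub>L ?K)) + (?J o\<^sub>L (?K o\<^sub>L ?J))"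
      by (rule blinfun_eqI) (simp add: KSuc blinfun.bilinear_simps algebra_simps)
    then have "nonneg_op (K (Suc n))"
      using K J by (simp add: nonneg_op_add nonneg_op_sandwich nonneg_op_symmetric)
    moreover have "id_blinfun - K (Suc n) = ?J + (?K o\<^sub>L ?K)"
      by (simp add: KSuc)
    then have "nonneg_op (id_blinfun - K (Suc n))"
      using K J by (metis nonneg_op_add nonneg_op_square nonneg_op_symmetric)
    moreover have "K (Suc n) o\<^sub>L A = A o\<^sub>L K (Suc n)"
      by (rule blinfun_eqI) (simp add: KSuc blinfun.bilinear_simps commute_apply[OF cA])
    ultimately show ?case by blast
  qed
  have Ksym: "inner (K n x) y = inner x (K n y)" for n x y
    using K by (simp add: nonneg_op_symmetric symmetric_opD)
  have Kcomm: "A (K n x) = K n (A x)" for n x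
    using K commute_apply by metis
  have dec: "inner x (B (K 0 x)) = inner x (B (K n x)) + (\<Sum>k<n. inner (K k x) (B (K k x)))"
    if "\<And>n x. B (K n x) = K n (B x)" for B :: "'a \<Rightarrow>\<^sub>L 'a" and n x
    by (induction n) (simp_all add: KSuc blinfun.bilinear_simps inner_simps that Ksym)
  have lim: "(\<lambda>n. K n x) \<longlonglongrightarrow> 0" for x
  proof -
    have "summable (\<lambda>k. inner (K k x) (K k x))"
    proof (rule summableI_nonneg_bounded)
      show "(\<Sum>k<n. inner (K k x) (K k x)) \<le> inner x (K 0 x)" for n
        using dec[of id_blinfun x n] K[of n] nonneg_opD[of "K n" x] by simp
    qed simp
    then have "(\<lambda>k. (norm (K k x))\<^sup>2) \<longlonglongrightarrow> 0"
      using summable_LIMSEQ_zero by (simp add: power2_norm_eq_inner)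
    then have "(\<lambda>k. sqrt ((norm (K k x))\<^sup>2)) \<longlonglongrightarrow> sqrt 0"
      by (rule tendsto_real_sqrt)
    then show ?thesis
      by (simp add: tendsto_norm_zero_iff)
  qed
  have "0 \<le> inner x (A (K 0 x))" for x
  proof (rule LIMSEQ_le_const2)
    have "(\<lambda>n. inner x (A (K n x))) \<longlonglongrightarrow> inner x (A 0)"
      by (intro tendsto_intros lim)
    then show "(\<lambda>n. inner x (A (K n x))) \<longlonglongrightarrow> 0" by (simp add: blinfun.bilinear_simps)
    show "\<exists>m. \<forall>n\<ge>m. inner x (A (K n x)) \<le> inner x (A (K 0 x))"
    proof (intro exI allI impI)
      fix n
      have "0 \<le> (\<Sum>k<n. inner (K k x) (A (K k x)))"
        by (intro sum_nonneg nonneg_opD[OF A])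
      then show "inner x (A (K n x)) \<le> inner x (A (K 0 x))"
        using dec[of A x n, OF Kcomm] by linarith
    qed
  qed
  then have "0 \<le> inner x (A (N x)) / c" for x
    by (simp add: K0 blinfun.bilinear_simps)
  then have "0 \<le> inner x (A (N x))" for x
    using c by (simp add: zero_le_divide_iff)
  then show ?thesis
    using symmetric_op_compose[of N A] N A comm commute_apply[OF comm] by (simp add: nonneg_op_def)
qed

lemma nonneg_op_norm_square_le:
  assumes "nonneg_op X" "nonneg_op (c *\<^sub>R id_blinfun - X)"
  shows "(norm (X x))\<^sup>2 \<le> c * inner x (X x)"
proof -
  have "nonneg_op (X o\<^sub>L (c *\<^sub>R id_blinfun - X))"
    by (rule nonneg_op_compose[OF assms]) (auto intro!: blinfun_eqI simp: blinfun.bilinear_simps)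
  from nonneg_opD[OF this, of x] show ?thesis
    using symmetric_opD[OF nonneg_op_symmetric[OF assms(1)], of x "X x"]
    by (simp add: blinfun.bilinear_simps inner_simps power2_norm_eq_inner)
qed

lemma nonneg_op_norm_le:
  assumes "nonneg_op X" "nonneg_op (c *\<^sub>R id_blinfun - X)" "c \<ge> 0"
  shows "norm X \<le> c"
proof (rule norm_blinfun_bound[OF assms(3)])
  fix x
  have "(norm (X x))\<^sup>2 \<le> c * inner x (X x)"
    by (rule nonneg_op_norm_square_le[OF assms(1,2)])
  also have "\<dots> \<le> c * (c * inner x x)"
    using nonneg_opD[OF assms(2), of x] assms(3)
    by (intro mult_left_mono) (auto simp: blinfun.bilinear_simps inner_simps)
  also have "\<dots> = (c * norm x)\<^sup>2"
    by (simp add: power2_norm_eq_inner[symmetric] power2_eq_square mult_ac)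
  finally show "norm (X x) \<le> c * norm x"
    by (rule power2_le_imp_le) (simp add: assms)
qed

subsection \<open>Strong limits\<close>

lemma strong_limit_nonneg:
  fixes X :: "'b \<Rightarrow> 'a::real_inner \<Rightarrow>\<^sub>L 'a" and Y :: "'a \<Rightarrow>\<^sub>L 'a"
  assumes "\<And>x. ((\<lambda>n. X n x) \<longlongrightarrow> Y x) F" "\<forall>\<^sub>F n in F. nonneg_op (X n)" "F \<noteq> bot"
  shows "nonneg_op Y"
proof -
  have "inner (Y x) y = inner x (Y y)" for x y
  proof (rule tendsto_unique[OF assms(3)])
    show "((\<lambda>n. inner (X n x) y) \<longlongrightarrow> inner (Y x) y) F" by (intro tendsto_intros assms)
    have "((\<lambda>n. inner x (X n y)) \<longlongrightarrow> inner x (Y y)) F" by (intro tendsto_intros assms)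
    then show "((\<lambda>n. inner (X n x) y) \<longlongrightarrow> inner x (Y y)) F"
      by (rule Lim_transform_eventually)
        (use assms(2) in eventually_elim, simp add: nonneg_op_symmetric symmetric_opD)
  qed
  moreover have "0 \<le> inner x (Y x)" for x
  proof (rule tendsto_lowerbound[OF _ _ assms(3)])
    show "((\<lambda>n. inner x (X n x)) \<longlongrightarrow> inner x (Y x)) F" by (intro tendsto_intros assms)
    show "\<forall>\<^sub>F n in F. 0 \<le> inner x (X n x)"
      using assms(2) by eventually_elim (rule nonneg_opD)
  qed
  ultimately show ?thesis by (simp add: nonneg_op_def symmetric_op_def)
qed

lemma strong_limit_compose:
  fixes X Y :: "nat \<Rightarrow> 'a::real_normed_vector \<Rightarrow>\<^sub>L 'a" and X' Y' :: "'a \<Rightarrow>\<^sub>L 'a"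
  assumes "\<And>x. (\<lambda>n. X n x) \<longlonglongrightarrow> X' x" "\<And>x. (\<lambda>n. Y n x) \<longlonglongrightarrow> Y' x" "\<And>n. norm (X n) \<le> c"
  shows "(\<lambda>n. X n (Y n x)) \<longlonglongrightarrow> X' (Y' x)"
proof -
  have "(\<lambda>n. X n (Y n x - Y' x)) \<longlonglongrightarrow> 0"
  proof (rule Lim_null_comparison)
    show "\<forall>\<^sub>F n in sequentially. norm (X n (Y n x - Y' x)) \<le> c * norm (Y n x - Y' x)"
      by (intro always_eventually allI order_trans[OF norm_blinfun] mult_right_mono assms) auto
    have "(\<lambda>n. c * norm (Y n x - Y' x)) \<longlonglongrightarrow> c * norm (Y' x - Y' x)"
      by (intro tendsto_intros assms)
    then show "(\<lambda>n. c * norm (Y n x - Y' x)) \<longlonglongrightarrow> 0" by simp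
  qed
  from tendsto_add[OF this assms(1)[of "Y' x"]] show ?thesis
    by (simp add: blinfun.bilinear_simps)
qed

lemma increasing_strong_limit:
  fixes X :: "nat \<Rightarrow> 'a::{real_inner,complete_space} \<Rightarrow>\<^sub>L 'a"
  assumes pos: "\<And>n. nonneg_op (X n)" and le1: "\<And>n. nonneg_op (id_blinfun - X n)"
    and inc: "\<And>n. nonneg_op (X (Suc n) - X n)"
  obtains Y :: "'a \<Rightarrow>\<^sub>L 'a" where "\<And>x. (\<lambda>n. X n x) \<longlonglongrightarrow> Y x"
proof -
  have mono: "nonneg_op (X n - X m)" if "m \<le> n" for m n
    using that
  proof (induction n rule: dec_induct)
    case (step n)
    show ?case by (rule nonneg_op_trans[OF step.IH inc])
  qed simp
  have diff: "(norm (X n x - X m x))\<^sup>2 \<le> inner x (X n x) - inner x (X m x)" if "m \<le> n" for m n x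
  proof -
    have "1 *\<^sub>R id_blinfun - (X n - X m) = (id_blinfun - X n) + X m" by simp
    then have "nonneg_op (1 *\<^sub>R id_blinfun - (X n - X m))"
      using nonneg_op_add[OF le1 pos] by metis
    from nonneg_op_norm_square_le[OF mono[OF that] this, of x] show ?thesis
      by (simp add: blinfun.bilinear_simps inner_simps)
  qed
  have conv: "convergent (\<lambda>n. X n x)" for x
  proof (rule Cauchy_convergent, rule metric_CauchyI)
    fix e :: real assume "e > 0"
    have inc': "incseq (\<lambda>n. inner x (X n x))"
      by (rule incseq_SucI) (use nonneg_opD[OF inc] in \<open>auto simp: blinfun.bilinear_simps inner_simps\<close>)
    have "inner x (X n x) \<le> inner x x" for n
      using nonneg_opD[OF le1, of x n] by (simp add: blinfun.bilinear_simps inner_simps)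
    then have "convergent (\<lambda>n. inner x (X n x))"
      by (metis incseq_convergent[OF inc'] convergent_def)
    then have "Cauchy (\<lambda>n. inner x (X n x))"
      by (rule convergent_Cauchy)
    then obtain M where M: "\<And>m n. m \<ge> M \<Longrightarrow> n \<ge> M \<Longrightarrow> dist (inner x (X m x)) (inner x (X n x)) < e\<^sup>2"
      using \<open>e > 0\<close> unfolding Cauchy_def by (meson zero_less_power)
    have less: "norm (X n x - X m x) < e" if "M \<le> m" "m \<le> n" for m n
    proof (rule power_less_imp_less_base)
      show "(norm (X n x - X m x))\<^sup>2 < e\<^sup>2"
        using diff[of m n x] M[of m n] that by (auto simp: dist_real_def)
    qed (use \<open>e > 0\<close> in simp)
    show "\<exists>M. \<forall>m\<ge>M. \<forall>n\<ge>M. dist (X m x) (X n x) < e"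
      by (rule exI[of _ M]) (metis dist_norm less norm_minus_commute nle_le)
  qed
  define g where "g x = lim (\<lambda>n. X n x)" for x
  have g: "(\<lambda>n. X n x) \<longlonglongrightarrow> g x" for x
    using conv by (simp add: g_def convergent_LIMSEQ_iff)
  have "bounded_linear g"
  proof (rule bounded_linear_intro[where K = 1])
    show "g (x + y) = g x + g y" for x y
      using tendsto_add[OF g[of x] g[of y]] g[of "x + y"]
      by (simp add: blinfun.bilinear_simps LIMSEQ_unique)
    show "g (r *\<^sub>R x) = r *\<^sub>R g x" for r x
      using tendsto_scaleR[OF tendsto_const g[of x]] g[of "r *\<^sub>R x"]
      by (simp add: blinfun.bilinear_simps LIMSEQ_unique)
    show "norm (g x) \<le> norm x * 1" for x
    proof (rule LIMSEQ_le_const2[OF tendsto_norm[OF g]])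
      have "norm (X n) \<le> 1" for n
        by (rule nonneg_op_norm_le) (use pos le1 in auto)
      then show "\<exists>N. \<forall>n\<ge>N. norm (X n x) \<le> norm x * 1"
        by (metis mult.commute mult_left_mono norm_blinfun norm_ge_zero order_trans)
    qed
  qed
  then show ?thesis
    using that[of "Blinfun g"] g by (simp add: bounded_linear_Blinfun_apply)
qed

text \<open>A von Neumann algebra, a commutant, and the set of complex-linear operators are all of this
  kind; limits of sequences suffice below.\<close>

definition strongly_closed_algebra :: "('a::real_normed_vector \<Rightarrow>\<^sub>L 'a) set \<Rightarrow> bool" where
  "strongly_closed_algebra C \<longleftrightarrow> id_blinfun \<in> C \<and> (\<forall>X\<in>C. \<forall>Y\<in>C. X + Y \<in> C) \<and>
     (\<forall>r. \<forall>X\<in>C. r *\<^sub>R X \<in> C) \<and> (\<forall>X\<in>C. \<forall>Y\<in>C. X o\<^sub>L Y \<in> C) \<and>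
     (\<forall>X Y. (\<forall>n::nat. X n \<in> C) \<and> (\<forall>x. (\<lambda>n. blinfun_apply (X n) x) \<longlonglongrightarrow> blinfun_apply Y x) \<longrightarrow> Y \<in> C)"

lemma strongly_closed_algebra_intros:
  assumes "strongly_closed_algebra C"
  shows "id_blinfun \<in> C" "0 \<in> C" "X \<in> C \<Longrightarrow> Y \<in> C \<Longrightarrow> X + Y \<in> C"
    "X \<in> C \<Longrightarrow> Y \<in> C \<Longrightarrow> X - Y \<in> C" "X \<in> C \<Longrightarrow> - X \<in> C" "X \<in> C \<Longrightarrow> r *\<^sub>R X \<in> C"
    "X \<in> C \<Longrightarrow> Y \<in> C \<Longrightarrow> X o\<^sub>L Y \<in> C"
proof -
  show "id_blinfun \<in> C" "X \<in> C \<Longrightarrow> Y \<in> C \<Longrightarrow> X + Y \<in> C" "X \<in> C \<Longrightarrow> Y \<in> C \<Longrightarrow> X o\<^sub>L Y \<in> C"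
    using assms by (auto simp: strongly_closed_algebra_def)
  have scale: "X \<in> C \<Longrightarrow> r *\<^sub>R X \<in> C" for X r
    using assms by (auto simp: strongly_closed_algebra_def)
  show "X \<in> C \<Longrightarrow> r *\<^sub>R X \<in> C" by (rule scale)
  show "X \<in> C \<Longrightarrow> - X \<in> C" using scale[of X "-1"] by simp
  show "0 \<in> C" using scale[of id_blinfun 0] assms by (simp add: strongly_closed_algebra_def)
  show "X \<in> C \<Longrightarrow> Y \<in> C \<Longrightarrow> X - Y \<in> C"
    using scale[of Y "-1"] assms unfolding strongly_closed_algebra_def
    by (metis scaleR_minus1_left uminus_add_conv_diff add.commute)
qed

lemma strongly_closed_algebra_limit:
  fixes X :: "nat \<Rightarrow> 'a::real_normed_vector \<Rightarrow>\<^sub>L 'a" and Y :: "'a \<Rightarrow>\<^sub>L 'a"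
  assumes "strongly_closed_algebra C" "\<And>n. X n \<in> C" "\<And>x. (\<lambda>n. X n x) \<longlonglongrightarrow> Y x"
  shows "Y \<in> C"
  using assms unfolding strongly_closed_algebra_def by blast

lemma strongly_closed_algebra_UNIV: "strongly_closed_algebra UNIV"
  by (simp add: strongly_closed_algebra_def)

lemma strongly_closed_algebra_commutant:
  "strongly_closed_algebra {X :: 'a::real_normed_vector \<Rightarrow>\<^sub>L 'a. X o\<^sub>L S = S o\<^sub>L X}"
  unfolding strongly_closed_algebra_def
proof (intro conjI ballI allI impI; (elim conjE)?; unfold mem_Collect_eq)
  fix X :: "nat \<Rightarrow> 'a \<Rightarrow>\<^sub>L 'a" and Y :: "'a \<Rightarrow>\<^sub>L 'a"
  assume X: "\<forall>n. X n o\<^sub>L S = S o\<^sub>L X n" and lim: "\<forall>x. (\<lambda>n. X n x) \<longlonglongrightarrow> Y x"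
  show "Y o\<^sub>L S = S o\<^sub>L Y"
  proof (rule blinfun_eqI)
    fix x
    have 1: "(\<lambda>n. S (X n x)) \<longlonglongrightarrow> S (Y x)"
      using lim by (intro bounded_linear.tendsto[OF blinfun.bounded_linear_right]) blast
    have 2: "(\<lambda>n. X n (S x)) \<longlonglongrightarrow> Y (S x)"
      using lim by blast
    have "S (X n x) = X n (S x)" for n
      using X commute_apply by metis
    then show "(Y o\<^sub>L S) x = (S o\<^sub>L Y) x"
      using LIMSEQ_unique[OF 2] 1 by simp
  qed
qed (auto intro!: blinfun_eqI simp: blinfun.bilinear_simps commute_apply)

primrec op_pow :: "('a::real_normed_vector \<Rightarrow>\<^sub>L 'a) \<Rightarrow> nat \<Rightarrow> 'a \<Rightarrow>\<^sub>L 'a" where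
  "op_pow X 0 = id_blinfun"
| "op_pow X (Suc n) = X o\<^sub>L op_pow X n"

lemma op_pow_mem: "strongly_closed_algebra C \<Longrightarrow> X \<in> C \<Longrightarrow> op_pow X n \<in> C"
  by (induction n) (auto intro: strongly_closed_algebra_intros)

lemma op_pow_commute: "X o\<^sub>L Y = Y o\<^sub>L X \<Longrightarrow> op_pow X n o\<^sub>L Y = Y o\<^sub>L op_pow X n"
  using op_pow_mem[OF strongly_closed_algebra_commutant, of X Y n] by simp

lemma op_pow_nonneg: "nonneg_op X \<Longrightarrow> nonneg_op (op_pow X n)"
  by (induction n) (simp_all add: nonneg_op_compose op_pow_commute)

lemma op_pow_add: "op_pow X (m + n) = op_pow X m o\<^sub>L op_pow X n"
  by (induction m) (auto intro!: blinfun_eqI)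

text \<open>The projection is \<open>lim\<^sub>n (1 - c M\<^sup>2)\<^sup>n\<close> for a small \<open>c > 0\<close>.\<close>

lemma kernel_projection:
  fixes M :: "'a::{real_inner,complete_space} \<Rightarrow>\<^sub>L 'a"
  assumes M: "symmetric_op M"
  obtains P where "orth_projection P" "M o\<^sub>L P = 0" "\<And>Y :: 'a \<Rightarrow>\<^sub>L 'a. M o\<^sub>L Y = 0 \<Longrightarrow> P o\<^sub>L Y = Y"
    "\<And>C. strongly_closed_algebra C \<Longrightarrow> M \<in> C \<Longrightarrow> P \<in> C"
proof -
  define c where "c = 1 / ((norm M)\<^sup>2 + 1)"
  have c: "c > 0" by (simp add: c_def add_nonneg_pos)
  define X where "X = id_blinfun - c *\<^sub>R (M o\<^sub>L M)"
  have M2: "nonneg_op (M o\<^sub>L M)" by (rule nonneg_op_square[OF M])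
  have X1: "nonneg_op (id_blinfun - X)"
    using c by (simp add: X_def nonneg_op_scaleR M2)
  have X: "nonneg_op X"
  proof -
    have "norm (c *\<^sub>R (M o\<^sub>L M)) \<le> c * (norm M * norm M)"
      using c by (simp add: norm_blinfun_compose)
    also have "\<dots> \<le> 1"
      by (simp add: c_def power2_eq_square divide_simps add_nonneg_pos)
    finally show ?thesis
      using norm_bound_symmetric_op(1)[of "c *\<^sub>R (M o\<^sub>L M)" 1] M2
      by (simp add: X_def symmetric_op_intros nonneg_op_symmetric)
  qed
  have dec: "nonneg_op (op_pow X n - op_pow X (Suc n))" for n
  proof -
    have "op_pow X n - op_pow X (Suc n) = (id_blinfun - X) o\<^sub>L op_pow X n"
      by (rule blinfun_eqI) (simp add: blinfun.bilinear_simps)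
    moreover have "(id_blinfun - X) o\<^sub>L op_pow X n = op_pow X n o\<^sub>L (id_blinfun - X)"
      by (rule blinfun_eqI) (simp add: blinfun.bilinear_simps commute_apply[OF op_pow_commute[of X X n]])
    ultimately show ?thesis
      using nonneg_op_compose[OF X1 op_pow_nonneg[OF X]] by simp
  qed
  have le1: "nonneg_op (id_blinfun - op_pow X n)" for n
    by (induction n) (use nonneg_op_trans[OF dec] in auto)
  obtain Q :: "'a \<Rightarrow>\<^sub>L 'a" where Q: "\<And>x. (\<lambda>n. (id_blinfun - op_pow X n) x) \<longlonglongrightarrow> Q x"
    by (rule increasing_strong_limit[of "\<lambda>n. id_blinfun - op_pow X n"])
      (use le1 op_pow_nonneg[OF X] dec in auto)
  define P where "P = id_blinfun - Q"
  have P: "(\<lambda>n. op_pow X n x) \<longlonglongrightarrow> P x" for x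
    using tendsto_diff[OF tendsto_const[of x] Q[of x]] by (simp add: P_def blinfun.bilinear_simps)
  have norm1: "norm (op_pow X n) \<le> 1" for n
    by (rule nonneg_op_norm_le) (use op_pow_nonneg[OF X] le1 in auto)
  have "P (P x) = P x" for x
  proof (rule LIMSEQ_unique)
    show "(\<lambda>n. op_pow X n (op_pow X n x)) \<longlonglongrightarrow> P (P x)"
      by (rule strong_limit_compose[OF P P norm1])
    have "(\<lambda>n. op_pow X (n + n) x) \<longlonglongrightarrow> P x"
      by (rule LIMSEQ_subseq_LIMSEQ[OF P, unfolded o_def]) (simp add: strict_mono_def)
    then show "(\<lambda>n. op_pow X n (op_pow X n x)) \<longlonglongrightarrow> P x"
      by (simp add: op_pow_add)
  qed
  moreover have Pnn: "nonneg_op P"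
    by (rule strong_limit_nonneg[OF P]) (auto simp: op_pow_nonneg X)
  ultimately have proj: "orth_projection P"
    by (auto simp: orth_projection_def nonneg_op_symmetric intro!: blinfun_eqI)
  have "X (P x) = P x" for x
  proof (rule LIMSEQ_unique)
    show "(\<lambda>n. X (op_pow X n x)) \<longlonglongrightarrow> X (P x)" by (intro tendsto_intros P)
    show "(\<lambda>n. X (op_pow X n x)) \<longlonglongrightarrow> P x" using LIMSEQ_Suc[OF P[of x]] by simp
  qed
  then have "M (M (P x)) = 0" for x
    using c by (simp add: X_def blinfun.bilinear_simps)
  then have "inner (M (P x)) (M (P x)) = 0" for x
    by (simp add: symmetric_opD[OF M])
  then have MP: "M o\<^sub>L P = 0"
    by (intro blinfun_eqI) simp
  show ?thesis
  proof (rule that[OF proj MP])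
    fix Y :: "'a \<Rightarrow>\<^sub>L 'a" assume Y: "M o\<^sub>L Y = 0"
    have "M (Y x) = 0" for x
      using Y by (metis blinfun_apply_blinfun_compose blinfun.zero_left)
    then have "op_pow X n (Y x) = Y x" for n x
      by (induction n) (simp_all add: X_def blinfun.bilinear_simps)
    then have "P (Y x) = Y x" for x
      using P[of "Y x"] by (simp add: LIMSEQ_const_iff)
    then show "P o\<^sub>L Y = Y" by (intro blinfun_eqI) simp
  next
    fix C assume "strongly_closed_algebra C" "M \<in> C"
    then show "P \<in> C"
      by (intro strongly_closed_algebra_limit[OF _ _ P] op_pow_mem)
        (simp_all add: X_def strongly_closed_algebra_intros)
  qed
qed

text \<open>After scaling to \<open>norm Z \<le> 1\<close>, the operator \<open>Y = 1 - \<bar>Z\<bar>\<close> is the increasing limit of the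
  iteration \<open>Y \<mapsto> (1 - Z\<^sup>2 + Y\<^sup>2) / 2\<close> started at \<open>0\<close>.\<close>

lemma absolute_value_exists:
  fixes Z :: "'a::{real_inner,complete_space} \<Rightarrow>\<^sub>L 'a"
  assumes Z: "symmetric_op Z"
  obtains W where "nonneg_op W" "W o\<^sub>L W = Z o\<^sub>L Z"
    "\<And>C. strongly_closed_algebra C \<Longrightarrow> Z \<in> C \<Longrightarrow> W \<in> C"
proof -
  define c where "c = norm Z + 1"
  have c: "c > 0" by (simp add: c_def add_nonneg_pos)
  define X where "X = id_blinfun - (1 / c\<^sup>2) *\<^sub>R (Z o\<^sub>L Z)"
  have Z2: "nonneg_op (Z o\<^sub>L Z)" by (rule nonneg_op_square[OF Z])
  have X1: "nonneg_op (id_blinfun - X)"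
    using c by (simp add: X_def nonneg_op_scaleR Z2)
  have X: "nonneg_op X"
  proof -
    have "norm ((1 / c\<^sup>2) *\<^sub>R (Z o\<^sub>L Z)) \<le> (1 / c\<^sup>2) * (norm Z * norm Z)"
      using c by (simp add: norm_blinfun_compose divide_right_mono)
    also have "\<dots> \<le> (1 / c\<^sup>2) * (c * c)"
      by (intro mult_left_mono mult_mono) (auto simp: c_def)
    also have "\<dots> = 1"
      using c by (simp add: power2_eq_square)
    finally show ?thesis
      using norm_bound_symmetric_op(1)[of "(1 / c\<^sup>2) *\<^sub>R (Z o\<^sub>L Z)" 1] Z2
      by (simp add: X_def symmetric_op_intros nonneg_op_symmetric)
  qed
  define Y where "Y = rec_nat 0 (\<lambda>_ U. (1 / 2) *\<^sub>R (X + (U o\<^sub>L U)))"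
  have Y0: "Y 0 = 0" and YS: "Y (Suc n) = (1 / 2) *\<^sub>R (X + (Y n o\<^sub>L Y n))" for n
    by (simp_all add: Y_def)
  have memC: "Y n \<in> C" if "strongly_closed_algebra C" "X \<in> C" for n C
    by (induction n) (auto simp: Y0 YS strongly_closed_algebra_intros that)
  have YX: "X o\<^sub>L Y m = Y m o\<^sub>L X" for m
    using memC[OF strongly_closed_algebra_commutant[of X]] by simp
  have YY: "Y n o\<^sub>L Y m = Y m o\<^sub>L Y n" for m n
    using memC[OF strongly_closed_algebra_commutant[of "Y m"]] YX by simp
  note Yc = commute_apply[OF YY]
  have Y: "nonneg_op (Y n)" for n
    by (induction n)
      (auto simp: Y0 YS intro!: nonneg_op_scaleR nonneg_op_add X nonneg_op_square intro: nonneg_op_symmetric)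
  have Y1: "nonneg_op (id_blinfun - Y n)" for n
  proof (induction n)
    case (Suc n)
    have "id_blinfun - Y (Suc n) =
        (1 / 2) *\<^sub>R ((id_blinfun - X) + ((id_blinfun - Y n) o\<^sub>L (id_blinfun + Y n)))"
      by (rule blinfun_eqI) (simp add: YS blinfun.bilinear_simps algebra_simps flip: scaleR_add_left)
    moreover have "nonneg_op ((id_blinfun - Y n) o\<^sub>L (id_blinfun + Y n))"
      by (rule nonneg_op_compose[OF Suc.IH nonneg_op_add[OF nonneg_op_id Y]])
        (auto intro!: blinfun_eqI simp: blinfun.bilinear_simps)
    ultimately show ?case
      by (auto intro!: nonneg_op_scaleR nonneg_op_add X1)
  qed (simp add: Y0)
  have inc: "nonneg_op (Y (Suc n) - Y n)" for n
  proof (induction n)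
    case 0
    show ?case using Y[of 1] by (simp add: Y0)
  next
    case (Suc n)
    have "Y (Suc (Suc n)) - Y (Suc n) = (1 / 2) *\<^sub>R ((Y (Suc n) - Y n) o\<^sub>L (Y (Suc n) + Y n))"
      unfolding YS[of "Suc n"] by (subst (3) YS)
        (auto intro!: blinfun_eqI simp: blinfun.bilinear_simps Yc[of "Suc n" n] scaleR_diff_right[symmetric])
    moreover have "nonneg_op ((Y (Suc n) - Y n) o\<^sub>L (Y (Suc n) + Y n))"
      by (rule nonneg_op_compose[OF Suc.IH nonneg_op_add[OF Y Y]])
        (auto intro!: blinfun_eqI simp: blinfun.bilinear_simps Yc[of "Suc n" n])
    ultimately show ?case by (auto intro!: nonneg_op_scaleR)
  qed
  obtain U :: "'a \<Rightarrow>\<^sub>L 'a" where U: "\<And>x. (\<lambda>n. Y n x) \<longlonglongrightarrow> U x"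
    by (rule increasing_strong_limit[of Y]) (use Y Y1 inc in auto)
  have norm1: "norm (Y n) \<le> 1" for n
    by (rule nonneg_op_norm_le) (use Y Y1 in auto)
  have fix_U: "U x = (1 / 2) *\<^sub>R (X x + U (U x))" for x
  proof (rule LIMSEQ_unique)
    show "(\<lambda>n. Y (Suc n) x) \<longlonglongrightarrow> U x" by (rule LIMSEQ_Suc[OF U])
    show "(\<lambda>n. Y (Suc n) x) \<longlonglongrightarrow> (1 / 2) *\<^sub>R (X x + U (U x))"
      by (auto simp: YS blinfun.bilinear_simps intro!: tendsto_intros strong_limit_compose[OF U U norm1])
  qed
  define W where "W = c *\<^sub>R (id_blinfun - U)"
  have "nonneg_op (id_blinfun - U)"
    by (rule strong_limit_nonneg[where X = "\<lambda>n. id_blinfun - Y n" and F = sequentially])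
      (auto simp: Y1 blinfun.bilinear_simps intro!: tendsto_intros U)
  then have W: "nonneg_op W"
    using c by (simp add: W_def nonneg_op_scaleR)
  have UU: "U (U x) = 2 *\<^sub>R U x - X x" for x
    by (subst (3) fix_U) (simp add: scaleR_add_right)
  have WW: "W o\<^sub>L W = Z o\<^sub>L Z"
  proof (rule blinfun_eqI)
    fix x
    have "(W o\<^sub>L W) x = (c * c) *\<^sub>R (x - U x - (U x - U (U x)))"
      by (simp add: W_def blinfun.bilinear_simps algebra_simps)
    also have "x - U x - (U x - U (U x)) = (1 / c\<^sup>2) *\<^sub>R Z (Z x)"
      by (simp add: UU X_def blinfun.bilinear_simps algebra_simps scaleR_2)
    finally show "(W o\<^sub>L W) x = (Z o\<^sub>L Z) x"
      using c by (simp add: power2_eq_square)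
  qed
  show ?thesis
  proof (rule that[OF W WW])
    fix C assume C: "strongly_closed_algebra C" "Z \<in> C"
    then have "X \<in> C" by (simp add: X_def strongly_closed_algebra_intros)
    then have "U \<in> C"
      using C by (intro strongly_closed_algebra_limit[OF C(1) _ U] memC)
    then show "W \<in> C" using C by (simp add: W_def strongly_closed_algebra_intros)
  qed
qed

lemmas op_apply_simps = blinfun.bilinear_simps scaleR_diff_right scaleR_add_right

lemma orth_projection_norm_le:
  assumes "orth_projection P" shows "norm P \<le> 1"
  using orth_projection_nonneg[OF orth_projection_compl[OF assms]]
    nonneg_op_norm_le[OF orth_projection_nonneg[OF assms], of 1] by simp

lemma blinfun_compose_assoc: "(X o\<^sub>L Y) o\<^sub>L Z = X o\<^sub>L (Y o\<^sub>L Z)"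
  by (rule blinfun_eqI) simp

lemma compose_id_blinfun [simp]: "X o\<^sub>L id_blinfun = X" "id_blinfun o\<^sub>L X = X"
  by (rule blinfun_eqI, simp)+

lemma nonneg_op_sqrt_unique:
  assumes A: "nonneg_op A" and B: "nonneg_op B" and eq: "A o\<^sub>L A = B o\<^sub>L B"
  shows "A = B"
proof -
  define D where "D = A - B"
  have D: "symmetric_op D"
    by (simp add: D_def symmetric_op_diff nonneg_op_symmetric A B)
  have eq': "A (A x) = B (B x)" for x
    using eq by (metis blinfun_apply_blinfun_compose)
  have 1: "A (D x) = - D (B x)" and 2: "D (A x) = - B (D x)" for x
    by (simp_all add: D_def op_apply_simps eq')
  then have 3: "B (D x) = - D (A x)" and 4: "D (B x) = - A (D x)" for x
    by simp_all
  have DD: "nonneg_op (D o\<^sub>L D)" by (rule nonneg_op_square[OF D])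
  have "nonneg_op ((D o\<^sub>L D) o\<^sub>L A)"
    by (rule nonneg_op_compose[OF DD A]) (auto intro!: blinfun_eqI simp: 1 2 op_apply_simps)
  moreover have "(D o\<^sub>L D) o\<^sub>L A = - (D o\<^sub>L (B o\<^sub>L D))"
    by (rule blinfun_eqI) (simp add: 2 op_apply_simps)
  ultimately have "D o\<^sub>L (B o\<^sub>L D) = 0"
    using nonneg_op_antisym[OF nonneg_op_sandwich[OF B D]] by simp
  then have DBD: "D (B (D x)) = 0" for x
    by (metis blinfun_apply_blinfun_compose blinfun.zero_left)
  have "nonneg_op ((D o\<^sub>L D) o\<^sub>L B)"
    by (rule nonneg_op_compose[OF DD B]) (auto intro!: blinfun_eqI simp: 3 4 op_apply_simps)
  moreover have "(D o\<^sub>L D) o\<^sub>L B = - (D o\<^sub>L (A o\<^sub>L D))"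
    by (rule blinfun_eqI) (simp add: 4 op_apply_simps)
  ultimately have "D o\<^sub>L (A o\<^sub>L D) = 0"
    using nonneg_op_antisym[OF nonneg_op_sandwich[OF A D]] by simp
  then have DAD: "D (A (D x)) = 0" for x
    by (metis blinfun_apply_blinfun_compose blinfun.zero_left)
  have "D (D (D x)) = D (A (D x)) - D (B (D x))" for x
    by (simp add: D_def op_apply_simps)
  then have DDD: "D (D (D x)) = 0" for x by (simp add: DBD DAD)
  have "inner (D (D x)) (D (D x)) = inner (D x) (D (D (D x)))" for x
    by (rule symmetric_opD[OF D])
  then have DD0: "D (D x) = 0" for x by (simp add: DDD)
  have "inner (D x) (D x) = inner x (D (D x))" for x
    by (rule symmetric_opD[OF D])
  then have "D x = 0" for x by (simp add: DD0)
  then show ?thesis by (intro blinfun_eqI) (simp add: D_def op_apply_simps)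
qed

lemma invertible_nonneg_lower_bound:
  assumes T: "nonneg_op T" and B: "B o\<^sub>L T = id_blinfun"
  obtains a where "a > 0" "nonneg_op (T - a *\<^sub>R id_blinfun)"
proof -
  define c b where "c = norm T + 1" and "b = (norm B)\<^sup>2 + 1"
  have c: "c > 0" and b: "b > 0" by (simp_all add: c_def b_def add_nonneg_pos)
  have le: "inner x x \<le> b * c * inner x (T x)" for x
  proof -
    have T': "(norm (T x))\<^sup>2 \<le> c * inner x (T x)"
      by (rule nonneg_op_norm_square_le[OF T norm_bound_symmetric_op(1)])
        (simp_all add: T nonneg_op_symmetric c_def)
    have "x = B (T x)"
      using B by (metis blinfun_apply_blinfun_compose blinfun_apply_id_blinfun)
    then have "norm x \<le> norm B * norm (T x)"
      by (metis norm_blinfun)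
    then have "(norm x)\<^sup>2 \<le> (norm B)\<^sup>2 * (norm (T x))\<^sup>2"
      by (metis norm_ge_zero power_mono power_mult_distrib)
    also have "\<dots> \<le> b * (norm (T x))\<^sup>2"
      by (intro mult_right_mono) (auto simp: b_def)
    also have "\<dots> \<le> b * (c * inner x (T x))"
      using b by (intro mult_left_mono T') auto
    finally show ?thesis by (simp add: power2_norm_eq_inner)
  qed
  have "(1 / (b * c)) * inner x x \<le> inner x (T x)" for x
    using le[of x] b c by (simp add: field_simps)
  then have "nonneg_op (T - (1 / (b * c)) *\<^sub>R id_blinfun)"
    using T by (auto simp: nonneg_op_def op_apply_simps inner_simps intro!: symmetric_op_intros)
  then show ?thesis using that[of "1 / (b * c)"] b c by simp
qed

lemma spectral_projection_exists:
  fixes T :: "'a::{real_inner,complete_space} \<Rightarrow>\<^sub>L 'a"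
  assumes T: "symmetric_op T"
  obtains P where "orth_projection P"
    "nonneg_op ((s *\<^sub>R id_blinfun - T) o\<^sub>L P)"
    "nonneg_op ((T - s *\<^sub>R id_blinfun) o\<^sub>L (id_blinfun - P))"
    "\<And>C. strongly_closed_algebra C \<Longrightarrow> T \<in> C \<Longrightarrow> P \<in> C"
    "\<And>Q. orth_projection Q \<Longrightarrow> Q o\<^sub>L T = T o\<^sub>L Q \<Longrightarrow> nonneg_op ((s *\<^sub>R id_blinfun - T) o\<^sub>L Q) \<Longrightarrow>
       P o\<^sub>L Q = Q"
proof -
  define Z where "Z = T - s *\<^sub>R id_blinfun"
  have Z: "symmetric_op Z" by (simp add: Z_def symmetric_op_intros T)
  have memZ: "Z \<in> C" if "strongly_closed_algebra C" "T \<in> C" for C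
    using that by (simp add: Z_def strongly_closed_algebra_intros)
  have negZ: "s *\<^sub>R id_blinfun - T = - Z" by (simp add: Z_def)
  obtain W where W: "nonneg_op W" and WW: "W o\<^sub>L W = Z o\<^sub>L Z"
    and memW: "\<And>C. strongly_closed_algebra C \<Longrightarrow> Z \<in> C \<Longrightarrow> W \<in> C"
    by (rule absolute_value_exists[OF Z]) blast
  have WZ: "W o\<^sub>L Z = Z o\<^sub>L W"
    using memW[OF strongly_closed_algebra_commutant[of Z]] by simp
  note WW' = WW[THEN arg_cong[where f = "\<lambda>X. blinfun_apply X x" for x], simplified]
  define M where "M = W + Z"
  have M: "symmetric_op M" by (simp add: M_def symmetric_op_intros W Z nonneg_op_symmetric)
  have memM: "M \<in> C" if "strongly_closed_algebra C" "Z \<in> C" for C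
    using that memW by (simp add: M_def strongly_closed_algebra_intros)
  obtain P where P: "orth_projection P" and MP: "M o\<^sub>L P = 0"
    and kerM: "\<And>Y :: 'a \<Rightarrow>\<^sub>L 'a. M o\<^sub>L Y = 0 \<Longrightarrow> P o\<^sub>L Y = Y"
    and memP: "\<And>C. strongly_closed_algebra C \<Longrightarrow> M \<in> C \<Longrightarrow> P \<in> C"
    by (rule kernel_projection[OF M]) blast
  have comm: "P o\<^sub>L Y = Y o\<^sub>L P" if "Z o\<^sub>L Y = Y o\<^sub>L Z" for Y
    using memP[OF strongly_closed_algebra_commutant[of Y] memM[OF strongly_closed_algebra_commutant]]
      that by simp
  have PZ: "P o\<^sub>L Z = Z o\<^sub>L P" and PW: "P o\<^sub>L W = W o\<^sub>L P"
    by (simp_all add: comm WZ)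
  have MP': "W (P x) = - Z (P x)" for x
    using MP[THEN arg_cong[where f = "\<lambda>X. blinfun_apply X x"]]
    by (simp add: M_def op_apply_simps add_eq_0_iff2)
  have "M o\<^sub>L (W - Z) = 0"
    by (rule blinfun_eqI) (simp add: M_def op_apply_simps WW' commute_apply[OF WZ])
  from kerM[OF this] have N: "P (W x - Z x) = W x - Z x" for x
    by (metis blinfun_apply_blinfun_compose blinfun.diff_left)
  have N': "W (P x) - Z (P x) = W x - Z x" for x
    using N[of x] by (simp add: op_apply_simps commute_apply[OF PZ] commute_apply[OF PW])
  have ZP: "- Z o\<^sub>L P = W o\<^sub>L P"
    by (rule blinfun_eqI) (simp add: op_apply_simps MP')
  have ZP': "Z o\<^sub>L (id_blinfun - P) = W o\<^sub>L (id_blinfun - P)"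
    by (rule blinfun_eqI) (use N' in \<open>simp add: op_apply_simps algebra_simps\<close>)
  have P1: "nonneg_op (W o\<^sub>L P)"
    by (rule nonneg_op_compose) (simp_all add: W P orth_projection_nonneg PW)
  have P2: "nonneg_op (W o\<^sub>L (id_blinfun - P))"
    by (rule nonneg_op_compose)
      (auto simp: W P orth_projection_nonneg orth_projection_compl op_apply_simps
        commute_apply[OF PW] intro!: blinfun_eqI)
  show ?thesis
  proof (rule that[OF P])
    show "nonneg_op ((s *\<^sub>R id_blinfun - T) o\<^sub>L P)"
      using P1 by (simp add: negZ ZP)
    show "nonneg_op ((T - s *\<^sub>R id_blinfun) o\<^sub>L (id_blinfun - P))"
      using P2 by (simp add: ZP' flip: Z_def)
    show "P \<in> C" if "strongly_closed_algebra C" "T \<in> C" for C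
      using that by (intro memP memM memZ)
  next
    fix Q assume Q: "orth_projection Q" and QT: "Q o\<^sub>L T = T o\<^sub>L Q"
      and le: "nonneg_op ((s *\<^sub>R id_blinfun - T) o\<^sub>L Q)"
    have QZ: "Q o\<^sub>L Z = Z o\<^sub>L Q"
      by (rule blinfun_eqI) (simp add: Z_def op_apply_simps commute_apply[OF QT])
    have MQ: "M o\<^sub>L Q = Q o\<^sub>L M"
      using memM[OF strongly_closed_algebra_commutant[of Q]] QZ by simp
    have ZM: "Z o\<^sub>L M = M o\<^sub>L Z"
      using memM[OF strongly_closed_algebra_commutant[of Z]] by simp
    have "2 *\<^sub>R W (P x) = W x - Z x" for x
      using N'[of x] MP'[of x] by (simp add: scaleR_2)
    then have "M = 2 *\<^sub>R (W o\<^sub>L (id_blinfun - P))"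
      by (intro blinfun_eqI) (simp add: M_def op_apply_simps, simp add: scaleR_2)
    then have Mpos: "nonneg_op M"
      using nonneg_op_scaleR[OF P2, of 2] by simp
    have "nonneg_op (M o\<^sub>L ((s *\<^sub>R id_blinfun - T) o\<^sub>L Q))"
      by (rule nonneg_op_compose[OF Mpos le])
        (auto intro!: blinfun_eqI simp: negZ op_apply_simps commute_apply[OF ZM]
          commute_apply[OF MQ, symmetric])
    moreover have "M (M x) = 2 *\<^sub>R M (Z x)" for x
      by (simp add: M_def op_apply_simps WW' commute_apply[OF WZ] scaleR_2)
    then have "M (Z x) = (1 / 2) *\<^sub>R M (M x)" for x
      by simp
    ultimately have "inner x (M (M (Q x))) \<le> 0" for x
      using nonneg_opD[of "M o\<^sub>L ((s *\<^sub>R id_blinfun - T) o\<^sub>L Q)" x]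
      by (simp add: negZ op_apply_simps)
    moreover have "inner (M (Q x)) (M (Q x)) = inner x (M (M (Q x)))" for x
    proof -
      have "inner (M (Q x)) (M (Q x)) = inner x (Q (M (M (Q x))))"
        by (simp only: symmetric_opD[OF M] symmetric_opD[OF orth_projection_symmetric[OF Q]])
      also have "Q (M (M (Q x))) = M (M (Q x))"
        by (simp only: commute_apply[OF MQ, symmetric] orth_projection_idem_apply[OF Q])
      finally show ?thesis .
    qed
    ultimately have "inner (M (Q x)) (M (Q x)) \<le> 0" for x
      by simp
    then have "M (Q x) = 0" for x
      by (metis inner_ge_zero inner_eq_zero_iff order_antisym)
    then have "M o\<^sub>L Q = 0" by (intro blinfun_eqI) simp
    then show "P o\<^sub>L Q = Q" by (rule kerM)
  qed
qed

section \<open>Spectral families\<close>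

lemma orth_projection_zeroI:
  assumes "orth_projection Q" "nonneg_op ((a *\<^sub>R id_blinfun - T) o\<^sub>L Q)"
    "nonneg_op ((T - b *\<^sub>R id_blinfun) o\<^sub>L Q)" "a < b"
  shows "Q = 0"
proof (rule nonneg_op_antisym)
  show "nonneg_op Q" by (rule orth_projection_nonneg[OF assms(1)])
  have "nonneg_op ((1 / (b - a)) *\<^sub>R (((a *\<^sub>R id_blinfun - T) o\<^sub>L Q) + ((T - b *\<^sub>R id_blinfun) o\<^sub>L Q)))"
    using assms by (intro nonneg_op_scaleR nonneg_op_add) auto
  moreover have "((a *\<^sub>R id_blinfun - T) o\<^sub>L Q) + ((T - b *\<^sub>R id_blinfun) o\<^sub>L Q) = (b - a) *\<^sub>R (- Q)"
    by (rule blinfun_eqI) (simp add: op_apply_simps scaleR_diff_left)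
  moreover have "(1 / (b - a)) *\<^sub>R ((b - a) *\<^sub>R (- Q)) = - Q"
    using \<open>a < b\<close> by simp
  ultimately show "nonneg_op (- Q)" by metis
qed

locale spectral_family =
  fixes T :: "'a::real_inner \<Rightarrow>\<^sub>L 'a" and E :: "real \<Rightarrow> 'a \<Rightarrow>\<^sub>L 'a"
  assumes proj: "\<And>s. orth_projection (E s)"
    and comm: "\<And>s. E s o\<^sub>L T = T o\<^sub>L E s"
    and upper: "\<And>s. nonneg_op ((s *\<^sub>R id_blinfun - T) o\<^sub>L E s)"
    and lower: "\<And>s. nonneg_op ((T - s *\<^sub>R id_blinfun) o\<^sub>L (id_blinfun - E s))"
    and mono: "\<And>s t. s \<le> t \<Longrightarrow> E t o\<^sub>L E s = E s"
    and right_cont: "\<And>s x. ((\<lambda>t. E t x) \<longlongrightarrow> E s x) (at_right s)"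
begin

lemma mono_apply: "s \<le> t \<Longrightarrow> E t (E s x) = E s x"
  using mono by (metis blinfun_apply_blinfun_compose)

lemma mono_apply': "s \<le> t \<Longrightarrow> E s (E t x) = E s x"
proof -
  assume st: "s \<le> t"
  have "inner (E s (E t x)) y = inner (E s x) y" for y
    by (simp add: symmetric_opD[OF orth_projection_symmetric[OF proj]] mono_apply[OF st])
  then show ?thesis by (metis inner_right_distrib inner_commute vector_eq_ldot)
qed

lemma block_projection:
  assumes "s \<le> t" shows "orth_projection (E t - E s)"
  unfolding orth_projection_def
  by (auto intro!: symmetric_op_diff[OF orth_projection_symmetric[OF proj] orth_projection_symmetric[OF proj]]
      blinfun_eqI simp: op_apply_simps orth_projection_idem_apply[OF proj]
        mono_apply[OF assms] mono_apply'[OF assms])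

lemma block_commute: "(E t - E s) o\<^sub>L T = T o\<^sub>L (E t - E s)"
  by (rule blinfun_eqI) (simp add: op_apply_simps commute_apply[OF comm])

lemma block_lower:
  assumes "s \<le> t" shows "nonneg_op ((T - s *\<^sub>R id_blinfun) o\<^sub>L (E t - E s))"
proof -
  have "nonneg_op (((T - s *\<^sub>R id_blinfun) o\<^sub>L (id_blinfun - E s)) o\<^sub>L E t)"
    by (rule nonneg_op_compose[OF lower orth_projection_nonneg[OF proj]])
      (auto intro!: blinfun_eqI simp: op_apply_simps commute_apply[OF comm]
        mono_apply[OF assms] mono_apply'[OF assms])
  moreover have "((T - s *\<^sub>R id_blinfun) o\<^sub>L (id_blinfun - E s)) o\<^sub>L E t = (T - s *\<^sub>R id_blinfun) o\<^sub>L (E t - E s)"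
    by (rule blinfun_eqI) (simp add: op_apply_simps mono_apply'[OF assms])
  ultimately show ?thesis by simp
qed

lemma block_upper:
  assumes "s \<le> t" shows "nonneg_op ((t *\<^sub>R id_blinfun - T) o\<^sub>L (E t - E s))"
proof -
  have "nonneg_op (((t *\<^sub>R id_blinfun - T) o\<^sub>L E t) o\<^sub>L (id_blinfun - E s))"
    by (rule nonneg_op_compose[OF upper orth_projection_nonneg[OF orth_projection_compl[OF proj]]])
      (auto intro!: blinfun_eqI simp: op_apply_simps commute_apply[OF comm]
        mono_apply[OF assms] mono_apply'[OF assms])
  moreover have "((t *\<^sub>R id_blinfun - T) o\<^sub>L E t) o\<^sub>L (id_blinfun - E s) = (t *\<^sub>R id_blinfun - T) o\<^sub>L (E t - E s)"
    by (rule blinfun_eqI) (simp add: op_apply_simps mono_apply[OF assms])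
  ultimately show ?thesis by simp
qed

lemma eq_0:
  assumes "nonneg_op (T - a *\<^sub>R id_blinfun)" "s < a"
  shows "E s = 0"
proof (rule orth_projection_zeroI[OF proj upper])
  show "nonneg_op ((T - a *\<^sub>R id_blinfun) o\<^sub>L E s)"
    by (rule nonneg_op_compose[OF assms(1) orth_projection_nonneg[OF proj]])
      (auto intro!: blinfun_eqI simp: op_apply_simps commute_apply[OF comm])
qed fact

lemma eq_id:
  assumes "nonneg_op (b *\<^sub>R id_blinfun - T)" "b \<le> s"
  shows "E s = id_blinfun"
proof -
  have gt: "E t = id_blinfun" if "b < t" for t
  proof -
    have "id_blinfun - E t = 0"
    proof (rule orth_projection_zeroI[OF orth_projection_compl[OF proj] _ lower that])
      show "nonneg_op ((b *\<^sub>R id_blinfun - T) o\<^sub>L (id_blinfun - E t))"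
        by (rule nonneg_op_compose[OF assms(1) orth_projection_nonneg[OF orth_projection_compl[OF proj]]])
          (auto intro!: blinfun_eqI simp: op_apply_simps commute_apply[OF comm])
    qed
    then show ?thesis by simp
  qed
  have "E s x = x" for x
  proof (rule tendsto_unique[OF _ right_cont])
    show "((\<lambda>t. E t x) \<longlongrightarrow> x) (at_right s)"
      by (rule tendsto_eventually)
        (use gt assms(2) in \<open>auto simp: eventually_at_filter\<close>)
  qed simp
  then show ?thesis by (intro blinfun_eqI) simp
qed

end

lemma spectral_family_exists:
  fixes T :: "'a::{real_inner,complete_space} \<Rightarrow>\<^sub>L 'a"
  assumes T: "symmetric_op T"
  obtains E where "spectral_family T E"
    "\<And>C s. strongly_closed_algebra C \<Longrightarrow> T \<in> C \<Longrightarrow> E s \<in> C"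
    "\<And>s Q. orth_projection Q \<Longrightarrow> Q o\<^sub>L T = T o\<^sub>L Q \<Longrightarrow> nonneg_op ((s *\<^sub>R id_blinfun - T) o\<^sub>L Q) \<Longrightarrow>
       E s o\<^sub>L Q = Q"
proof -
  have "\<forall>s. \<exists>P. orth_projection P \<and>
    nonneg_op ((s *\<^sub>R id_blinfun - T) o\<^sub>L P) \<and>
    nonneg_op ((T - s *\<^sub>R id_blinfun) o\<^sub>L (id_blinfun - P)) \<and>
    (\<forall>C. strongly_closed_algebra C \<longrightarrow> T \<in> C \<longrightarrow> P \<in> C) \<and>
    (\<forall>Q. orth_projection Q \<longrightarrow> Q o\<^sub>L T = T o\<^sub>L Q \<longrightarrow> nonneg_op ((s *\<^sub>R id_blinfun - T) o\<^sub>L Q) \<longrightarrow>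
       P o\<^sub>L Q = Q)"
    by (rule allI, rule spectral_projection_exists[OF T], blast)
  from choice[OF this] obtain E where
    proj: "\<And>s. orth_projection (E s)" and
    upper: "\<And>s. nonneg_op ((s *\<^sub>R id_blinfun - T) o\<^sub>L E s)" and
    lower: "\<And>s. nonneg_op ((T - s *\<^sub>R id_blinfun) o\<^sub>L (id_blinfun - E s))" and
    mem: "\<And>s C. strongly_closed_algebra C \<Longrightarrow> T \<in> C \<Longrightarrow> E s \<in> C" and
    max: "\<And>s Q. orth_projection Q \<Longrightarrow> Q o\<^sub>L T = T o\<^sub>L Q \<Longrightarrow>
       nonneg_op ((s *\<^sub>R id_blinfun - T) o\<^sub>L Q) \<Longrightarrow> E s o\<^sub>L Q = Q"
    by auto
  have comm: "E s o\<^sub>L X = X o\<^sub>L E s" if "T o\<^sub>L X = X o\<^sub>L T" for s X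
    using mem[OF strongly_closed_algebra_commutant[of X]] that by simp
  have ET: "E s o\<^sub>L T = T o\<^sub>L E s" for s
    by (rule comm) simp
  have EE: "E s o\<^sub>L E t = E t o\<^sub>L E s" for s t
    by (rule comm) (simp add: ET)
  have mono: "E t o\<^sub>L E s = E s" if "s \<le> t" for s t
  proof (rule max[OF proj ET])
    have "nonneg_op (((s *\<^sub>R id_blinfun - T) o\<^sub>L E s) + (t - s) *\<^sub>R E s)"
      using that by (intro nonneg_op_add upper nonneg_op_scaleR orth_projection_nonneg proj) simp
    moreover have "((s *\<^sub>R id_blinfun - T) o\<^sub>L E s) + (t - s) *\<^sub>R E s = (t *\<^sub>R id_blinfun - T) o\<^sub>L E s"
      by (rule blinfun_eqI) (simp add: op_apply_simps algebra_simps)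
    ultimately show "nonneg_op ((t *\<^sub>R id_blinfun - T) o\<^sub>L E s)" by simp
  qed
  have mono_apply: "E t (E s x) = E s x" "E s (E t x) = E s x" if "s \<le> t" for s t x
    using mono[OF that] EE by (metis blinfun_apply_blinfun_compose)+
  have right_cont: "((\<lambda>t. E t x) \<longlongrightarrow> E s x) (at_right s)" for s x
  proof -
    define u where "u n = s + 1 / Suc n" for n
    have u: "s < u n" and u_dec: "u (Suc n) \<le> u n" for n
      by (simp_all add: u_def frac_le)
    have u_lim: "u \<longlonglongrightarrow> s"
      using tendsto_add[OF tendsto_const[of s] lim_inverse_n'[THEN LIMSEQ_Suc]] by (simp add: u_def[abs_def])
    obtain Q' :: "'a \<Rightarrow>\<^sub>L 'a" where Q': "\<And>x. (\<lambda>n. (id_blinfun - E (u n)) x) \<longlonglongrightarrow> Q' x"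
    proof (rule increasing_strong_limit[of "\<lambda>n. id_blinfun - E (u n)"])
      show "nonneg_op ((id_blinfun - E (u (Suc n))) - (id_blinfun - E (u n)))" for n
      proof -
        have "orth_projection (E (u n) o\<^sub>L (id_blinfun - E (u (Suc n))))"
          by (intro orth_projection_compose orth_projection_compl proj)
            (auto intro!: blinfun_eqI simp: op_apply_simps commute_apply[OF EE[of "u n" "u (Suc n)"]])
        moreover have "E (u n) o\<^sub>L (id_blinfun - E (u (Suc n))) = (id_blinfun - E (u (Suc n))) - (id_blinfun - E (u n))"
          by (rule blinfun_eqI) (simp add: op_apply_simps mono_apply[OF u_dec])
        ultimately show ?thesis using orth_projection_nonneg by metis
      qed
    qed (auto intro!: orth_projection_nonneg orth_projection_compl proj)
    define Q where "Q = id_blinfun - Q'"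
    have Q: "(\<lambda>n. E (u n) x) \<longlonglongrightarrow> Q x" for x
      using tendsto_diff[OF tendsto_const[of x] Q'[of x]] by (simp add: Q_def op_apply_simps)
    have Qmem: "Q \<in> C" if "strongly_closed_algebra C" "T \<in> C" for C
      using that by (intro strongly_closed_algebra_limit[OF _ _ Q] mem)
    have QT: "Q o\<^sub>L T = T o\<^sub>L Q"
      using Qmem[OF strongly_closed_algebra_commutant[of T]] by simp
    have "Q (Q x) = Q x" for x
    proof (rule LIMSEQ_unique[OF _ Q])
      show "(\<lambda>n. E (u n) x) \<longlonglongrightarrow> Q (Q x)"
        using strong_limit_compose[OF Q Q orth_projection_norm_le[OF proj], of x]
        by (simp add: orth_projection_idem_apply[OF proj])
    qed
    moreover have "nonneg_op Q"
      by (rule strong_limit_nonneg[OF Q]) (simp_all add: orth_projection_nonneg proj)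
    ultimately have Qproj: "orth_projection Q"
      by (auto simp: orth_projection_def nonneg_op_symmetric intro!: blinfun_eqI)
    have "nonneg_op ((s *\<^sub>R id_blinfun - T) o\<^sub>L Q)"
    proof (rule strong_limit_nonneg[where F = sequentially])
      show "(\<lambda>n. ((u n *\<^sub>R id_blinfun - T) o\<^sub>L E (u n)) x) \<longlonglongrightarrow> ((s *\<^sub>R id_blinfun - T) o\<^sub>L Q) x" for x
        by (auto simp: op_apply_simps intro!: tendsto_intros u_lim Q)
    qed (auto simp: upper)
    from max[OF Qproj QT this] have 1: "E s (Q x) = Q x" for x
      by (metis blinfun_apply_blinfun_compose)
    have 2: "Q (E s x) = E s x" for x
      using Q[of "E s x"] u by (simp add: mono_apply less_imp_le LIMSEQ_const_iff)
    have "E s o\<^sub>L Q = Q o\<^sub>L E s"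
      by (rule comm) (simp add: QT)
    with 1 2 have QE: "Q x = E s x" for x
      using commute_apply by metis
    show ?thesis
    proof (rule tendstoI)
      fix e :: real assume "e > 0"
      from tendstoD[OF Q[of x] this] obtain n where n: "dist (E (u n) x) (Q x) < e"
        by (auto simp: eventually_sequentially)
      have "dist (E t x) (E s x) < e" if "s < t" "t < u n" for t
      proof -
        have "E t x - E s x = E t (E (u n) x - E s x)"
          using that by (simp add: op_apply_simps mono_apply)
        also have "norm \<dots> \<le> 1 * norm (E (u n) x - E s x)"
          by (intro order_trans[OF norm_blinfun] mult_right_mono orth_projection_norm_le proj) simp
        finally show ?thesis using n by (simp add: dist_norm QE)
      qed
      then show "\<forall>\<^sub>F t in at_right s. dist (E t x) (E s x) < e"
        using u[of n] by (auto simp: eventually_at_right[OF u])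
    qed
  qed
  have "spectral_family T E"
    by unfold_locales (simp_all add: proj ET upper lower mono right_cont)
  then show ?thesis using that mem max by blast
qed

lemma spectral_family_mem:
  fixes T :: "'a::{real_inner,complete_space} \<Rightarrow>\<^sub>L 'a"
  assumes T: "symmetric_op T" and E: "spectral_family T E"
    and C: "strongly_closed_algebra C" "T \<in> C"
  shows "E s \<in> C"
proof -
  interpret spectral_family T E by (rule E)
  obtain G where G: "spectral_family T G"
    and mem: "\<And>C s. strongly_closed_algebra C \<Longrightarrow> T \<in> C \<Longrightarrow> G s \<in> C"
    and max: "\<And>s Q. orth_projection Q \<Longrightarrow> Q o\<^sub>L T = T o\<^sub>L Q \<Longrightarrow>
       nonneg_op ((s *\<^sub>R id_blinfun - T) o\<^sub>L Q) \<Longrightarrow> G s o\<^sub>L Q = Q"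
    by (rule spectral_family_exists[OF T]) blast
  interpret G: spectral_family T G by (rule G)
  have GE: "G s (E s x) = E s x" for x
    using max[OF proj comm upper] by (metis blinfun_apply_blinfun_compose)
  have comm': "G s o\<^sub>L E t = E t o\<^sub>L G s" for t
    using mem[OF strongly_closed_algebra_commutant[of "E t"]] by (simp add: comm)
  have "G s (E t x) = G s x" if "s < t" for t x
  proof -
    let ?Q = "G s o\<^sub>L (id_blinfun - E t)"
    have c: "G s o\<^sub>L (id_blinfun - E t) = (id_blinfun - E t) o\<^sub>L G s"
      by (rule blinfun_eqI) (simp add: op_apply_simps commute_apply[OF comm'])
    have "?Q = 0"
    proof (rule orth_projection_zeroI[OF _ _ _ that])
      show "orth_projection ?Q"
        by (rule orth_projection_compose[OF G.proj orth_projection_compl[OF proj] c])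
      have "nonneg_op (((s *\<^sub>R id_blinfun - T) o\<^sub>L G s) o\<^sub>L (id_blinfun - E t))"
        by (rule nonneg_op_compose[OF G.upper orth_projection_nonneg[OF orth_projection_compl[OF proj]]])
          (auto intro!: blinfun_eqI simp: op_apply_simps commute_apply[OF comm]
            commute_apply[OF comm'])
      then show "nonneg_op ((s *\<^sub>R id_blinfun - T) o\<^sub>L ?Q)"
        by (simp add: blinfun_compose_assoc)
      have "nonneg_op (((T - t *\<^sub>R id_blinfun) o\<^sub>L (id_blinfun - E t)) o\<^sub>L G s)"
        by (rule nonneg_op_compose[OF lower orth_projection_nonneg[OF G.proj]])
          (auto intro!: blinfun_eqI simp: op_apply_simps commute_apply[OF G.comm]
            commute_apply[OF comm'])
      then show "nonneg_op ((T - t *\<^sub>R id_blinfun) o\<^sub>L ?Q)"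
        by (simp add: blinfun_compose_assoc c)
    qed
    from this[THEN arg_cong[where f = "\<lambda>X. blinfun_apply X x"]] show ?thesis
      by (simp add: op_apply_simps)
  qed
  then have "((\<lambda>t. G s (E t x)) \<longlongrightarrow> G s x) (at_right s)" for x
    by (intro tendsto_eventually) (auto simp: eventually_at_filter)
  moreover have "((\<lambda>t. G s (E t x)) \<longlongrightarrow> G s (E s x)) (at_right s)" for x
    by (intro bounded_linear.tendsto[OF blinfun.bounded_linear_right] right_cont)
  ultimately have "G s x = G s (E s x)" for x
    using tendsto_unique trivial_limit_at_right_real by blast
  then have "E s = G s" by (intro blinfun_eqI) (simp add: GE)
  then show ?thesis using mem[OF C] by simp
qed

section \<open>Logarithm and inverse of a strictly positive operator\<close>

lemma op_pow_projection_bound: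
  assumes X: "nonneg_op X" and "0 \<le> \<rho>" and PX: "P o\<^sub>L X = X o\<^sub>L P"
    and bd: "nonneg_op (e *\<^sub>R ((\<rho> *\<^sub>R id_blinfun - X) o\<^sub>L P))"
  shows "nonneg_op (e *\<^sub>R ((\<rho> ^ k *\<^sub>R id_blinfun - op_pow X k) o\<^sub>L P))"
proof (induction k)
  case (Suc k)
  let ?Y = "e *\<^sub>R ((\<rho> *\<^sub>R id_blinfun - X) o\<^sub>L P)"
  have XY: "X o\<^sub>L ?Y = ?Y o\<^sub>L X"
    by (rule blinfun_eqI) (simp add: op_apply_simps commute_apply[OF PX])
  have "nonneg_op (\<rho> *\<^sub>R (e *\<^sub>R ((\<rho> ^ k *\<^sub>R id_blinfun - op_pow X k) o\<^sub>L P)) + (op_pow X k o\<^sub>L ?Y))"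
    using op_pow_commute[OF XY]
    by (intro nonneg_op_add nonneg_op_scaleR Suc.IH nonneg_op_compose op_pow_nonneg bd X \<open>0 \<le> \<rho>\<close>)
  moreover have "\<rho> *\<^sub>R (e *\<^sub>R ((\<rho> ^ k *\<^sub>R id_blinfun - op_pow X k) o\<^sub>L P)) + (op_pow X k o\<^sub>L ?Y) =
      e *\<^sub>R ((\<rho> ^ Suc k *\<^sub>R id_blinfun - op_pow X (Suc k)) o\<^sub>L P)"
    by (rule blinfun_eqI)
      (simp add: op_apply_simps commute_apply[OF op_pow_commute[of X X k]] algebra_simps)
  ultimately show ?case by simp
qed simp

lemma norm_op_pow_le: "norm (op_pow X n) \<le> norm X ^ n"
proof (induction n)
  case (Suc n)
  have "norm (op_pow X (Suc n)) \<le> norm X * norm (op_pow X n)"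
    by (simp add: norm_blinfun_compose)
  also have "\<dots> \<le> norm X * norm X ^ n"
    by (intro mult_left_mono Suc.IH) simp
  finally show ?case by simp
qed (simp add: norm_blinfun_id_le)

lemma norm_contraction_of_bounds:
  assumes low: "nonneg_op (T - a *\<^sub>R id_blinfun)" and up: "nonneg_op (K *\<^sub>R id_blinfun - T)"
    and a: "0 < a" "a \<le> K"
  shows "nonneg_op ((1 / K) *\<^sub>R (K *\<^sub>R id_blinfun - T))"
    "norm ((1 / K) *\<^sub>R (K *\<^sub>R id_blinfun - T)) < 1"
proof -
  let ?X = "(1 / K) *\<^sub>R (K *\<^sub>R id_blinfun - T)"
  show X: "nonneg_op ?X" using a by (intro nonneg_op_scaleR up) auto
  have "(1 - a / K) *\<^sub>R id_blinfun - ?X = (1 / K) *\<^sub>R (T - a *\<^sub>R id_blinfun)"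
    using a by (simp add: algebra_simps)
  then have "nonneg_op ((1 - a / K) *\<^sub>R id_blinfun - ?X)"
    using a low by (simp add: nonneg_op_scaleR)
  from nonneg_op_norm_le[OF X this] a have "norm ?X \<le> 1 - a / K"
    by simp
  also have "\<dots> < 1" using a by simp
  finally show "norm ?X < 1" .
qed

text \<open>With \<open>X = 1 - T / K\<close>, the logarithm is \<open>ln K - \<Sum>k. X\<^sup>k\<^sup>+\<^sup>1 / (k + 1)\<close>.  The sign \<open>e\<close> allows one
  statement for both a lower and an upper bound.\<close>

lemma log_operator_exists:
  fixes T :: "'a::{real_inner,banach} \<Rightarrow>\<^sub>L 'a"
  assumes low: "nonneg_op (T - a *\<^sub>R id_blinfun)" and up: "nonneg_op (K *\<^sub>R id_blinfun - T)"
    and a: "0 < a" "a \<le> K"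
  obtains L where "\<And>C. strongly_closed_algebra C \<Longrightarrow> T \<in> C \<Longrightarrow> L \<in> C"
    "\<And>P r e. P o\<^sub>L T = T o\<^sub>L P \<Longrightarrow> 0 < r \<Longrightarrow> r \<le> K \<Longrightarrow>
      nonneg_op (e *\<^sub>R ((T - r *\<^sub>R id_blinfun) o\<^sub>L P)) \<Longrightarrow>
      nonneg_op (e *\<^sub>R ((L - ln r *\<^sub>R id_blinfun) o\<^sub>L P))"
proof -
  have K: "K > 0" using a by simp
  define X where "X = (1 / K) *\<^sub>R (K *\<^sub>R id_blinfun - T)"
  have X: "nonneg_op X" and X1: "norm X < 1"
    unfolding X_def by (rule norm_contraction_of_bounds[OF low up a])+
  define f where "f k = (1 / Suc k) *\<^sub>R op_pow X (Suc k)" for k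
  have f: "summable f"
  proof (rule summable_comparison_test)
    have "norm (f k) \<le> norm X ^ Suc k" for k
    proof -
      have "norm (f k) \<le> 1 * norm (op_pow X (Suc k))"
        unfolding f_def norm_scaleR by (intro mult_right_mono) auto
      then show ?thesis using norm_op_pow_le[of X "Suc k"] by linarith
    qed
    then show "\<exists>N. \<forall>n\<ge>N. norm (f n) \<le> norm X ^ Suc n" by blast
    show "summable (\<lambda>n. norm X ^ Suc n)"
      using X1 summable_geometric[of "norm X"] by (simp only: summable_Suc_iff) simp
  qed
  have lim: "(\<lambda>n. (\<Sum>k<n. f k) x) \<longlonglongrightarrow> suminf f x" for x
    using f by (intro bounded_linear.tendsto[OF blinfun.bounded_linear_left] summable_LIMSEQ)
  define L where "L = ln K *\<^sub>R id_blinfun - suminf f"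
  show ?thesis
  proof (rule that[of L])
    fix C assume C: "strongly_closed_algebra C" "T \<in> C"
    have X: "X \<in> C" using C by (simp add: X_def strongly_closed_algebra_intros)
    have "(\<Sum>k<n. f k) \<in> C" for n
      by (induction n)
        (simp_all add: strongly_closed_algebra_intros C f_def op_pow_mem X del: op_pow.simps)
    then have "suminf f \<in> C"
      by (rule strongly_closed_algebra_limit[OF C(1) _ lim])
    then show "L \<in> C" using C by (simp add: L_def strongly_closed_algebra_intros)
  next
    fix P :: "'a \<Rightarrow>\<^sub>L 'a" and r e :: real
    assume PT: "P o\<^sub>L T = T o\<^sub>L P" and r: "0 < r" "r \<le> K"
      and bd: "nonneg_op (e *\<^sub>R ((T - r *\<^sub>R id_blinfun) o\<^sub>L P))"
    define \<rho> where "\<rho> = 1 - r / K"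
    have \<rho>: "0 \<le> \<rho>" "\<rho> < 1" using r K by (simp_all add: \<rho>_def)
    define g where "g k = (1 / Suc k) * \<rho> ^ Suc k" for k
    have PX: "P o\<^sub>L X = X o\<^sub>L P"
      by (rule blinfun_eqI) (simp add: X_def op_apply_simps commute_apply[OF PT])
    have "e *\<^sub>R ((\<rho> *\<^sub>R id_blinfun - X) o\<^sub>L P) = (1 / K) *\<^sub>R (e *\<^sub>R ((T - r *\<^sub>R id_blinfun) o\<^sub>L P))"
      using K by (intro blinfun_eqI) (simp add: X_def \<rho>_def op_apply_simps algebra_simps)
    then have "nonneg_op (e *\<^sub>R ((\<rho> *\<^sub>R id_blinfun - X) o\<^sub>L P))"
      using nonneg_op_scaleR[OF bd, of "1 / K"] K by simp
    note pow = op_pow_projection_bound[OF X \<rho>(1) PX this]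
    have S: "nonneg_op (e *\<^sub>R ((\<Sum>k<n. g k *\<^sub>R id_blinfun - f k) o\<^sub>L P))" for n
    proof (induction n)
      case (Suc n)
      have "e *\<^sub>R ((\<Sum>k<Suc n. g k *\<^sub>R id_blinfun - f k) o\<^sub>L P) =
        e *\<^sub>R ((\<Sum>k<n. g k *\<^sub>R id_blinfun - f k) o\<^sub>L P) +
        (1 / Suc n) *\<^sub>R (e *\<^sub>R ((\<rho> ^ Suc n *\<^sub>R id_blinfun - op_pow X (Suc n)) o\<^sub>L P))"
        by (rule blinfun_eqI) (simp add: f_def g_def op_apply_simps algebra_simps del: op_pow.simps of_nat_Suc)
      then show ?case
        by (simp only:) (intro nonneg_op_add nonneg_op_scaleR Suc.IH pow; simp)
    qed simp
    have "(\<lambda>n. - ((- (- \<rho>)) ^ n) / real n) sums ln (1 + - \<rho>)"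
      using \<rho> by (intro ln_series') auto
    then have "(\<lambda>n. - ((\<rho> ^ Suc n) / real (Suc n))) sums ln (1 - \<rho>)"
      by (subst sums_Suc_iff) simp
    from sums_minus[OF this] have "g sums - ln (1 - \<rho>)"
      by (simp add: g_def[abs_def] del: of_nat_Suc power_Suc)
    also have "- ln (1 - \<rho>) = ln K - ln r"
      using r K by (simp add: \<rho>_def ln_div)
    finally have g: "(\<lambda>n. \<Sum>k<n. g k) \<longlonglongrightarrow> ln K - ln r"
      by (simp add: sums_def)
    have "nonneg_op (e *\<^sub>R (((ln K - ln r) *\<^sub>R id_blinfun - suminf f) o\<^sub>L P))"
    proof (rule strong_limit_nonneg[where F = sequentially])
      show "\<forall>\<^sub>F n in sequentially. nonneg_op (e *\<^sub>R (((\<Sum>k<n. g k) *\<^sub>R id_blinfun - (\<Sum>k<n. f k)) o\<^sub>L P))"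
        using S by (simp add: sum_subtractf scaleR_sum_left)
      show "(\<lambda>n. (e *\<^sub>R (((\<Sum>k<n. g k) *\<^sub>R id_blinfun - (\<Sum>k<n. f k)) o\<^sub>L P)) x)
          \<longlonglongrightarrow> (e *\<^sub>R (((ln K - ln r) *\<^sub>R id_blinfun - suminf f) o\<^sub>L P)) x" for x
        unfolding blinfun_apply_blinfun_compose blinfun.scaleR_left blinfun.diff_left
        by (intro tendsto_intros g summable_LIMSEQ f)
    qed simp
    then show "nonneg_op (e *\<^sub>R ((L - ln r *\<^sub>R id_blinfun) o\<^sub>L P))"
      by (simp add: L_def algebra_simps)
  qed
qed

lemma inverse_operator_exists:
  fixes T :: "'a::{real_inner,banach} \<Rightarrow>\<^sub>L 'a"
  assumes low: "nonneg_op (T - a *\<^sub>R id_blinfun)" and a: "0 < a"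
  obtains B where "T o\<^sub>L B = id_blinfun" "B o\<^sub>L T = id_blinfun"
    "\<And>C. strongly_closed_algebra C \<Longrightarrow> T \<in> C \<Longrightarrow> B \<in> C"
proof -
  define K where "K = norm T + a"
  have K: "a \<le> K" "K > 0" using a by (simp_all add: K_def add_nonneg_pos)
  have T: "symmetric_op T"
    using symmetric_op_add[OF nonneg_op_symmetric[OF low] symmetric_op_scaleR[OF symmetric_op_id, of a]]
    by simp
  have up: "nonneg_op (K *\<^sub>R id_blinfun - T)"
    by (rule norm_bound_symmetric_op[OF T]) (use a in \<open>simp add: K_def\<close>)
  define X where "X = (1 / K) *\<^sub>R (K *\<^sub>R id_blinfun - T)"
  have X1: "norm X < 1"
    unfolding X_def by (rule norm_contraction_of_bounds[OF low up a K(1)])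
  have "summable (op_pow X)"
  proof (rule summable_comparison_test)
    show "\<exists>N. \<forall>n\<ge>N. norm (op_pow X n) \<le> norm X ^ n" using norm_op_pow_le by blast
    show "summable (\<lambda>n. norm X ^ n)" using X1 by (simp add: summable_geometric)
  qed
  then have lim: "(\<lambda>n. (\<Sum>k<n. op_pow X k) x) \<longlonglongrightarrow> suminf (op_pow X) x" for x
    by (intro bounded_linear.tendsto[OF blinfun.bounded_linear_left] summable_LIMSEQ)
  define B where "B = (1 / K) *\<^sub>R suminf (op_pow X)"
  have mem: "B \<in> C" if C: "strongly_closed_algebra C" "T \<in> C" for C
  proof -
    have X: "X \<in> C" using C by (simp add: X_def strongly_closed_algebra_intros)
    have "(\<Sum>k<n. op_pow X k) \<in> C" for n
      by (induction n) (simp_all add: strongly_closed_algebra_intros C op_pow_mem X)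
    then have "suminf (op_pow X) \<in> C"
      by (rule strongly_closed_algebra_limit[OF C(1) _ lim])
    then show ?thesis using C by (simp add: B_def strongly_closed_algebra_intros)
  qed
  have T_eq: "T x = K *\<^sub>R (x - X x)" for x
    using K by (simp add: X_def op_apply_simps)
  have "T (B x) = x" for x
  proof (rule LIMSEQ_unique)
    show "(\<lambda>n. T ((1 / K) *\<^sub>R (\<Sum>k<n. op_pow X k) x)) \<longlonglongrightarrow> T (B x)"
      unfolding B_def blinfun.scaleR_left
      by (intro bounded_linear.tendsto[OF blinfun.bounded_linear_right] tendsto_intros lim)
    have tele: "(\<Sum>k<n. op_pow X k) x - X ((\<Sum>k<n. op_pow X k) x) = x - op_pow X n x" for n
      by (induction n) (simp_all add: op_apply_simps, simp add: algebra_simps)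
    have "(\<lambda>n. op_pow X n x) \<longlonglongrightarrow> 0"
    proof (rule Lim_null_comparison)
      show "\<forall>\<^sub>F n in sequentially. norm (op_pow X n x) \<le> norm X ^ n * norm x"
        by (intro always_eventually allI order_trans[OF norm_blinfun] mult_right_mono norm_op_pow_le) simp
      show "(\<lambda>n. norm X ^ n * norm x) \<longlonglongrightarrow> 0"
        using X1 by (intro tendsto_mult_left_zero LIMSEQ_power_zero) simp
    qed
    from tendsto_diff[OF tendsto_const[of x] this]
    show "(\<lambda>n. T ((1 / K) *\<^sub>R (\<Sum>k<n. op_pow X k) x)) \<longlonglongrightarrow> x"
      using K by (simp add: T_eq blinfun.scaleR_right tele flip: scaleR_diff_right)
  qed
  then have TB: "T o\<^sub>L B = id_blinfun" by (intro blinfun_eqI) simp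
  moreover have "B o\<^sub>L T = T o\<^sub>L B"
    using mem[OF strongly_closed_algebra_commutant[of T]] by simp
  ultimately show ?thesis using that mem by metis
qed

section \<open>Stieltjes integrals\<close>

lemma interval_measure_AE:
  fixes F :: "real \<Rightarrow> real"
  assumes F: "mono F" "\<And>x. continuous (at_right x) F"
    and "\<And>x. x \<le> a \<Longrightarrow> F x = F a" "\<And>x. b \<le> x \<Longrightarrow> F x = F b"
  shows "AE x in interval_measure F. x \<in> {a<..b}"
proof -
  let ?M = "interval_measure F"
  have em: "emeasure ?M {s<..t} = F t - F s" if "s \<le> t" for s t
    by (rule emeasure_interval_measure_Ioc[OF that monoD[OF F(1)] F(2)])
  have "(\<Union>n. {a - real n<..a}) \<union> (\<Union>n. {b<..b + real n}) \<in> null_sets ?M"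
    by (intro null_sets.Un null_sets_UN) (auto simp: null_sets_def em assms(3)[of "a - _"] assms(4)[of "b + _"])
  moreover have "{x. x \<notin> {a<..b}} \<subseteq> (\<Union>n. {a - real n<..a}) \<union> (\<Union>n. {b<..b + real n})"
  proof
    fix x assume "x \<in> {x. x \<notin> {a<..b}}"
    then consider "x \<le> a" | "b < x" by fastforce
    then show "x \<in> (\<Union>n. {a - real n<..a}) \<union> (\<Union>n. {b<..b + real n})"
    proof cases
      case 1
      obtain n where "a - x < real n" using reals_Archimedean2 by blast
      with 1 have "x \<in> {a - real n<..a}" by simp
      then show ?thesis by blast
    next
      case 2
      obtain n where "x - b < real n" using reals_Archimedean2 by blast
      with 2 have "x \<in> {b<..b + real n}" by simp
      then show ?thesis by blast
    qed
  qed
  ultimately show ?thesis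
    by (intro AE_I'[where N = "(\<Union>n. {a - real n<..a}) \<union> (\<Union>n. {b<..b + real n})"]) auto
qed

lemma interval_measure_set_integral_bounds:
  fixes F f :: "real \<Rightarrow> real"
  assumes F: "mono F" "\<And>x. continuous (at_right x) F"
    and f: "mono_on {a..b} f" "f \<in> borel_measurable borel"
  shows "a \<le> b \<Longrightarrow> set_integrable (interval_measure F) {a<..b} f"
    and "a \<le> s \<Longrightarrow> s \<le> t \<Longrightarrow> t \<le> b \<Longrightarrow> f s * (F t - F s) \<le>
      (LINT x:{a<..t}|interval_measure F. f x) - (LINT x:{a<..s}|interval_measure F. f x)"
    and "a \<le> s \<Longrightarrow> s \<le> t \<Longrightarrow> t \<le> b \<Longrightarrow>
      (LINT x:{a<..t}|interval_measure F. f x) - (LINT x:{a<..s}|interval_measure F. f x)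
        \<le> f t * (F t - F s)"
proof -
  let ?M = "interval_measure F"
  have em: "emeasure ?M {s<..t} = F t - F s" "measure ?M {s<..t} = F t - F s" if "s \<le> t" for s t
    using emeasure_interval_measure_Ioc[OF that monoD[OF F(1)] F(2)]
      measure_interval_measure_Ioc[OF that monoD[OF F(1)] F(2)] by auto
  have meas: "f \<in> borel_measurable ?M"
    using f(2) measurable_cong_sets[OF sets_interval_measure refl, of F borel] by blast
  have bd: "norm (f x) \<le> \<bar>f a\<bar> + \<bar>f b\<bar>" if "x \<in> {a<..b}" for x
    using mono_onD[OF f(1), of a x] mono_onD[OF f(1), of x b] that by auto
  show int: "set_integrable ?M {a<..b} f" if "a \<le> b"
    unfolding set_integrable_def
  proof (rule integrableI_bounded_set_indicator)
    show "emeasure ?M {a<..b} < \<infinity>" by (simp add: em that)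
    show "AE x in ?M. x \<in> {a<..b} \<longrightarrow> norm (f x) \<le> \<bar>f a\<bar> + \<bar>f b\<bar>" using bd by simp
  qed (simp_all add: meas)
  assume st: "a \<le> s" "s \<le> t" "t \<le> b"
  have int': "set_integrable ?M {u<..v} f" if "a \<le> u" "v \<le> b" for u v
    by (rule set_integrable_subset[OF int]) (use that st in auto)
  have intc: "set_integrable ?M {s<..t} (\<lambda>_. c)" "(LINT x:{s<..t}|?M. c) = c * (F t - F s)" for c
  proof -
    show "set_integrable ?M {s<..t} (\<lambda>_. c)"
      unfolding set_integrable_def
      by (rule integrableI_bounded_set_indicator[where B = "\<bar>c\<bar>"]) (simp_all add: em st)
    show "(LINT x:{s<..t}|?M. c) = c * (F t - F s)"
      using em[OF st(2)] by (simp add: set_lebesgue_integral_def)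
  qed
  have "{a<..t} = {a<..s} \<union> {s<..t}" using st by auto
  then have "(LINT x:{a<..t}|?M. f x) = (LINT x:{a<..s}|?M. f x) + (LINT x:{s<..t}|?M. f x)"
    using st by (simp only:) (rule set_integral_Un; auto intro: int')
  moreover have "(LINT x:{s<..t}|?M. f s) \<le> (LINT x:{s<..t}|?M. f x)"
    using st by (intro set_integral_mono intc int') (auto intro!: mono_onD[OF f(1)])
  moreover have "(LINT x:{s<..t}|?M. f x) \<le> (LINT x:{s<..t}|?M. f t)"
    using st by (intro set_integral_mono intc int') (auto intro!: mono_onD[OF f(1)])
  ultimately show
    "f s * (F t - F s) \<le> (LINT x:{a<..t}|?M. f x) - (LINT x:{a<..s}|?M. f x)"
    "(LINT x:{a<..t}|?M. f x) - (LINT x:{a<..s}|?M. f x) \<le> f t * (F t - F s)"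
    using intc(2) by auto
qed

lemma interval_measure_set_integral:
  fixes F f \<eta> :: "real \<Rightarrow> real"
  assumes F: "mono F" "\<And>x. continuous (at_right x) F"
    and ab: "a \<le> b" and f: "mono_on {a..b} f" "continuous_on {a..b} f" "f \<in> borel_measurable borel"
    and lower: "\<And>s t. a \<le> s \<Longrightarrow> s \<le> t \<Longrightarrow> t \<le> b \<Longrightarrow> f s * (F t - F s) \<le> \<eta> t - \<eta> s"
    and upper: "\<And>s t. a \<le> s \<Longrightarrow> s \<le> t \<Longrightarrow> t \<le> b \<Longrightarrow> \<eta> t - \<eta> s \<le> f t * (F t - F s)"
  shows "(LINT x:{a<..b}|interval_measure F. f x) = \<eta> b - \<eta> a"
proof -
  define G where "G t = (LINT x:{a<..t}|interval_measure F. f x)" for t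
  note G = interval_measure_set_integral_bounds(2,3)[OF F f(1,3), folded G_def]
  define D where "D t = \<eta> t - G t" for t
  have step: "\<bar>D t - D s\<bar> \<le> (f t - f s) * (F t - F s)" if "a \<le> s" "s \<le> t" "t \<le> b" for s t
    using lower[OF that] upper[OF that] G[OF that] by (auto simp: D_def abs_le_iff algebra_simps)
  have small: "\<bar>D b - D a\<bar> \<le> e * (F b - F a)" if e: "e > 0" for e
  proof -
    have "a \<le> a \<and> b \<le> b \<longrightarrow> \<bar>D b - D a\<bar> \<le> e * (F b - F a)"
    proof (rule Bolzano[OF ab, where P = "\<lambda>u v. a \<le> u \<and> v \<le> b \<longrightarrow> \<bar>D v - D u\<bar> \<le> e * (F v - F u)"], goal_cases)
      case (1 u v w)
      show ?case
      proof
        assume "a \<le> u \<and> w \<le> b"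
        then have "\<bar>D v - D u\<bar> \<le> e * (F v - F u)" "\<bar>D w - D v\<bar> \<le> e * (F w - F v)"
          using 1 by auto
        then show "\<bar>D w - D u\<bar> \<le> e * (F w - F u)"
          by (auto simp: abs_le_iff algebra_simps)
      qed
    next
      case (2 x)
      then have "\<exists>d>0. \<forall>y\<in>{a..b}. dist y x < d \<longrightarrow> dist (f y) (f x) < e / 2"
        using f(2)[unfolded continuous_on_iff, rule_format, of x "e / 2"] e by auto
      then obtain d where d: "d > 0" "\<And>y. y \<in> {a..b} \<Longrightarrow> dist y x < d \<Longrightarrow> dist (f y) (f x) < e / 2"
        by blast
      show ?case
      proof (intro exI conjI allI impI)
        fix u v assume uv: "u \<le> x \<and> x \<le> v \<and> v - u < d" and b: "a \<le> u \<and> v \<le> b"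
        then have "dist u x < d" "dist v x < d"
          by (auto simp: dist_real_def)
        then have "dist (f u) (f x) < e / 2" "dist (f v) (f x) < e / 2"
          using d(2)[of u] d(2)[of v] uv b by auto
        then have "f v - f u \<le> e"
          unfolding dist_real_def by linarith
        moreover have "0 \<le> F v - F u" using uv monoD[OF F(1), of u v] by simp
        ultimately show "\<bar>D v - D u\<bar> \<le> e * (F v - F u)"
          using step[of u v] uv b mult_right_mono[of "f v - f u" e "F v - F u"] by linarith
      qed (rule d)
    qed
    then show ?thesis by simp
  qed
  have "\<bar>D b - D a\<bar> \<le> 0"
  proof (rule field_le_epsilon)
    fix e :: real assume "e > 0"
    have Fba: "0 \<le> F b - F a" using monoD[OF F(1) ab] by simp
    have "\<bar>D b - D a\<bar> \<le> e / (F b - F a + 1) * (F b - F a)"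
      using \<open>e > 0\<close> Fba by (intro small) simp
    also have "\<dots> \<le> e" using \<open>e > 0\<close> Fba by (simp add: field_simps)
    finally show "\<bar>D b - D a\<bar> \<le> 0 + e" by simp
  qed
  moreover have "G a = 0" by (simp add: G_def set_lebesgue_integral_def)
  ultimately show ?thesis by (simp add: D_def G_def)
qed

lemma interval_measure_integral_eq_set:
  fixes F f :: "real \<Rightarrow> real"
  assumes F: "mono F" "\<And>x. continuous (at_right x) F"
    and const: "\<And>x. x \<le> a \<Longrightarrow> F x = F a" "\<And>x. b \<le> x \<Longrightarrow> F x = F b"
    and f: "f \<in> borel_measurable borel"
  shows "set_integrable (interval_measure F) {a<..b} f \<longleftrightarrow> integrable (interval_measure F) f"
    and "(LINT x:{a<..b}|interval_measure F. f x) = (LINT x|interval_measure F. f x)"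
proof -
  let ?M = "interval_measure F"
  have "AE x in ?M. x \<in> {a<..b}"
    by (intro interval_measure_AE F const)
  then have ae: "AE x in ?M. indicator {a<..b} x *\<^sub>R f x = f x"
    by eventually_elim simp
  have meas: "f \<in> borel_measurable ?M"
    using f measurable_cong_sets[OF sets_interval_measure refl, of F borel] by blast
  then have meas': "(\<lambda>x. indicator {a<..b} x *\<^sub>R f x) \<in> borel_measurable ?M"
    by measurable
  show "set_integrable ?M {a<..b} f \<longleftrightarrow> integrable ?M f"
    unfolding set_integrable_def by (rule integrable_cong_AE[OF meas' meas ae])
  show "(LINT x:{a<..b}|?M. f x) = (LINT x|?M. f x)"
    unfolding set_lebesgue_integral_def by (rule integral_cong_AE[OF meas' meas ae])
qed

section \<open>Complex-linear operators\<close>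

instance chilbert_space \<subseteq> banach ..

lemma inner_eqI: "(\<And>z. inner z x = inner z y) \<Longrightarrow> x = y"
  using vector_eq_ldot by blast

lemma scaleC_scaleR: "c *\<^sub>C r *\<^sub>R x = r *\<^sub>R c *\<^sub>C x"
  by (simp add: scaleR_scaleC scaleC_scaleC mult.commute)

lemma cinner_scaleC_left: "cinner (c *\<^sub>C x) y = cnj c * cinner x y"
  by (metis cinner_commute cinner_scaleC_right complex_cnj_cnj complex_cnj_mult)

lemma Im_cinner: "Im (cinner x y) = inner (\<i> *\<^sub>C x) y"
  by (simp add: inner_eq_Re_cinner cinner_scaleC_left)

lemma clinear_op_scaleC: "clinear_op X \<Longrightarrow> blinfun_apply X (c *\<^sub>C x) = c *\<^sub>C X x"
  by (simp add: clinear_op_def clinear_on_def)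

lemma clinear_opI: "(\<And>c x. blinfun_apply X (c *\<^sub>C x) = c *\<^sub>C blinfun_apply X x) \<Longrightarrow> clinear_op X"
  by (simp add: clinear_op_def clinear_on_def blinfun.add_right)

lemma symmetric_op_Im:
  assumes "clinear_op X"
  shows "symmetric_op X \<longleftrightarrow> (\<forall>x. Im (cinner x (X x)) = 0)"
proof
  assume X: "symmetric_op X"
  show "\<forall>x. Im (cinner x (X x)) = 0"
  proof
    fix x
    have "inner (\<i> *\<^sub>C x) (X x) = inner (\<i> *\<^sub>C X x) x"
      by (simp add: clinear_op_scaleC[OF assms] flip: symmetric_opD[OF X])
    also have "\<dots> = Im (cinner (X x) x)" by (simp add: Im_cinner)
    also have "\<dots> = - Im (cinner x (X x))" by (subst cinner_commute) simp
    finally show "Im (cinner x (X x)) = 0" by (simp add: Im_cinner)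
  qed
next
  assume *: "\<forall>x. Im (cinner x (X x)) = 0"
  have "inner (X x) y = inner x (X y)" for x y
  proof -
    have exp: "cinner (x + z) (X (x + z)) = cinner x (X x) + cinner x (X z) + cinner z (X x) + cinner z (X z)" for z
    proof -
      have "cinner (u + v) w = cinner u w + cinner v w" for u v w :: 'a
        by (metis cinner_add_right cinner_commute complex_cnj_add)
      then show ?thesis by (simp add: blinfun.add_right cinner_add_right)
    qed
    have "Im (cinner x (X z)) + Im (cinner z (X x)) = 0" for z
      using arg_cong[OF exp[of z], of Im] *[rule_format, of x] *[rule_format, of z]
        *[rule_format, of "x + z"] by simp
    from this[of "\<i> *\<^sub>C y"] have "Re (cinner x (X y)) = Re (cinner y (X x))"
      by (simp add: clinear_op_scaleC[OF assms] cinner_scaleC_right cinner_scaleC_left)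
    then show ?thesis by (simp add: inner_eq_Re_cinner[symmetric] inner_commute)
  qed
  then show "symmetric_op X" by (simp add: symmetric_op_def)
qed

lemma cinner_symmetric_op:
  assumes "clinear_op X" "symmetric_op X"
  shows "cinner x (X x) = complex_of_real (inner x (X x))"
  using symmetric_op_Im[OF assms(1)] assms(2) by (simp add: complex_eq_iff inner_eq_Re_cinner)

lemma positive_op_iff: "positive_op X \<longleftrightarrow> clinear_op X \<and> nonneg_op X"
proof
  assume X: "positive_op X"
  then have "clinear_op X" by (simp add: positive_op_def)
  then show "clinear_op X \<and> nonneg_op X"
    using X symmetric_op_Im[of X]
    by (auto simp: nonneg_op_def positive_op_def complex_nonneg_Reals_iff inner_eq_Re_cinner)
next
  assume "clinear_op X \<and> nonneg_op X"
  then show "positive_op X"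
    by (auto simp: positive_op_def cinner_symmetric_op nonneg_op_def)
qed

lemma adj_symmetric:
  assumes "clinear_op X" "symmetric_op X"
  shows "adj X = X"
  unfolding adj_def
proof (rule the_equality)
  show "\<forall>x y. cinner (X x) y = cinner x (X y)"
  proof (intro allI complex_eqI)
    fix x y
    show "Re (cinner (X x) y) = Re (cinner x (X y))"
      using symmetric_opD[OF assms(2)] by (simp flip: inner_eq_Re_cinner)
    show "Im (cinner (X x) y) = Im (cinner x (X y))"
      using symmetric_opD[OF assms(2), of "\<i> *\<^sub>C x" y]
      by (simp add: Im_cinner clinear_op_scaleC[OF assms(1)])
  qed
  fix B assume B: "\<forall>x y. cinner (X x) y = cinner x (blinfun_apply B y)"
  show "B = X"
  proof (rule blinfun_eqI)
    fix y
    have "inner x (B y) = inner x (X y)" for x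
      using B symmetric_opD[OF assms(2), of x y] by (simp add: inner_eq_Re_cinner)
    then show "B y = X y" by (rule inner_eqI)
  qed
qed

lemma abs_op_positive:
  assumes "positive_op A" shows "abs_op A = A"
proof -
  have A: "clinear_op A" "nonneg_op A" using assms by (simp_all add: positive_op_iff)
  then have adj: "adj A = A" by (simp add: adj_symmetric nonneg_op_symmetric)
  show ?thesis
    unfolding abs_op_def
    by (rule the_equality) (auto simp: assms adj positive_op_iff A intro: nonneg_op_sqrt_unique)
qed

lemma strongly_closed_algebra_clinear: "strongly_closed_algebra {X. clinear_op X}"
  unfolding strongly_closed_algebra_def
proof (intro conjI ballI allI impI; (elim conjE)?; unfold mem_Collect_eq)
  fix X :: "nat \<Rightarrow> 'a \<Rightarrow>\<^sub>L 'a" and Y :: "'a \<Rightarrow>\<^sub>L 'a"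
  assume X: "\<forall>n. clinear_op (X n)" and lim: "\<forall>x. (\<lambda>n. X n x) \<longlonglongrightarrow> Y x"
  have "bounded_linear (\<lambda>y::'a. c *\<^sub>C y)" for c
    by (rule bounded_linear_intro[where K = "cmod c"])
      (simp_all add: scaleC_add_right norm_scaleC scaleC_scaleR mult.commute)
  then have "(\<lambda>n. c *\<^sub>C X n x) \<longlonglongrightarrow> c *\<^sub>C Y x" for c x
    using lim by (intro bounded_linear.tendsto[where f = "\<lambda>y. c *\<^sub>C y"]) auto
  moreover have "c *\<^sub>C X n x = X n (c *\<^sub>C x)" for n c x
    using X by (simp add: clinear_op_scaleC)
  ultimately have "(\<lambda>n. X n (c *\<^sub>C x)) \<longlonglongrightarrow> c *\<^sub>C Y x" for c x
    by simp
  then show "clinear_op Y"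
    using lim LIMSEQ_unique by (intro clinear_opI) blast
qed (auto intro!: clinear_opI simp: clinear_op_scaleC blinfun.bilinear_simps scaleC_add_right scaleC_scaleR)

lemma strongly_closed_algebra_von_neumann:
  assumes R: "von_neumann_algebra R" shows "strongly_closed_algebra R"
  unfolding strongly_closed_algebra_def
proof (intro conjI ballI allI impI; (elim conjE)?)
  fix r X assume "X \<in> R"
  then have "complex_of_real r *\<^sub>C X \<in> R" using R by (simp add: von_neumann_algebra_def)
  then show "r *\<^sub>R X \<in> R" by (simp add: scaleR_scaleC)
next
  fix X :: "nat \<Rightarrow> 'a \<Rightarrow>\<^sub>L 'a" and Y :: "'a \<Rightarrow>\<^sub>L 'a"
  assume X: "\<forall>n. X n \<in> R" and lim: "\<forall>x. (\<lambda>n. X n x) \<longlonglongrightarrow> Y x"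
  have closed: "closedin strong_operator_topology R"
    using R by (simp add: von_neumann_algebra_def)
  have "limitin strong_operator_topology X Y sequentially"
  proof (unfold limitin_def, intro conjI allI impI)
    show "Y \<in> topspace strong_operator_topology" by (simp add: strong_operator_topology_topspace)
    fix U assume "openin strong_operator_topology U \<and> Y \<in> U"
    then obtain V where V: "open V" "U = blinfun_apply -` V" "blinfun_apply Y \<in> V"
      unfolding strong_operator_topology_def openin_pullback_topology by auto
    have "((\<lambda>n. blinfun_apply (X n)) \<longlongrightarrow> blinfun_apply Y) sequentially"
      using lim by (simp add: limitin_componentwise euclidean_product_topology[symmetric]
          flip: limitin_canonical_iff)
    then have "\<forall>\<^sub>F n in sequentially. blinfun_apply (X n) \<in> V"
      using V by (simp add: topological_tendstoD)
    then show "\<forall>\<^sub>F n in sequentially. X n \<in> U" by (simp add: V)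
  qed
  then show "Y \<in> R"
    by (rule limitin_closedin[OF _ closed]) (use X in auto)
qed (use R in \<open>auto simp: von_neumann_algebra_def\<close>)

section \<open>Spectral decompositions\<close>

text \<open>A positive normal functional evaluated on a spectral family yields a finite Stieltjes measure.
  The two instances needed are \<open>X \<mapsto> \<langle>x, X x\<rangle>\<close> and the real part of a trace.\<close>

locale spectral_functional = spectral_family T E
  for T :: "'a::{real_inner,complete_space} \<Rightarrow>\<^sub>L 'a" and E +
  fixes C :: "('a \<Rightarrow>\<^sub>L 'a) set" and \<phi> :: "('a \<Rightarrow>\<^sub>L 'a) \<Rightarrow> real" and a b :: real
  assumes C: "strongly_closed_algebra C" and E_C: "\<And>s. E s \<in> C"
    and \<phi>_add: "\<And>X Y. X \<in> C \<Longrightarrow> Y \<in> C \<Longrightarrow> \<phi> (X + Y) = \<phi> X + \<phi> Y"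
    and \<phi>_scale: "\<And>r X. X \<in> C \<Longrightarrow> \<phi> (r *\<^sub>R X) = r * \<phi> X"
    and \<phi>_nonneg: "\<And>X. X \<in> C \<Longrightarrow> nonneg_op X \<Longrightarrow> 0 \<le> \<phi> X"
    and \<phi>_right: "\<And>s. continuous (at_right s) (\<lambda>s. \<phi> (E s))"
    and ab: "a \<le> b" and E_low: "\<And>s. s \<le> a \<Longrightarrow> E s = 0" and E_high: "\<And>s. b \<le> s \<Longrightarrow> E s = id_blinfun"
begin

abbreviation "\<mu> \<equiv> interval_measure (\<lambda>s. \<phi> (E s))"

lemma \<phi>_diff: "X \<in> C \<Longrightarrow> Y \<in> C \<Longrightarrow> \<phi> (X - Y) = \<phi> X - \<phi> Y"
  using \<phi>_add[of X "-1 *\<^sub>R Y"] \<phi>_scale[of Y "-1"] C by (simp add: strongly_closed_algebra_intros)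

lemma \<phi>_mono: "X \<in> C \<Longrightarrow> Y \<in> C \<Longrightarrow> nonneg_op (Y - X) \<Longrightarrow> \<phi> X \<le> \<phi> Y"
  using \<phi>_nonneg[of "Y - X"] \<phi>_diff[of Y X] C by (simp add: strongly_closed_algebra_intros)

lemma mono_F: "mono (\<lambda>s. \<phi> (E s))"
  by (intro monoI \<phi>_mono E_C orth_projection_nonneg block_projection)

lemma const_F: "s \<le> a \<Longrightarrow> \<phi> (E s) = \<phi> (E a)" "b \<le> s \<Longrightarrow> \<phi> (E s) = \<phi> (E b)"
  by (simp_all add: E_low E_high)

lemma \<phi>_zero: "\<phi> 0 = 0"
  using \<phi>_scale[of 0 0] C by (simp add: strongly_closed_algebra_intros)

lemma integral_eq:
  assumes L: "L \<in> C" and f: "mono_on {a..c} f" "continuous_on {a..c} f" "f \<in> borel_measurable borel"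
    and c: "a \<le> c"
    and lower: "\<And>s t. a \<le> s \<Longrightarrow> s \<le> t \<Longrightarrow> t \<le> c \<Longrightarrow> nonneg_op ((L - f s *\<^sub>R id_blinfun) o\<^sub>L (E t - E s))"
    and upper: "\<And>s t. a \<le> s \<Longrightarrow> s \<le> t \<Longrightarrow> t \<le> c \<Longrightarrow> nonneg_op ((f t *\<^sub>R id_blinfun - L) o\<^sub>L (E t - E s))"
  shows "set_integrable \<mu> {a<..c} f" "(LINT x:{a<..c}|\<mu>. f x) = \<phi> (L o\<^sub>L E c)"
proof -
  show "set_integrable \<mu> {a<..c} f"
    by (rule interval_measure_set_integral_bounds(1)[OF mono_F \<phi>_right f(1,3) c])
  have mem: "L o\<^sub>L E s \<in> C" "r *\<^sub>R E s \<in> C" for s r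
    using L E_C C by (auto intro: strongly_closed_algebra_intros)
  have "(LINT x:{a<..c}|\<mu>. f x) = \<phi> (L o\<^sub>L E c) - \<phi> (L o\<^sub>L E a)"
  proof (rule interval_measure_set_integral[OF mono_F \<phi>_right c f])
    fix s t assume st: "a \<le> s" "s \<le> t" "t \<le> c"
    have "(L - f s *\<^sub>R id_blinfun) o\<^sub>L (E t - E s) = ((L o\<^sub>L E t) - (L o\<^sub>L E s)) - (f s *\<^sub>R E t - f s *\<^sub>R E s)"
      by (rule blinfun_eqI) (simp add: op_apply_simps)
    then have "0 \<le> \<phi> (((L o\<^sub>L E t) - (L o\<^sub>L E s)) - (f s *\<^sub>R E t - f s *\<^sub>R E s))"
      using lower[OF st] by (intro \<phi>_nonneg) (auto intro!: strongly_closed_algebra_intros[OF C] mem L E_C)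
    also have "\<dots> = (\<phi> (L o\<^sub>L E t) - \<phi> (L o\<^sub>L E s)) - (f s * \<phi> (E t) - f s * \<phi> (E s))"
      by (simp only: \<phi>_diff \<phi>_scale mem E_C strongly_closed_algebra_intros[OF C])
    finally show "f s * (\<phi> (E t) - \<phi> (E s)) \<le> \<phi> (L o\<^sub>L E t) - \<phi> (L o\<^sub>L E s)"
      by (simp add: algebra_simps)
    have "(f t *\<^sub>R id_blinfun - L) o\<^sub>L (E t - E s) = (f t *\<^sub>R E t - f t *\<^sub>R E s) - ((L o\<^sub>L E t) - (L o\<^sub>L E s))"
      by (rule blinfun_eqI) (simp add: op_apply_simps)
    then have "0 \<le> \<phi> ((f t *\<^sub>R E t - f t *\<^sub>R E s) - ((L o\<^sub>L E t) - (L o\<^sub>L E s)))"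
      using upper[OF st] by (intro \<phi>_nonneg) (auto intro!: strongly_closed_algebra_intros[OF C] mem L E_C)
    also have "\<dots> = (f t * \<phi> (E t) - f t * \<phi> (E s)) - (\<phi> (L o\<^sub>L E t) - \<phi> (L o\<^sub>L E s))"
      by (simp only: \<phi>_diff \<phi>_scale mem E_C strongly_closed_algebra_intros[OF C])
    finally show "\<phi> (L o\<^sub>L E t) - \<phi> (L o\<^sub>L E s) \<le> f t * (\<phi> (E t) - \<phi> (E s))"
      by (simp add: algebra_simps)
  qed
  then show "(LINT x:{a<..c}|\<mu>. f x) = \<phi> (L o\<^sub>L E c)"
    by (simp add: E_low \<phi>_zero)
qed

lemma integral_eq_full:
  assumes L: "L \<in> C" and f: "mono_on {a..b} f" "continuous_on {a..b} f" "f \<in> borel_measurable borel"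
    and lower: "\<And>s t. a \<le> s \<Longrightarrow> s \<le> t \<Longrightarrow> t \<le> b \<Longrightarrow> nonneg_op ((L - f s *\<^sub>R id_blinfun) o\<^sub>L (E t - E s))"
    and upper: "\<And>s t. a \<le> s \<Longrightarrow> s \<le> t \<Longrightarrow> t \<le> b \<Longrightarrow> nonneg_op ((f t *\<^sub>R id_blinfun - L) o\<^sub>L (E t - E s))"
  shows "integrable \<mu> f" "(LINT x|\<mu>. f x) = \<phi> L"
proof -
  note I = integral_eq[OF L f ab lower upper]
  note S = interval_measure_integral_eq_set[OF mono_F \<phi>_right const_F f(3)]
  show "integrable \<mu> f" using I(1) S(1) by simp
  show "(LINT x|\<mu>. f x) = \<phi> L" using I(2) S(2) by (simp add: E_high)
qed

end

lemma spectral_family_quadratic_functional: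
  fixes T :: "'a::{real_inner,complete_space} \<Rightarrow>\<^sub>L 'a"
  assumes "spectral_family T E" "a \<le> b" "\<And>s. s \<le> a \<Longrightarrow> E s = 0" "\<And>s. b \<le> s \<Longrightarrow> E s = id_blinfun"
  shows "spectral_functional T E UNIV (\<lambda>X. inner x (X x)) a b"
proof -
  interpret spectral_family T E by (rule assms(1))
  show ?thesis
  proof unfold_locales
    show "continuous (at_right s) (\<lambda>s. inner x (E s x))" for s
      unfolding continuous_within by (intro tendsto_intros right_cont)
  qed (auto simp: assms strongly_closed_algebra_UNIV blinfun.bilinear_simps inner_simps dest: nonneg_opD)
qed

lemma spectral_family_id_bounds:
  assumes "spectral_family T E" "symmetric_op T"
  shows "s < - norm T \<Longrightarrow> E s = 0" "norm T \<le> s \<Longrightarrow> E s = id_blinfun"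
proof -
  interpret spectral_family T E by (rule assms(1))
  show "s < - norm T \<Longrightarrow> E s = 0"
    by (rule eq_0[of "- norm T"])
      (use norm_bound_symmetric_op(2)[OF assms(2) order_refl] in \<open>simp_all add: add.commute\<close>)
  show "norm T \<le> s \<Longrightarrow> E s = id_blinfun"
    by (rule eq_id[of "norm T"]) (use norm_bound_symmetric_op(1)[OF assms(2) order_refl] in simp_all)
qed

lemma spectral_family_imp_decomposition:
  assumes T: "clinear_op T" "symmetric_op T" and E: "spectral_family T E"
  shows "spectral_decomposition T E"
proof -
  interpret spectral_family T E by (rule E)
  have clin: "clinear_op (E s)" for s
    using spectral_family_mem[OF T(2) E strongly_closed_algebra_clinear] T(1) by simp
  note bounds = spectral_family_id_bounds[OF E T(2)]
  have diff: "clinear_op (E t - E s)" for s t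
    using strongly_closed_algebra_intros(4)[OF strongly_closed_algebra_clinear] clin by blast
  have int: "(LINT s|interval_measure (\<lambda>s. inner x (E s x)). s) = inner x (T x)" for x
  proof -
    interpret spectral_functional T E UNIV "\<lambda>X. inner x (X x)" "- norm T - 1" "norm T"
      by (rule spectral_family_quadratic_functional[OF E])
        (use bounds norm_ge_zero[of T] in \<open>auto simp del: norm_ge_zero\<close>)
    show ?thesis
      by (rule integral_eq_full(2)[of T "\<lambda>s. s"])
        (auto intro!: mono_onI block_lower block_upper)
  qed
  show ?thesis
    unfolding spectral_decomposition_def has_spectral_integral_def
    using bounds clin diff int right_cont T
    by (auto simp: projection_op_def adj_symmetric orth_projection_symmetric[OF proj]
        orth_projection_idem[OF proj] op_le_def positive_op_iff cinner_symmetric_op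
        orth_projection_nonneg[OF block_projection] simp flip: inner_eq_Re_cinner)
qed

lemma orth_projection_absorb:
  assumes P: "orth_projection P" and Q: "orth_projection Q" and le: "nonneg_op (Q - P)"
  shows "Q o\<^sub>L P = P"
proof -
  have "P (w - Q w) = 0" for w
  proof -
    let ?z = "w - Q w"
    have "Q ?z = 0" by (simp add: blinfun.diff_right orth_projection_idem_apply[OF Q])
    then have "inner ?z (P ?z) \<le> 0"
      using nonneg_opD[OF le, of ?z] by (simp add: blinfun.diff_left inner_diff_right)
    moreover have "inner (P ?z) (P ?z) = inner ?z (P ?z)"
      by (simp only: symmetric_opD[OF orth_projection_symmetric[OF P]] orth_projection_idem_apply[OF P])
    ultimately have "inner (P ?z) (P ?z) \<le> 0" by simp
    then show ?thesis by (metis inner_ge_zero inner_eq_zero_iff order_antisym)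
  qed
  then have PQ: "P (Q w) = P w" for w
    by (simp add: blinfun.diff_right)
  have "inner (Q (P x)) y = inner (P x) y" for x y
    by (simp add: symmetric_opD[OF orth_projection_symmetric[OF P]]
        symmetric_opD[OF orth_projection_symmetric[OF Q]] PQ)
  then have "Q (P x) = P x" for x
    using vector_eq_rdot by blast
  then show ?thesis by (intro blinfun_eqI) simp
qed

text \<open>For \<open>u\<close> in the range of \<open>E\<^sub>s\<close> and \<open>v\<close> orthogonal to it the measures of \<open>u\<close> and \<open>v\<close> add up to
  that of \<open>u + v\<close>; hence \<open>\<langle>u, T v\<rangle> = 0\<close>, and \<open>E\<^sub>s\<close> commutes with \<open>T\<close>.\<close>

lemma decomposition_imp_spectral_family:
  assumes T: "clinear_op T" "symmetric_op T" and E: "spectral_decomposition T E"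
  shows "spectral_family T E"
proof -
  have proj_op: "projection_op (E s)" for s using E by (simp add: spectral_decomposition_def)
  have le: "nonneg_op (E t - E s)" if "s \<le> t" for s t
    using E that by (simp add: spectral_decomposition_def op_le_def positive_op_iff)
  have right_cont: "((\<lambda>t. E t x) \<longlongrightarrow> E s x) (at_right s)" for s x
    using E by (simp add: spectral_decomposition_def)
  have low: "E s = 0" if "s < - norm T" for s using E that by (simp add: spectral_decomposition_def)
  have high: "E s = id_blinfun" if "norm T \<le> s" for s using E that by (simp add: spectral_decomposition_def)
  have sym: "symmetric_op (E s)" for s
  proof -
    have "nonneg_op (id_blinfun - E s)"
      using le[of s "max s (norm T)"] high[of "max s (norm T)"] by simp
    from symmetric_op_diff[OF symmetric_op_id nonneg_op_symmetric[OF this]] show ?thesis by simp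
  qed
  have proj: "orth_projection (E s)" for s
    using proj_op[of s] sym by (simp add: projection_op_def orth_projection_def)
  have EE: "E t (E s x) = E s x" "E s (E t x) = E s x" if "s \<le> t" for s t x
  proof -
    have ts: "E t o\<^sub>L E s = E s" by (rule orth_projection_absorb[OF proj proj le[OF that]])
    then show "E t (E s x) = E s x" by (metis blinfun_apply_blinfun_compose)
    have "inner (E s (E t x)) y = inner (E s x) y" for y
      using ts by (simp add: symmetric_opD[OF sym]) (metis blinfun_apply_blinfun_compose)
    then show "E s (E t x) = E s x" using vector_eq_rdot by blast
  qed
  define F where "F x s = inner x (E s x)" for x s
  have F_norm: "F x s = inner (E s x) (E s x)" for x s
    by (simp add: F_def symmetric_opD[OF sym] orth_projection_idem_apply[OF proj])
  have F: "mono (F x)" "continuous (at_right s) (F x)" for x s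
  proof -
    show "mono (F x)"
      unfolding F_def using nonneg_opD[OF le, of _ _ x] by (intro monoI) (simp add: blinfun.diff_left inner_diff_right)
    show "continuous (at_right s) (F x)"
      unfolding F_def continuous_within by (intro tendsto_intros right_cont)
  qed
  have int: "inner x (T x) = (LINT s|interval_measure (F x). s)" for x
    using E unfolding spectral_decomposition_def has_spectral_integral_def F_def
    by (simp add: inner_eq_Re_cinner)
  have *: "inner (E s x) (T (y - E s y)) = 0 \<and>
      inner (E s x) (T (E s x)) \<le> s * inner (E s x) (E s x) \<and>
      s * inner (y - E s y) (y - E s y) \<le> inner (y - E s y) (T (y - E s y))" for s x y
  proof -
    define a b where "a = min (- norm T) s - 1" and "b = max (norm T) s"
    have ab: "a \<le> s" "s \<le> b" "a \<le> b" by (simp_all add: a_def b_def)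
    have const: "F z t = F z a" if "t \<le> a" for z t
      using that low by (simp add: F_def a_def)
    have const': "F z t = F z b" if "b \<le> t" for z t
      using that high by (simp add: F_def b_def)
    have Fa: "F z a = 0" and Fb: "F z b = inner z z" for z
      using low[of a] high[of b] by (simp_all add: F_def a_def b_def)
    define G where "G z t = (LINT r:{a<..t}|interval_measure (F z). r)" for z t
    note G = interval_measure_set_integral_bounds(2,3)[OF F mono_onI, of a b "\<lambda>r. r", folded G_def, simplified]
    have Ga: "G z a = 0" for z by (simp add: G_def set_lebesgue_integral_def)
    have Gb: "G z b = inner z (T z)" for z
      unfolding G_def int by (rule interval_measure_integral_eq_set(2)[OF F const const']) auto
    define u v where "u = E s x" and "v = y - E s y"
    have Eu: "E t u = E t x" if "t \<le> s" for t using that by (simp add: u_def EE)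
    have Eu': "E t u = u" if "s \<le> t" for t using that by (simp add: u_def EE)
    have Ev: "E t v = 0" if "t \<le> s" for t using that by (simp add: v_def blinfun.diff_right EE)
    have Ev': "E t v = E t y - E s y" if "s \<le> t" for t using that by (simp add: v_def blinfun.diff_right EE)
    have uv: "inner u (E t v) = 0" "inner v (E t u) = 0" for t
    proof -
      have "inner u (E t v) = inner x (E s (E t v))" by (simp add: u_def symmetric_opD[OF sym])
      also have "E s (E t v) = 0"
      proof (cases "t \<le> s")
        case False
        then show ?thesis by (simp add: Ev' blinfun.diff_right EE orth_projection_idem_apply[OF proj])
      qed (simp add: Ev blinfun.zero_right)
      finally show "inner u (E t v) = 0" by simp
      then show "inner v (E t u) = 0" using symmetric_opD[OF sym, of t v u] by (simp add: inner_commute)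
    qed
    have Fsum: "F (u + v) t = F u t + F v t" for t
      using uv by (simp add: F_def blinfun.add_right inner_simps)
    have "G (u + v) b = (G u b + G v b) - (G u a + G v a)"
      unfolding G_def[of "u + v"]
    proof (rule interval_measure_set_integral[OF F ab(3)])
      fix p q assume pq: "a \<le> p" "p \<le> q" "q \<le> b"
      show "p * (F (u + v) q - F (u + v) p) \<le> G u q + G v q - (G u p + G v p)"
        using G(1)[OF pq, of u] G(1)[OF pq, of v] by (simp add: Fsum algebra_simps)
      show "G u q + G v q - (G u p + G v p) \<le> q * (F (u + v) q - F (u + v) p)"
        using G(2)[OF pq, of u] G(2)[OF pq, of v] by (simp add: Fsum algebra_simps)
    qed (auto intro!: mono_onI)
    then have "inner (u + v) (T (u + v)) = inner u (T u) + inner v (T v)"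
      by (simp add: Gb Ga)
    then have "inner u (T v) + inner v (T u) = 0"
      by (simp add: blinfun.add_right inner_simps)
    moreover have "inner v (T u) = inner u (T v)"
      by (metis inner_commute symmetric_opD[OF T(2)])
    ultimately have 1: "inner u (T v) = 0" by simp
    have 2: "inner u (T u) \<le> s * inner u u"
      using G(2)[OF order_refl ab(1,2), of u] G(2)[OF ab(1,2) order_refl, of u]
      by (simp add: Gb Ga Fa Fb) (simp add: F_def Eu')
    have 3: "s * inner v v \<le> inner v (T v)"
      using G(1)[OF order_refl ab(1,2), of v] G(1)[OF ab(1,2) order_refl, of v]
      by (simp add: Gb Ga Fa Fb) (simp add: F_def Ev)
    show ?thesis using 1 2 3 by (simp add: u_def v_def)
  qed
  have ETE: "E s (T x) = E s (T (E s x))" "T (E s x) = E s (T (E s x))" for s x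
  proof -
    have "inner z (E s (T (x - E s x))) = 0" for z
      using *[of s z x] symmetric_opD[OF sym, of s z "T (x - E s x)"] by simp
    then have "E s (T (x - E s x)) = 0" by - (rule inner_eqI, simp)
    then show "E s (T x) = E s (T (E s x))" by (simp add: blinfun.diff_right)
    have "inner z (T (E s x) - E s (T (E s x))) = inner (z - E s z) (T (E s x))" for z
      by (simp add: inner_simps symmetric_opD[OF sym])
    also have "\<dots> z = inner (E s x) (T (z - E s z))" for z
      by (metis inner_commute symmetric_opD[OF T(2)])
    finally have "inner z (T (E s x) - E s (T (E s x))) = 0" for z
      using * by simp
    then have "T (E s x) - E s (T (E s x)) = 0" by - (rule inner_eqI, simp)
    then show "T (E s x) = E s (T (E s x))" by simp
  qed
  have comm: "E s o\<^sub>L T = T o\<^sub>L E s" for s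
    by (rule blinfun_eqI, unfold blinfun_apply_blinfun_compose, rule trans[OF ETE(1) ETE(2)[symmetric]])
  have comm': "E s (T x) = T (E s x)" for s x
    by (rule commute_apply[OF comm])
  show ?thesis
  proof
    show "nonneg_op ((s *\<^sub>R id_blinfun - T) o\<^sub>L E s)" for s
      unfolding nonneg_op_def
    proof (intro conjI allI)
      show "symmetric_op ((s *\<^sub>R id_blinfun - T) o\<^sub>L E s)"
        by (intro symmetric_op_compose symmetric_op_intros sym T symmetric_op_id blinfun_eqI)
          (simp add: op_apply_simps comm')
      fix x
      have "inner x (((s *\<^sub>R id_blinfun - T) o\<^sub>L E s) x) = s * inner (E s x) (E s x) - inner (E s x) (T (E s x))"
        by (simp add: op_apply_simps inner_simps symmetric_opD[OF sym] comm' orth_projection_idem_apply[OF proj])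
      then show "0 \<le> inner x (((s *\<^sub>R id_blinfun - T) o\<^sub>L E s) x)" using * by simp
    qed
    show "nonneg_op ((T - s *\<^sub>R id_blinfun) o\<^sub>L (id_blinfun - E s))" for s
      unfolding nonneg_op_def
    proof (intro conjI allI)
      show "symmetric_op ((T - s *\<^sub>R id_blinfun) o\<^sub>L (id_blinfun - E s))"
        by (intro symmetric_op_compose symmetric_op_intros sym T symmetric_op_id blinfun_eqI)
          (simp add: op_apply_simps comm')
      fix x
      have "inner x (((T - s *\<^sub>R id_blinfun) o\<^sub>L (id_blinfun - E s)) x) =
          inner (x - E s x) (T (x - E s x)) - s * inner (x - E s x) (x - E s x)"
        by (simp add: op_apply_simps inner_simps symmetric_opD[OF sym] comm' orth_projection_idem_apply[OF proj]
            algebra_simps)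
      then show "0 \<le> inner x (((T - s *\<^sub>R id_blinfun) o\<^sub>L (id_blinfun - E s)) x)" using * by simp
    qed
  qed (auto intro!: proj comm right_cont blinfun_eqI simp: EE)
qed

lemma resolution_spectral_family:
  assumes T: "clinear_op T" "symmetric_op T"
  shows "spectral_family T (resolution T)"
proof -
  obtain E where "spectral_family T E"
    by (rule spectral_family_exists[OF T(2)])
  then have "spectral_decomposition T E"
    by (rule spectral_family_imp_decomposition[OF T])
  then have "spectral_decomposition T (resolution T)"
    unfolding resolution_def by (rule someI[where P = "spectral_decomposition T"])
  then show ?thesis by (rule decomposition_imp_spectral_family[OF T])
qed

lemma has_spectral_integral_unique:
  assumes "has_spectral_integral E f L" "has_spectral_integral E f L'"
  shows "L = L'"
proof -
  have lin: "clinear_op L" "clinear_op L'" using assms by (simp_all add: has_spectral_integral_def)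
  have eq: "inner x (L x) = inner x (L' x)" for x
    using assms by (simp add: has_spectral_integral_def inner_eq_Re_cinner)
  have "symmetric_op L" "symmetric_op L'"
    using assms by (simp_all add: symmetric_op_Im lin has_spectral_integral_def)
  then have "L - L' = 0"
    by (intro symmetric_op_eq_0I symmetric_op_diff)
      (simp_all add: blinfun.diff_left inner_diff_right eq)
  then show ?thesis by simp
qed

lemma log_op_spectral:
  assumes T: "clinear_op T" and low: "nonneg_op (T - a *\<^sub>R id_blinfun)"
    and up: "nonneg_op (K *\<^sub>R id_blinfun - T)" and a: "0 < a" "a \<le> K"
  shows "strongly_closed_algebra C \<Longrightarrow> T \<in> C \<Longrightarrow> log_op T \<in> C"
    and "P o\<^sub>L T = T o\<^sub>L P \<Longrightarrow> 0 < r \<Longrightarrow> r \<le> K \<Longrightarrow>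
      nonneg_op (e *\<^sub>R ((T - r *\<^sub>R id_blinfun) o\<^sub>L P)) \<Longrightarrow>
      nonneg_op (e *\<^sub>R ((log_op T - ln r *\<^sub>R id_blinfun) o\<^sub>L P))"
proof -
  obtain L where mem: "\<And>C. strongly_closed_algebra C \<Longrightarrow> T \<in> C \<Longrightarrow> L \<in> C"
    and bd: "\<And>P r e. P o\<^sub>L T = T o\<^sub>L P \<Longrightarrow> 0 < r \<Longrightarrow> r \<le> K \<Longrightarrow>
      nonneg_op (e *\<^sub>R ((T - r *\<^sub>R id_blinfun) o\<^sub>L P)) \<Longrightarrow>
      nonneg_op (e *\<^sub>R ((L - ln r *\<^sub>R id_blinfun) o\<^sub>L P))"
    by (rule log_operator_exists[OF low up a]) blast
  have Tsym: "symmetric_op T"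
    using symmetric_op_diff[OF symmetric_op_scaleR[OF symmetric_op_id, of K] nonneg_op_symmetric[OF up]]
    by simp
  have Llin: "clinear_op L"
    using mem[OF strongly_closed_algebra_clinear] T by simp
  have "nonneg_op (1 *\<^sub>R ((L - ln a *\<^sub>R id_blinfun) o\<^sub>L id_blinfun))"
    by (rule bd) (use a low in simp_all)
  then have "nonneg_op (L - ln a *\<^sub>R id_blinfun)"
    by simp
  from symmetric_op_add[OF nonneg_op_symmetric[OF this] symmetric_op_scaleR[OF symmetric_op_id, of "ln a"]]
  have Lsym: "symmetric_op L" by simp
  let ?E = "resolution T"
  interpret spectral_family T ?E by (rule resolution_spectral_family[OF T Tsym])
  have "has_spectral_integral ?E ln L"
    unfolding has_spectral_integral_def
  proof (intro conjI allI)
    fix x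
    interpret spectral_functional T ?E UNIV "\<lambda>X. inner x (X x)" "a / 2" K
      by (rule spectral_family_quadratic_functional)
        (use a eq_0[OF low] eq_id[OF up] in \<open>auto intro: spectral_family_axioms\<close>)
    have "(LINT s|\<mu>. ln s) = inner x (L x)"
    proof (rule integral_eq_full(2))
      show "mono_on {a / 2..K} ln" "continuous_on {a / 2..K} ln"
        using a by (auto intro!: mono_onI continuous_intros)
      fix s t assume st: "a / 2 \<le> s" "s \<le> t" "t \<le> K"
      show "nonneg_op ((L - ln s *\<^sub>R id_blinfun) o\<^sub>L (?E t - ?E s))"
        using bd[OF block_commute, of s 1 t s] block_lower[OF st(2)] st a by simp
      have neg: "-1 *\<^sub>R ((X - Y) o\<^sub>L Z) = (Y - X) o\<^sub>L Z" for X Y Z :: "'a \<Rightarrow>\<^sub>L 'a"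
        by (rule blinfun_eqI) (simp add: op_apply_simps)
      show "nonneg_op ((ln t *\<^sub>R id_blinfun - L) o\<^sub>L (?E t - ?E s))"
        using bd[OF block_commute, of t "-1" t s] block_upper[OF st(2)] st a by (simp only: neg)
    qed auto
    then show "cinner x (L x) = complex_of_real (LINT s|interval_measure (\<lambda>s. Re (cinner x (?E s x))). ln s)"
      by (simp add: cinner_symmetric_op[OF Llin Lsym] flip: inner_eq_Re_cinner)
  qed (rule Llin)
  then have L: "log_op T = L"
    unfolding log_op_def by (intro the_equality) (auto intro: has_spectral_integral_unique)
  show "strongly_closed_algebra C \<Longrightarrow> T \<in> C \<Longrightarrow> log_op T \<in> C"
    and "P o\<^sub>L T = T o\<^sub>L P \<Longrightarrow> 0 < r \<Longrightarrow> r \<le> K \<Longrightarrow>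
      nonneg_op (e *\<^sub>R ((T - r *\<^sub>R id_blinfun) o\<^sub>L P)) \<Longrightarrow>
      nonneg_op (e *\<^sub>R ((log_op T - ln r *\<^sub>R id_blinfun) o\<^sub>L P))"
    unfolding L by (rule mem bd; assumption)+
qed

lemma inv_op_eq: "A o\<^sub>L B = id_blinfun \<Longrightarrow> B o\<^sub>L A = id_blinfun \<Longrightarrow> inv_op A = B"
  unfolding inv_op_def
  by (rule the_equality) (auto, metis blinfun_compose_assoc compose_id_blinfun)

lemma inv_op_nonneg:
  fixes T :: "'a::chilbert_space \<Rightarrow>\<^sub>L 'a"
  assumes low: "nonneg_op (T - a *\<^sub>R id_blinfun)" "0 < a"
  shows "T o\<^sub>L inv_op T = id_blinfun" "inv_op T o\<^sub>L T = id_blinfun"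
    "strongly_closed_algebra C \<Longrightarrow> T \<in> C \<Longrightarrow> inv_op T \<in> C" "nonneg_op (inv_op T)"
proof -
  obtain B where B: "T o\<^sub>L B = id_blinfun" "B o\<^sub>L T = id_blinfun"
    and mem: "\<And>C. strongly_closed_algebra C \<Longrightarrow> T \<in> C \<Longrightarrow> B \<in> C"
    by (rule inverse_operator_exists[OF low]) blast
  have inv: "inv_op T = B" by (rule inv_op_eq[OF B])
  have T: "nonneg_op T"
    using nonneg_op_add[OF low(1) nonneg_op_scaleR[OF nonneg_op_id, of a]] low(2) by simp
  have TB: "T (B x) = x" for x
    using B(1) by (metis blinfun_apply_blinfun_compose blinfun_apply_id_blinfun)
  have "inner (B x) y = inner x (B y)" for x y
    using symmetric_opD[OF nonneg_op_symmetric[OF T], of "B x" "B y"] by (simp add: TB)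
  moreover have "0 \<le> inner x (B x)" for x
    using nonneg_opD[OF T, of "B x"] by (simp add: TB inner_commute)
  ultimately have "nonneg_op B" by (simp add: nonneg_op_def symmetric_op_def)
  then show "T o\<^sub>L inv_op T = id_blinfun" "inv_op T o\<^sub>L T = id_blinfun"
    "strongly_closed_algebra C \<Longrightarrow> T \<in> C \<Longrightarrow> inv_op T \<in> C" "nonneg_op (inv_op T)"
    unfolding inv using B mem by blast+
qed

section \<open>Traces\<close>

locale traced_algebra =
  fixes R :: "('h::chilbert_space \<Rightarrow>\<^sub>L 'h) set" and \<tau> :: "'h \<Rightarrow>\<^sub>L 'h \<Rightarrow> complex"
  assumes vN: "von_neumann_algebra R" and trace: "faithful_normal_tracial_state R \<tau>"
begin

abbreviation tr :: "('h \<Rightarrow>\<^sub>L 'h) \<Rightarrow> real" where "tr X \<equiv> Re (\<tau> X)"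

lemma R: "strongly_closed_algebra R"
  by (rule strongly_closed_algebra_von_neumann[OF vN])

lemmas R_intros = strongly_closed_algebra_intros[OF R]

lemma R_clinear: "X \<in> R \<Longrightarrow> clinear_op X"
  using vN by (simp add: von_neumann_algebra_def)

lemma R_positive: "X \<in> R \<Longrightarrow> positive_op X \<longleftrightarrow> nonneg_op X"
  by (simp add: positive_op_iff R_clinear)

lemma tr_add: "X \<in> R \<Longrightarrow> Y \<in> R \<Longrightarrow> tr (X + Y) = tr X + tr Y"
  and tr_id: "tr id_blinfun = 1"
  and tr_commute: "X \<in> R \<Longrightarrow> Y \<in> R \<Longrightarrow> tr (X o\<^sub>L Y) = tr (Y o\<^sub>L X)"
  using trace by (simp_all add: faithful_normal_tracial_state_def state_on_def clinear_on_def)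

lemma tr_scaleR: "X \<in> R \<Longrightarrow> tr (r *\<^sub>R X) = r * tr X"
  using trace
  by (simp add: faithful_normal_tracial_state_def state_on_def clinear_on_def scaleR_scaleC scaleC_complex_def)

lemma tr_nonneg: "X \<in> R \<Longrightarrow> nonneg_op X \<Longrightarrow> 0 \<le> tr X"
  using trace
  by (simp add: faithful_normal_tracial_state_def state_on_def R_positive complex_nonneg_Reals_iff)

lemma tr_diff: "X \<in> R \<Longrightarrow> Y \<in> R \<Longrightarrow> tr (X - Y) = tr X - tr Y"
  using tr_add[of X "-1 *\<^sub>R Y"] tr_scaleR[of Y "-1"] by (simp add: R_intros)

lemma tr_mono: "X \<in> R \<Longrightarrow> Y \<in> R \<Longrightarrow> nonneg_op (Y - X) \<Longrightarrow> tr X \<le> tr Y"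
  using tr_nonneg[of "Y - X"] tr_diff[of Y X] by (simp add: R_intros)

lemma tr_compress_le:
  assumes Y: "Y \<in> R" "nonneg_op Y" and P: "P \<in> R" "orth_projection P"
  shows "tr (P o\<^sub>L (Y o\<^sub>L P)) \<le> tr Y"
proof -
  have cyc: "tr (Q o\<^sub>L (Y o\<^sub>L Q)) = tr (Y o\<^sub>L Q)" if "Q \<in> R" "orth_projection Q" for Q
  proof -
    have "tr (Q o\<^sub>L (Y o\<^sub>L Q)) = tr ((Y o\<^sub>L Q) o\<^sub>L Q)"
      using that Y by (intro tr_commute R_intros)
    then show ?thesis using orth_projection_idem[OF that(2)] by (simp add: blinfun_compose_assoc)
  qed
  let ?Q = "id_blinfun - P"
  have Q: "?Q \<in> R" "orth_projection ?Q"
    using P by (auto intro: R_intros orth_projection_compl)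
  have "0 \<le> tr (?Q o\<^sub>L (Y o\<^sub>L ?Q))"
    by (intro tr_nonneg R_intros(7) nonneg_op_sandwich orth_projection_symmetric Y Q)
  also have "\<dots> = tr (Y o\<^sub>L ?Q)" by (rule cyc[OF Q])
  also have "Y o\<^sub>L ?Q = Y - (Y o\<^sub>L P)" by (rule blinfun_eqI) (simp add: op_apply_simps)
  also have "tr (Y - (Y o\<^sub>L P)) = tr Y - tr (Y o\<^sub>L P)"
    using Y P by (intro tr_diff R_intros)
  finally show ?thesis by (simp add: cyc[OF P])
qed

text \<open>Normality is applied to the increasing net \<open>1 - E\<^sub>t\<close>, \<open>t > s\<close>, whose supremum is \<open>1 - E\<^sub>s\<close>.\<close>

lemma tr_right_continuous:
  assumes E: "spectral_family T E" and mem: "\<And>s. E s \<in> R"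
  shows "continuous (at_right s) (\<lambda>s. tr (E s))"
proof -
  interpret spectral_family T E by (rule E)
  let ?D = "(\<lambda>t. id_blinfun - E t) ` {s<..}"
  have sa: "id_blinfun - E t \<in> selfadjoint_part R" for t
    using mem orth_projection_symmetric[OF orth_projection_compl[OF proj]]
    by (auto simp: selfadjoint_part_def R_intros adj_symmetric R_clinear)
  have le: "op_le (id_blinfun - E t) (id_blinfun - E t')" if "t' \<le> t" for t t'
    using orth_projection_nonneg[OF block_projection[OF that]] mem
    by (simp add: op_le_def R_positive R_intros)
  have dir: "directed_op ?D"
    unfolding directed_op_def
  proof (intro conjI ballI)
    show "?D \<noteq> {}" by (auto intro: gt_ex)
    fix X Y assume "X \<in> ?D" "Y \<in> ?D"
    then obtain t t' where "t > s" "t' > s" "X = id_blinfun - E t" "Y = id_blinfun - E t'" by auto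
    then show "\<exists>U\<in>?D. op_le X U \<and> op_le Y U"
      by (intro bexI[of _ "id_blinfun - E (min t t')"]) (auto intro!: le)
  qed
  have lub: "is_lub_op R ?D (id_blinfun - E s)"
    unfolding is_lub_op_def
  proof (intro conjI ballI impI)
    fix B assume "B \<in> selfadjoint_part R" and B: "\<forall>S\<in>?D. op_le S B"
    then have BR: "B \<in> R" by (simp add: selfadjoint_part_def)
    have nn: "nonneg_op (B - (id_blinfun - E t))" if "t > s" for t
      using B that mem BR by (auto simp: op_le_def positive_op_iff)
    have "nonneg_op (B - (id_blinfun - E s))"
    proof (rule strong_limit_nonneg[where F = "at_right s"])
      show "((\<lambda>t. blinfun_apply (B - (id_blinfun - E t)) x) \<longlongrightarrow> blinfun_apply (B - (id_blinfun - E s)) x) (at_right s)" for x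
        unfolding blinfun.diff_left by (intro tendsto_intros right_cont)
      show "\<forall>\<^sub>F t in at_right s. nonneg_op (B - (id_blinfun - E t))"
        using nn by (auto simp: eventually_at_filter)
    qed simp
    then show "op_le (id_blinfun - E s) B"
      using mem BR by (simp add: op_le_def R_positive R_intros)
  qed (auto intro!: sa le)
  have "normal_on R \<tau>" using trace by (simp add: faithful_normal_tracial_state_def)
  moreover have "?D \<subseteq> selfadjoint_part R" using sa by auto
  ultimately have "tr (id_blinfun - E s) = (SUP S\<in>?D. tr S)"
    using dir lub by (simp add: normal_on_def)
  then have sup: "1 - tr (E s) = (SUP t\<in>{s<..}. 1 - tr (E t))"
    using mem by (simp add: image_image tr_diff tr_id R_intros)
  have mono: "tr (E t) \<le> tr (E t')" if "t \<le> t'" for t t'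
    by (rule tr_mono[OF mem mem orth_projection_nonneg[OF block_projection[OF that]]])
  have bdd: "bdd_above ((\<lambda>t. 1 - tr (E t)) ` {s<..})"
    by (rule bdd_aboveI2[where M = "1 - tr (E s)"]) (auto intro!: mono)
  show ?thesis
    unfolding continuous_within
  proof (rule tendstoI)
    fix e :: real assume "e > 0"
    then have "1 - tr (E s) - e < (SUP t\<in>{s<..}. 1 - tr (E t))" using sup by simp
    then obtain t where t: "t > s" "1 - tr (E s) - e < 1 - tr (E t)"
      using less_cSUP_iff[OF _ bdd] by auto
    have "dist (tr (E u)) (tr (E s)) < e" if "s < u" "u < t" for u
      using mono[of s u] mono[of u t] that t(2) by (simp add: dist_real_def)
    then show "\<forall>\<^sub>F u in at_right s. dist (tr (E u)) (tr (E s)) < e"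
      using t(1) by (auto simp: eventually_at_right[OF t(1)])
  qed
qed

lemma resolution_functional:
  assumes T: "T \<in> R" and low: "nonneg_op (T - l *\<^sub>R id_blinfun)" and up: "nonneg_op (b *\<^sub>R id_blinfun - T)"
    and "a < l" "a \<le> b"
  shows "spectral_functional T (resolution T) R tr a b"
proof -
  have Tsym: "symmetric_op T"
    using symmetric_op_diff[OF symmetric_op_scaleR[OF symmetric_op_id, of b] nonneg_op_symmetric[OF up]]
    by simp
  have fam: "spectral_family T (resolution T)"
    by (rule resolution_spectral_family[OF R_clinear[OF T] Tsym])
  then interpret spectral_family T "resolution T" .
  have mem: "resolution T s \<in> R" for s
    by (rule spectral_family_mem[OF Tsym fam R T])
  show ?thesis
    by unfold_locales
      (use assms in \<open>auto intro: R mem tr_add tr_scaleR tr_nonneg tr_right_continuous[OF fam mem]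
        eq_0[OF low] eq_id[OF up]\<close>)
qed

lemma tr_log_inv:
  assumes T: "T \<in> R" and low: "nonneg_op (T - a *\<^sub>R id_blinfun)" "0 < a"
  shows "tr (log_op (inv_op T)) = - tr (log_op T)"
proof -
  note inv = inv_op_nonneg[OF low]
  let ?B = "inv_op T"
  have B: "?B \<in> R" by (rule inv(3)[OF R T])
  obtain a' where a': "0 < a'" "nonneg_op (?B - a' *\<^sub>R id_blinfun)"
    by (rule invertible_nonneg_lower_bound[OF inv(4,1)])
  define K where "K = norm T + a"
  define K' where "K' = norm ?B + a' + 2 / a"
  have Tsym: "symmetric_op T"
    using symmetric_op_add[OF nonneg_op_symmetric[OF low(1)] symmetric_op_scaleR[OF symmetric_op_id, of a]]
    by simp
  have K: "a \<le> K" "nonneg_op (K *\<^sub>R id_blinfun - T)"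
    using low by (auto simp: K_def intro!: norm_bound_symmetric_op Tsym)
  have K': "a' \<le> K'" "2 / a \<le> K'" "nonneg_op (K' *\<^sub>R id_blinfun - ?B)"
    using low a' by (auto simp: K'_def intro!: norm_bound_symmetric_op nonneg_op_symmetric inv add_nonneg_nonneg)
  note L = log_op_spectral[OF R_clinear[OF T] low(1) K(2) low(2) K(1)]
  note L' = log_op_spectral[OF R_clinear[OF B] a'(2) K'(3) a'(1) K'(1)]
  let ?E = "resolution T"
  interpret spectral_functional T ?E R tr "a / 2" K
    by (rule resolution_functional[OF T low(1) K(2)]) (use low K in auto)
  have TB: "T (?B x) = x" "?B (T x) = x" for x
    using inv(1,2) by (metis blinfun_apply_blinfun_compose blinfun_apply_id_blinfun)+
  have "mono_on {a / 2..K} ln" "continuous_on {a / 2..K} ln"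
    using low by (auto intro!: mono_onI continuous_intros)
  moreover have "(ln :: real \<Rightarrow> real) \<in> borel_measurable borel" by measurable
  ultimately have f: "mono_on {a / 2..K} ln" "continuous_on {a / 2..K} ln"
    "(ln :: real \<Rightarrow> real) \<in> borel_measurable borel" .
  have neg: "-1 *\<^sub>R ((X - Y) o\<^sub>L Z) = (Y - X) o\<^sub>L Z" for X Y Z :: "'h \<Rightarrow>\<^sub>L 'h"
    by (rule blinfun_eqI) (simp add: op_apply_simps)
  have "(LINT s|\<mu>. ln s) = tr (log_op T)"
  proof (rule integral_eq_full(2)[OF L(1)[OF R T] f])
    fix s t assume st: "a / 2 \<le> s" "s \<le> t" "t \<le> K"
    show "nonneg_op ((log_op T - ln s *\<^sub>R id_blinfun) o\<^sub>L (?E t - ?E s))"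
      using L(2)[OF block_commute, of s 1 t s] block_lower[OF st(2)] st low by simp
    show "nonneg_op ((ln t *\<^sub>R id_blinfun - log_op T) o\<^sub>L (?E t - ?E s))"
      using L(2)[OF block_commute, of t "-1" t s] block_upper[OF st(2)] st low by (simp only: neg)
  qed
  moreover have "(LINT s|\<mu>. ln s) = tr (- log_op ?B)"
  proof (rule integral_eq_full(2)[OF R_intros(5)[OF L'(1)[OF R B]] f])
    fix s t assume st: "a / 2 \<le> s" "s \<le> t" "t \<le> K"
    let ?D = "?E t - ?E s"
    have pos: "0 < s" "0 < t" using st low by auto
    have le: "1 / s \<le> K'" "1 / t \<le> K'"
    proof -
      have "1 / s \<le> 1 / (a / 2)" using st low by (intro divide_left_mono) auto
      then show "1 / s \<le> K'" using K'(2) by simp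
      moreover have "1 / t \<le> 1 / s" using st pos by (intro divide_left_mono) auto
      ultimately show "1 / t \<le> K'" by simp
    qed
    have DT: "T (?D x) = ?D (T x)" for x
      using commute_apply[OF block_commute] by metis
    have DB: "?B (?D x) = ?D (?B x)" for x
      by (metis DT TB)
    have comm: "?D o\<^sub>L ?B = ?B o\<^sub>L ?D"
      by (rule blinfun_eqI) (simp add: DB del: minus_blinfun.rep_eq)
    have "nonneg_op ((1 / s) *\<^sub>R (?B o\<^sub>L ((T - s *\<^sub>R id_blinfun) o\<^sub>L ?D)))"
      using pos by (intro nonneg_op_scaleR nonneg_op_compose[OF inv(4) block_lower[OF st(2)]] blinfun_eqI)
        (simp_all add: blinfun.diff_left[of T] blinfun.diff_right[of ?B] blinfun.scaleR_left
          blinfun.scaleR_right TB DB DT del: minus_blinfun.rep_eq)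
    also have "(1 / s) *\<^sub>R (?B o\<^sub>L ((T - s *\<^sub>R id_blinfun) o\<^sub>L ?D)) = -1 *\<^sub>R ((?B - (1 / s) *\<^sub>R id_blinfun) o\<^sub>L ?D)"
      using pos by (intro blinfun_eqI)
        (simp add: blinfun.diff_left[of T] blinfun.diff_left[of ?B] blinfun.diff_right[of ?B] blinfun.scaleR_left
          blinfun.scaleR_right blinfun.minus_left TB scaleR_diff_right)
    finally have "nonneg_op (-1 *\<^sub>R ((log_op ?B - ln (1 / s) *\<^sub>R id_blinfun) o\<^sub>L ?D))"
      using pos le by (intro L'(2)[OF comm]) auto
    also have "-1 *\<^sub>R ((log_op ?B - ln (1 / s) *\<^sub>R id_blinfun) o\<^sub>L ?D) = (- log_op ?B - ln s *\<^sub>R id_blinfun) o\<^sub>L ?D"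
      using pos by (intro blinfun_eqI) (simp add: op_apply_simps ln_div)
    finally show "nonneg_op ((- log_op ?B - ln s *\<^sub>R id_blinfun) o\<^sub>L ?D)" .
    have "nonneg_op ((1 / t) *\<^sub>R (?B o\<^sub>L ((t *\<^sub>R id_blinfun - T) o\<^sub>L ?D)))"
      using pos by (intro nonneg_op_scaleR nonneg_op_compose[OF inv(4) block_upper[OF st(2)]] blinfun_eqI)
        (simp_all add: blinfun.diff_left[of _ T] blinfun.diff_right[of ?B] blinfun.scaleR_left
          blinfun.scaleR_right TB DB DT del: minus_blinfun.rep_eq)
    also have "(1 / t) *\<^sub>R (?B o\<^sub>L ((t *\<^sub>R id_blinfun - T) o\<^sub>L ?D)) = 1 *\<^sub>R ((?B - (1 / t) *\<^sub>R id_blinfun) o\<^sub>L ?D)"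
      using pos by (intro blinfun_eqI)
        (simp add: blinfun.diff_left[of _ T] blinfun.diff_left[of ?B] blinfun.diff_right[of ?B] blinfun.scaleR_left
          blinfun.scaleR_right TB scaleR_diff_right)
    finally have "nonneg_op (1 *\<^sub>R ((log_op ?B - ln (1 / t) *\<^sub>R id_blinfun) o\<^sub>L ?D))"
      using pos le by (intro L'(2)[OF comm]) auto
    also have "1 *\<^sub>R ((log_op ?B - ln (1 / t) *\<^sub>R id_blinfun) o\<^sub>L ?D) = (ln t *\<^sub>R id_blinfun - - log_op ?B) o\<^sub>L ?D"
      using pos by (intro blinfun_eqI) (simp add: op_apply_simps ln_div)
    finally show "nonneg_op ((ln t *\<^sub>R id_blinfun - - log_op ?B) o\<^sub>L ?D)" .
  qed
  moreover have "tr (- log_op ?B) = - tr (log_op ?B)"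
    using tr_scaleR[OF L'(1)[OF R B], of "-1"] by simp
  ultimately show ?thesis by simp
qed

text \<open>Let \<open>P\<close> be the spectral projection of \<open>\<Phi> A\<close> for \<open>(-\<infinity>, c]\<close> and \<open>(c - A)\<^sub>+\<close> the positive part.
  Then \<open>\<tau>((c - \<Phi> A)\<^sub>+) = \<tau>(P \<Phi>(c - A) P) \<le> \<tau>(P \<Phi>((c - A)\<^sub>+) P) \<le> \<tau>(\<Phi>((c - A)\<^sub>+)) = \<tau>((c - A)\<^sub>+)\<close>:
  the spectral distribution of \<open>\<Phi> A\<close> is dominated in the convex order, and no operator inequality
  for \<open>\<Phi>\<close> beyond positivity is needed.\<close>

lemma tr_positive_part_le:
  assumes \<Phi>: "unital_positive_map R \<Phi>" "trace_preserving R \<tau> \<Phi>"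
    and A: "A \<in> R" "symmetric_op A" and EA: "spectral_family A E"
    and \<Phi>A: "symmetric_op (\<Phi> A)" and EB: "spectral_family (\<Phi> A) G"
  shows "tr ((c *\<^sub>R id_blinfun - \<Phi> A) o\<^sub>L G c) \<le> tr ((c *\<^sub>R id_blinfun - A) o\<^sub>L E c)"
proof -
  interpret A: spectral_family A E by (rule EA)
  interpret B: spectral_family "\<Phi> A" G by (rule EB)
  have \<Phi>R: "\<Phi> X \<in> R" if "X \<in> R" for X using \<Phi>(1) that by (auto simp: unital_positive_map_def)
  have E: "E s \<in> R" for s by (rule spectral_family_mem[OF A(2) EA R A(1)])
  have G: "G s \<in> R" for s by (rule spectral_family_mem[OF \<Phi>A EB R \<Phi>R[OF A(1)]])
  have \<Phi>_nonneg: "nonneg_op (\<Phi> X)" if "X \<in> R" "nonneg_op X" for X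
    using \<Phi>(1) that R_positive[OF that(1)] R_positive[OF \<Phi>R[OF that(1)]]
    by (simp add: unital_positive_map_def)
  have \<Phi>_lin: "\<Phi> (X - Y) = \<Phi> X - \<Phi> Y" "\<Phi> (r *\<^sub>R X) = r *\<^sub>R \<Phi> X" if "X \<in> R" "Y \<in> R" for X Y r
  proof -
    have *: "\<Phi> (X + Y) = \<Phi> X + \<Phi> Y" "\<Phi> (r *\<^sub>R X) = r *\<^sub>R \<Phi> X" if "X \<in> R" "Y \<in> R" for X Y r
      using \<Phi>(1) that by (simp_all add: unital_positive_map_def clinear_on_def scaleR_scaleC)
    show "\<Phi> (r *\<^sub>R X) = r *\<^sub>R \<Phi> X" by (rule *(2)[OF that])
    show "\<Phi> (X - Y) = \<Phi> X - \<Phi> Y"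
      using *(1)[OF that(1) R_intros(6)[OF that(2)], of "-1"] *(2)[OF that(2) that(2), of "-1"] by simp
  qed
  have \<Phi>_id: "\<Phi> id_blinfun = id_blinfun" using \<Phi>(1) by (simp add: unital_positive_map_def)
  define X where "X = c *\<^sub>R id_blinfun - A"
  define X' where "X' = X o\<^sub>L E c"
  have X: "X \<in> R" "X' \<in> R" using A E by (auto simp: X_def X'_def intro!: R_intros)
  have \<Phi>X: "\<Phi> X = c *\<^sub>R id_blinfun - \<Phi> A"
    using A(1) by (simp add: X_def \<Phi>_lin \<Phi>_id R_intros)
  have X'_nonneg: "nonneg_op X'" unfolding X'_def X_def by (rule A.upper)
  have "X' - X = (A - c *\<^sub>R id_blinfun) o\<^sub>L (id_blinfun - E c)"
    by (rule blinfun_eqI) (simp add: X'_def X_def op_apply_simps)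
  then have "nonneg_op (\<Phi> (X' - X))"
    using A.lower X by (intro \<Phi>_nonneg R_intros) simp_all
  then have diff: "nonneg_op (\<Phi> X' - \<Phi> X)" using X by (simp add: \<Phi>_lin)
  have "(c *\<^sub>R id_blinfun - \<Phi> A) o\<^sub>L G c = G c o\<^sub>L (\<Phi> X o\<^sub>L G c)"
    by (rule blinfun_eqI)
      (simp add: \<Phi>X op_apply_simps orth_projection_idem_apply[OF B.proj] commute_apply[OF B.comm])
  also have "tr \<dots> \<le> tr (G c o\<^sub>L (\<Phi> X' o\<^sub>L G c))"
  proof (rule tr_mono)
    have "(G c o\<^sub>L (\<Phi> X' o\<^sub>L G c)) - (G c o\<^sub>L (\<Phi> X o\<^sub>L G c)) = G c o\<^sub>L ((\<Phi> X' - \<Phi> X) o\<^sub>L G c)"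
      by (rule blinfun_eqI) (simp add: op_apply_simps)
    then show "nonneg_op ((G c o\<^sub>L (\<Phi> X' o\<^sub>L G c)) - (G c o\<^sub>L (\<Phi> X o\<^sub>L G c)))"
      using nonneg_op_sandwich[OF diff orth_projection_symmetric[OF B.proj]] by simp
  qed (intro R_intros \<Phi>R G X)+
  also have "\<dots> \<le> tr (\<Phi> X')"
    by (intro tr_compress_le \<Phi>R X \<Phi>_nonneg X'_nonneg G B.proj)
  also have "\<dots> = tr X'" using \<Phi>(2) X by (simp add: trace_preserving_def)
  finally show ?thesis by (simp add: X'_def X_def)
qed

end

section \<open>The logarithmic integral\<close>

text \<open>The convex function \<open>ln M - ln x + x / M - 1\<close> on \<open>[0, M]\<close> is a mixture of the functions
  \<open>(c - x)\<^sub>+\<close>, with density \<open>1 / c\<^sup>2\<close>.  (\<open>ennreal\<close> truncates at 0.)\<close>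

lemma nn_integral_positive_part_kernel:
  fixes x M :: real
  assumes "0 \<le> x" "x \<le> M" "0 < M"
  shows "(\<integral>\<^sup>+c. indicator {0<..M} c * (ennreal (c - x) * ennreal (1 / c\<^sup>2)) \<partial>lborel) =
    (if x = 0 then \<infinity> else ennreal (ln M - ln x + x / M - 1))" (is "?h x = _")
proof -
  have pos: "?h y = ennreal (ln M - ln y + y / M - 1)" if y: "0 < y" "y \<le> M" for y
  proof -
    have "?h y = (\<integral>\<^sup>+c. ennreal ((c - y) / c\<^sup>2) * indicator {y..M} c \<partial>lborel)"
    proof (intro nn_integral_cong)
      fix c :: real
      show "indicator {0<..M} c * (ennreal (c - y) * ennreal (1 / c\<^sup>2)) = ennreal ((c - y) / c\<^sup>2) * indicator {y..M} c"
        using y by (cases "y \<le> c"; cases "c \<le> M")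
          (auto simp: indicator_def ennreal_neg simp flip: ennreal_mult)
    qed
    also have "\<dots> = ennreal ((ln M + y / M) - (ln y + y / y))"
    proof (rule nn_integral_FTC_Icc)
      fix c assume "c \<in> {y..M}"
      then have c: "c > 0" "y \<le> c" using y by auto
      then show "((\<lambda>c. ln c + y / c) has_real_derivative (c - y) / c\<^sup>2) (at c)"
        by (auto intro!: derivative_eq_intros simp: field_simps power2_eq_square)
      show "0 \<le> (c - y) / c\<^sup>2" using c by simp
    qed (use y in simp_all)
    also have "(ln M + y / M) - (ln y + y / y) = ln M - ln y + y / M - 1"
      using y by simp
    finally show ?thesis .
  qed
  show ?thesis
  proof (cases "x = 0")
    case False
    then show ?thesis using pos[of x] assms by simp
  next
    case True
    have "of_nat n \<le> ?h 0" for n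
    proof -
      define y where "y = M * exp (- (real n + 1))"
      have y: "0 < y" "y \<le> M" using assms by (simp_all add: y_def)
      have "ln y = ln M - (real n + 1)" using assms by (simp add: y_def ln_mult)
      then have "of_nat n \<le> ?h y"
        using y assms by (simp add: pos ennreal_of_nat_eq_real_of_nat)
      also have "?h y \<le> ?h 0"
        using y by (intro nn_integral_mono mult_left_mono mult_right_mono ennreal_leI) auto
      finally show ?thesis .
    qed
    then have "\<not> ?h 0 < top"
      using ennreal_Ex_less_of_nat[of "?h 0"] leD by blast
    then have "?h 0 = top" using less_top by blast
    then show ?thesis by (simp add: True)
  qed
qed

lemma elog_decomposition:
  fixes x M :: real
  assumes "0 \<le> x" "x \<le> M" "1 \<le> M"
  shows "(if x = 0 then \<infinity> else ennreal (ln M - ln x + x / M - 1)) + e2ennreal (elog x) + 1 =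
    e2ennreal (- elog x) + ennreal (ln M + x / M)"
proof (cases "x = 0")
  case True
  then show ?thesis by (simp add: elog_def)
next
  case False
  then have x: "x > 0" using assms by simp
  have "ln (x / M) \<le> x / M - 1" using x assms by (intro ln_le_minus_one) simp
  then have k: "0 \<le> ln M - ln x + x / M - 1" using x assms by (simp add: ln_div)
  have M: "0 \<le> ln M + x / M" using x assms by simp
  show ?thesis
  proof (cases "0 \<le> ln x")
    case True
    have "ennreal ((ln M - ln x + x / M - 1) + ln x + 1) =
        ennreal (ln M - ln x + x / M - 1) + ennreal (ln x) + ennreal 1"
      using k True by (simp only: ennreal_plus add_nonneg_nonneg zero_le_one)
    then show ?thesis using x False True by (simp add: elog_def ennreal_neg)
  next
    case neg: False
    have "ennreal (ln M - ln x + x / M - 1) + ennreal 1 = ennreal ((ln M - ln x + x / M - 1) + 1)"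
      using k by (intro ennreal_plus[symmetric]) auto
    also have "(ln M - ln x + x / M - 1) + 1 = - ln x + (ln M + x / M)" by simp
    also have "ennreal (- ln x + (ln M + x / M)) = ennreal (- ln x) + ennreal (ln M + x / M)"
      using neg M by (intro ennreal_plus) auto
    finally show ?thesis using x False neg by (simp add: elog_def ennreal_neg)
  qed
qed

context traced_algebra
begin

definition positive_part_integral :: "real \<Rightarrow> ('h \<Rightarrow>\<^sub>L 'h) \<Rightarrow> ennreal" where
  "positive_part_integral M T = (\<integral>\<^sup>+c. indicator {0<..M} c *
     (ennreal (tr ((c *\<^sub>R id_blinfun - T) o\<^sub>L resolution T c)) * ennreal (1 / c\<^sup>2)) \<partial>lborel)"

lemma log_integral_eq:
  assumes T: "T \<in> R" "nonneg_op T" and M: "norm T \<le> M" "1 \<le> M"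
  shows "log_integral \<tau> (resolution T) = ereal (ln M + tr T / M - 1) - enn2ereal (positive_part_integral M T)"
proof -
  let ?E = "resolution T"
  have Tsym: "symmetric_op T" using T by (simp add: nonneg_op_symmetric)
  have up: "nonneg_op (M *\<^sub>R id_blinfun - T)" by (rule norm_bound_symmetric_op(1)[OF Tsym M(1)])
  have low: "nonneg_op (T - 0 *\<^sub>R id_blinfun)" using T by simp
  have func: "spectral_functional T ?E R tr a M" if "a < 0" for a
    by (rule resolution_functional[OF T(1) low up that]) (use that M in auto)
  interpret spectral_functional T ?E R tr "-1" M
    by (rule func) simp
  have sf: "sigma_finite_measure \<mu>"
    by (rule sigma_finite_interval_measure[OF monoD[OF mono_F] \<phi>_right])
  interpret pair_sigma_finite lborel \<mu>
    by (intro pair_sigma_finite.intro sf sigma_finite_lborel)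
  have "AE x in \<mu>. \<forall>n. x \<in> {- 1 / Suc n<..M}"
  proof (subst AE_all_countable, rule allI)
    fix n :: nat
    interpret n: spectral_functional T ?E R tr "- 1 / Suc n" M
      by (rule func) simp
    show "AE x in \<mu>. x \<in> {- 1 / Suc n<..M}"
      by (intro interval_measure_AE mono_F \<phi>_right n.const_F)
  qed
  then have supp: "AE x in \<mu>. 0 \<le> x \<and> x \<le> M"
  proof eventually_elim
    case (elim x)
    have "0 \<le> x"
    proof (rule ccontr)
      assume "\<not> 0 \<le> x"
      then obtain n where "inverse (Suc n) < - x" using reals_Archimedean[of "- x"] by auto
      then show False using elim[rule_format, of n] by (simp add: divide_inverse)
    qed
    then show ?case using elim by auto
  qed
  have tr_int: "integrable \<mu> (\<lambda>x. x)" "(LINT x|\<mu>. x) = tr T"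
    by (rule integral_eq_full[OF T(1)]; auto intro!: mono_onI block_lower block_upper)+
  have mass: "integrable \<mu> (\<lambda>x. 1 :: real)" "(LINT x|\<mu>. 1 :: real) = 1"
    using integral_eq_full[OF R_intros(1), of "\<lambda>_. 1"] tr_id by (auto intro!: mono_onI)
  have part: "(\<integral>\<^sup>+x. ennreal (c - x) \<partial>\<mu>) = ennreal (tr ((c *\<^sub>R id_blinfun - T) o\<^sub>L ?E c))"
    if c: "0 < c" "c \<le> M" for c
  proof -
    have 1: "set_integrable \<mu> {-1<..c} (\<lambda>x. x)" "(LINT x:{-1<..c}|\<mu>. x) = tr (T o\<^sub>L ?E c)"
      using c by (intro integral_eq[OF T(1)]; auto intro!: mono_onI block_lower block_upper)+
    have 2: "set_integrable \<mu> {-1<..c} (\<lambda>x. c)" "(LINT x:{-1<..c}|\<mu>. c) = tr ((c *\<^sub>R id_blinfun) o\<^sub>L ?E c)"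
      using c by (intro integral_eq[OF R_intros(6)[OF R_intros(1), where r = c], where f = "\<lambda>_. c"]; auto intro!: mono_onI)+
    have "(\<integral>\<^sup>+x. ennreal (c - x) \<partial>\<mu>) = (\<integral>\<^sup>+x. ennreal (indicator {-1<..c} x *\<^sub>R (c - x)) \<partial>\<mu>)"
      by (rule nn_integral_cong_AE, use supp in eventually_elim) (auto simp: indicator_def ennreal_neg)
    also have "\<dots> = ennreal (LINT x:{-1<..c}|\<mu>. (c - x))"
      unfolding set_lebesgue_integral_def
      by (rule nn_integral_eq_integral)
        (use set_integral_diff(1)[OF 2(1) 1(1)] in \<open>auto simp: set_integrable_def indicator_def\<close>)
    also have "(LINT x:{-1<..c}|\<mu>. (c - x)) = tr ((c *\<^sub>R id_blinfun) o\<^sub>L ?E c) - tr (T o\<^sub>L ?E c)"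
      by (simp add: set_integral_diff(2)[OF 2(1) 1(1)] 1(2) 2(2))
    also have "\<dots> = tr (((c *\<^sub>R id_blinfun) o\<^sub>L ?E c) - (T o\<^sub>L ?E c))"
      by (rule tr_diff[symmetric]) (intro R_intros E_C T)+
    also have "((c *\<^sub>R id_blinfun) o\<^sub>L ?E c) - (T o\<^sub>L ?E c) = (c *\<^sub>R id_blinfun - T) o\<^sub>L ?E c"
      by (rule blinfun_eqI) (simp add: op_apply_simps)
    finally show ?thesis .
  qed
  define h where "h x = (\<integral>\<^sup>+c. indicator {0<..M} c * (ennreal (c - x) * ennreal (1 / c\<^sup>2)) \<partial>lborel)" for x
  have [measurable]: "h \<in> borel_measurable borel" unfolding h_def by measurable
  have [measurable]: "elog \<in> borel_measurable borel" unfolding elog_def by measurable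
  have J: "(\<integral>\<^sup>+x. h x \<partial>\<mu>) = positive_part_integral M T"
  proof -
    have "(\<integral>\<^sup>+x. h x \<partial>\<mu>) = (\<integral>\<^sup>+c. \<integral>\<^sup>+x. indicator {0<..M} c * (ennreal (c - x) * ennreal (1 / c\<^sup>2)) \<partial>\<mu> \<partial>lborel)"
      unfolding h_def by (rule Fubini') measurable
    also have "\<dots> = positive_part_integral M T"
      unfolding positive_part_integral_def
    proof (rule nn_integral_cong)
      fix c :: real
      show "(\<integral>\<^sup>+x. indicator {0<..M} c * (ennreal (c - x) * ennreal (1 / c\<^sup>2)) \<partial>\<mu>) =
        indicator {0<..M} c * (ennreal (tr ((c *\<^sub>R id_blinfun - T) o\<^sub>L ?E c)) * ennreal (1 / c\<^sup>2))"
        by (cases "c \<in> {0<..M}") (simp_all add: nn_integral_cmult nn_integral_multc part)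
    qed
    finally show ?thesis .
  qed
  define p n where "p = (\<integral>\<^sup>+x. e2ennreal (elog x) \<partial>\<mu>)" and "n = (\<integral>\<^sup>+x. e2ennreal (- elog x) \<partial>\<mu>)"
  have const: "(\<integral>\<^sup>+x. ennreal r \<partial>\<mu>) = ennreal r" if "0 \<le> r" for r
    using nn_integral_eq_integral[OF integrable_scaleR_right[OF mass(1), of r]] mass(2) that by simp
  have lnM: "0 \<le> ln M" using M by simp
  have trT: "0 \<le> tr T" by (rule tr_nonneg[OF T])
  have "(\<integral>\<^sup>+x. (h x + e2ennreal (elog x) + 1) \<partial>\<mu>) = (\<integral>\<^sup>+x. (e2ennreal (- elog x) + ennreal (ln M + x / M)) \<partial>\<mu>)"
    by (rule nn_integral_cong_AE, use supp in eventually_elim)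
      (use M in \<open>simp add: h_def nn_integral_positive_part_kernel elog_decomposition del: if_split\<close>)
  moreover have "(\<integral>\<^sup>+x. (h x + e2ennreal (elog x) + 1) \<partial>\<mu>) = positive_part_integral M T + p + 1"
    using const[of 1] by (simp add: nn_integral_add J p_def)
  moreover have "(\<integral>\<^sup>+x. ennreal (ln M + x / M) \<partial>\<mu>) = ennreal (ln M + tr T / M)"
  proof -
    have 1: "integrable \<mu> (\<lambda>x. ln M)" "(LINT x|\<mu>. ln M) = ln M"
      using integrable_scaleR_right[OF mass(1), of "ln M"] mass(2) by simp_all
    have 2: "integrable \<mu> (\<lambda>x. x / M)" "(LINT x|\<mu>. x / M) = tr T / M"
      using tr_int by simp_all
    note int = Bochner_Integration.integrable_add[OF 1(1) 2(1)]
    have "(LINT x|\<mu>. ln M + x / M) = ln M + tr T / M"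
      by (simp only: Bochner_Integration.integral_add[OF 1(1) 2(1)] 1(2) 2(2))
    moreover have "AE x in \<mu>. 0 \<le> ln M + x / M"
      using supp by eventually_elim (use M in simp)
    ultimately show ?thesis using nn_integral_eq_integral[OF int] by simp
  qed
  ultimately have eq: "positive_part_integral M T + p + 1 = n + ennreal (ln M + tr T / M)"
    by (simp add: nn_integral_add n_def)
  have "p \<le> (\<integral>\<^sup>+x. ennreal (ln M) \<partial>\<mu>)"
    unfolding p_def
  proof (rule nn_integral_mono_AE, use supp in eventually_elim)
    case (elim x)
    then show ?case by (auto simp: elog_def e2ennreal_neg intro!: ennreal_leI)
  qed
  then have "p < top" using const[OF lnM] by (simp add: le_less_trans)
  then obtain p' where p': "p = ennreal p'" "0 \<le> p'" by (cases p) auto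
  have I: "log_integral \<tau> ?E = enn2ereal p - enn2ereal n"
    by (simp add: log_integral_def p_def n_def Let_def)
  have r: "0 \<le> ln M + tr T / M" using lnM trT M by simp
  show ?thesis
  proof (cases "positive_part_integral M T")
    case (real j)
    then have eq': "n + ennreal (ln M + tr T / M) = ennreal (j + p' + 1)"
      using eq p' by (simp flip: ennreal_plus ennreal_1)
    then have "n < top" by (metis ennreal_less_top ennreal_add_eq_top less_top)
    then obtain n' where n': "n = ennreal n'" "0 \<le> n'" by (cases n) auto
    have "n' + (ln M + tr T / M) = j + p' + 1"
      using eq' n' r real p' by (simp flip: ennreal_plus)
    then show ?thesis
      using I p' n' real by (simp add: enn2ereal_ennreal)
  next
    case top
    then have "n + ennreal (ln M + tr T / M) = top" using eq by simp
    then have "n = top" by (simp add: ennreal_add_eq_top)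
    then show ?thesis using I p' top by (simp add: enn2ereal_ennreal)
  qed
qed

definition exp_log_integral :: "ereal \<Rightarrow> real" where
  "exp_log_integral I = (if I = -\<infinity> then 0 else exp (real_of_ereal I))"

lemma exp_log_integral_mono:
  assumes "I \<le> J" "J < \<infinity>" shows "exp_log_integral I \<le> exp_log_integral J"
  using assms by (cases I; cases J) (auto simp: exp_log_integral_def)

lemma regular_op_lower_bound:
  assumes "T \<in> R" "nonneg_op T" "regular_op T"
  obtains a where "0 < a" "nonneg_op (T - a *\<^sub>R id_blinfun)"
  using assms(3) invertible_nonneg_lower_bound[OF assms(2)] by (auto simp: regular_op_def)

lemma fk_det_regular:
  assumes "T \<in> R" "nonneg_op T" "regular_op T"
  shows "fk_det \<tau> T = exp (tr (log_op T))"
  using assms by (simp add: fk_det_def abs_op_positive R_positive)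

lemma fk_det_nonneg_op:
  assumes T: "T \<in> R" "nonneg_op T"
  shows "fk_det \<tau> T = exp_log_integral (log_integral \<tau> (resolution T))"
proof (cases "regular_op T")
  case False
  then show ?thesis
    using T by (simp add: fk_det_def abs_op_positive R_positive exp_log_integral_def Let_def)
next
  case True
  obtain a where a: "0 < a" and low: "nonneg_op (T - a *\<^sub>R id_blinfun)"
    by (rule regular_op_lower_bound[OF T True])
  define K where "K = norm T + a"
  have K: "a \<le> K" "nonneg_op (K *\<^sub>R id_blinfun - T)"
    using a T by (auto simp: K_def nonneg_op_symmetric intro!: norm_bound_symmetric_op)
  note L = log_op_spectral[OF R_clinear[OF T(1)] low K(2) a K(1)]
  let ?E = "resolution T"
  interpret spectral_functional T ?E R tr "a / 2" K
    by (rule resolution_functional[OF T(1) low K(2)]) (use a K in auto)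
  have neg: "-1 *\<^sub>R ((X - Y) o\<^sub>L Z) = (Y - X) o\<^sub>L Z" for X Y Z :: "'h \<Rightarrow>\<^sub>L 'h"
    by (rule blinfun_eqI) (simp add: op_apply_simps)
  have f: "mono_on {a / 2..K} ln" "continuous_on {a / 2..K} ln"
    using a by (auto intro!: mono_onI continuous_intros)
  have meas: "(ln :: real \<Rightarrow> real) \<in> borel_measurable borel" by measurable
  have "nonneg_op ((log_op T - ln s *\<^sub>R id_blinfun) o\<^sub>L (?E t - ?E s))"
    "nonneg_op ((ln t *\<^sub>R id_blinfun - log_op T) o\<^sub>L (?E t - ?E s))"
    if st: "a / 2 \<le> s" "s \<le> t" "t \<le> K" for s t
  proof -
    show "nonneg_op ((log_op T - ln s *\<^sub>R id_blinfun) o\<^sub>L (?E t - ?E s))"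
      using L(2)[OF block_commute, of s 1 t s] block_lower[OF st(2)] st a by simp
    show "nonneg_op ((ln t *\<^sub>R id_blinfun - log_op T) o\<^sub>L (?E t - ?E s))"
      using L(2)[OF block_commute, of t "-1" t s] block_upper[OF st(2)] st a by (simp only: neg)
  qed
  note int = integral_eq_full[OF L(1)[OF R T(1)] f meas this]
  have supp: "AE x in \<mu>. x \<in> {a / 2<..K}"
    by (intro interval_measure_AE mono_F \<phi>_right const_F)
  have p: "(\<integral>\<^sup>+x. e2ennreal (elog x) \<partial>\<mu>) = (\<integral>\<^sup>+x. ennreal (ln x) \<partial>\<mu>)"
    by (rule nn_integral_cong_AE, use supp in eventually_elim) (use a in \<open>auto simp: elog_def\<close>)
  have n: "(\<integral>\<^sup>+x. e2ennreal (- elog x) \<partial>\<mu>) = (\<integral>\<^sup>+x. ennreal (- ln x) \<partial>\<mu>)"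
    by (rule nn_integral_cong_AE, use supp in eventually_elim) (use a in \<open>auto simp: elog_def\<close>)
  have fin: "(\<integral>\<^sup>+x. ennreal (ln x) \<partial>\<mu>) < top" "(\<integral>\<^sup>+x. ennreal (- ln x) \<partial>\<mu>) < top"
    using int(1) by (simp_all add: real_integrable_def less_top)
  define p' n' where "p' = enn2real (\<integral>\<^sup>+x. ennreal (ln x) \<partial>\<mu>)"
    and "n' = enn2real (\<integral>\<^sup>+x. ennreal (- ln x) \<partial>\<mu>)"
  have pn: "(\<integral>\<^sup>+x. ennreal (ln x) \<partial>\<mu>) = ennreal p'" "0 \<le> p'"
    "(\<integral>\<^sup>+x. ennreal (- ln x) \<partial>\<mu>) = ennreal n'" "0 \<le> n'"
    using fin by (simp_all add: p'_def n'_def ennreal_enn2real)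
  have "tr (log_op T) = p' - n'"
    using real_lebesgue_integral_def[OF int(1)] pn int(2) by simp
  moreover have "log_integral \<tau> ?E = ereal (p' - n')"
    using pn by (simp add: log_integral_def Let_def p n enn2ereal_ennreal)
  ultimately show ?thesis
    by (simp add: fk_det_regular[OF T True] exp_log_integral_def)
qed

lemma regular_opI:
  assumes "nonneg_op (T - a *\<^sub>R id_blinfun)" "0 < a"
  shows "regular_op T"
  using inv_op_nonneg(1,2)[OF assms] unfolding regular_op_def by blast

lemma fk_det_inv_op:
  assumes T: "T \<in> R" and low: "nonneg_op (T - a *\<^sub>R id_blinfun)" "0 < a"
  shows "fk_det \<tau> (inv_op T) = inverse (fk_det \<tau> T)"
proof -
  have pos: "nonneg_op T"
    using nonneg_op_add[OF low(1) nonneg_op_scaleR[OF nonneg_op_id, of a]] low(2) by simp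
  note inv = inv_op_nonneg[OF low]
  have "regular_op (inv_op T)"
    using inv(1,2) unfolding regular_op_def by blast
  then show ?thesis
    using tr_log_inv[OF T low] inv(3)[OF R T] inv(4) T pos regular_opI[OF low]
    by (simp add: fk_det_regular exp_minus)
qed

lemma fk_det_le:
  assumes \<Phi>: "unital_positive_map R \<Phi>" "trace_preserving R \<tau> \<Phi>"
    and A: "A \<in> R" "nonneg_op A"
  shows "fk_det \<tau> A \<le> fk_det \<tau> (\<Phi> A)"
proof -
  have B: "\<Phi> A \<in> R" "nonneg_op (\<Phi> A)"
  proof -
    show "\<Phi> A \<in> R" using \<Phi>(1) A by (auto simp: unital_positive_map_def)
    then show "nonneg_op (\<Phi> A)"
      using \<Phi>(1) A R_positive[of "\<Phi> A"] R_positive[of A] by (simp add: unital_positive_map_def)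
  qed
  define M where "M = max 1 (max (norm A) (norm (\<Phi> A)))"
  have M: "norm A \<le> M" "norm (\<Phi> A) \<le> M" "1 \<le> M" by (simp_all add: M_def)
  have fam: "spectral_family A (resolution A)" "spectral_family (\<Phi> A) (resolution (\<Phi> A))"
    using A B by (auto intro!: resolution_spectral_family R_clinear nonneg_op_symmetric)
  have "positive_part_integral M (\<Phi> A) \<le> positive_part_integral M A"
    unfolding positive_part_integral_def
    using A B tr_positive_part_le[OF \<Phi> A(1) _ fam(1) _ fam(2)]
    by (intro nn_integral_mono mult_left_mono mult_right_mono ennreal_leI) (auto simp: nonneg_op_symmetric)
  then have "log_integral \<tau> (resolution A) \<le> log_integral \<tau> (resolution (\<Phi> A))"
    using \<Phi>(2) A(1) M
    by (simp add: log_integral_eq[OF A] log_integral_eq[OF B] trace_preserving_def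
        ereal_minus_mono less_eq_ennreal.rep_eq)
  moreover have "log_integral \<tau> (resolution (\<Phi> A)) < \<infinity>"
    using enn2ereal_nonneg[of "positive_part_integral M (\<Phi> A)"]
    by (simp add: log_integral_eq[OF B M(2,3)])
      (cases "enn2ereal (positive_part_integral M (\<Phi> A))"; auto)
  ultimately show ?thesis
    by (simp add: fk_det_nonneg_op A B exp_log_integral_mono)
qed

end

theorem corollary4p16:
  fixes R :: "('h::chilbert_space \<Rightarrow>\<^sub>L 'h) set"
    and \<tau> :: "'h \<Rightarrow>\<^sub>L 'h \<Rightarrow> complex"
    and \<Phi> :: "'h \<Rightarrow>\<^sub>L 'h \<Rightarrow> 'h \<Rightarrow>\<^sub>L 'h"
  assumes "finite_von_neumann_algebra R"
    and "faithful_normal_tracial_state R \<tau>"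
    and "unital_positive_map R \<Phi>"
    and "trace_preserving R \<tau> \<Phi>"
  shows "(\<forall>A\<in>R. positive_op A \<longrightarrow> fk_det \<tau> A \<le> fk_det \<tau> (\<Phi> A)) \<and>
         (\<forall>A\<in>R. positive_op A \<and> regular_op A \<longrightarrow>
            fk_det \<tau> (inv_op (\<Phi> (inv_op A))) \<le> fk_det \<tau> A)"
proof -
  interpret traced_algebra R \<tau>
    using assms(1,2) by unfold_locales (simp_all add: finite_von_neumann_algebra_def)
  note le = fk_det_le[OF assms(3,4)]
  show ?thesis
  proof (intro conjI ballI impI)
    fix A assume "A \<in> R" "positive_op A"
    then show "fk_det \<tau> A \<le> fk_det \<tau> (\<Phi> A)" by (simp add: le R_positive)
  next
    fix A assume A: "A \<in> R" "positive_op A \<and> regular_op A"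
    then obtain a where a: "0 < a" "nonneg_op (A - a *\<^sub>R id_blinfun)"
      using regular_op_lower_bound[of A] by (auto simp: R_positive)
    note inv = inv_op_nonneg[OF a(2,1)]
    define C where "C = inv_op A"
    have C: "C \<in> R" "nonneg_op C" using inv(3)[OF R A(1)] inv(4) by (simp_all add: C_def)
    obtain c where c: "0 < c" "nonneg_op (C - c *\<^sub>R id_blinfun)"
      using invertible_nonneg_lower_bound[OF C(2), of A] inv(1) by (auto simp: C_def)
    have \<Phi>C: "\<Phi> C \<in> R" using assms(3) C by (auto simp: unital_positive_map_def)
    have lin: "clinear_on R \<Phi>" and one: "\<Phi> id_blinfun = id_blinfun"
      using assms(3) by (auto simp: unital_positive_map_def)
    have "(- complex_of_real c) *\<^sub>C id_blinfun = - (c *\<^sub>R (id_blinfun :: 'h \<Rightarrow>\<^sub>L 'h))"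
      by (metis of_real_minus scaleR_minus_left scaleR_scaleC)
    moreover have "\<Phi> (C + (- complex_of_real c) *\<^sub>C id_blinfun) = \<Phi> C + (- complex_of_real c) *\<^sub>C id_blinfun"
      using lin C(1) one vN by (simp add: clinear_on_def von_neumann_algebra_def)
    ultimately have "\<Phi> (C - c *\<^sub>R id_blinfun) = \<Phi> C - c *\<^sub>R id_blinfun"
      by simp
    moreover have "C - c *\<^sub>R id_blinfun \<in> R" by (intro R_intros C)
    then have "nonneg_op (\<Phi> (C - c *\<^sub>R id_blinfun))"
      using assms(3) c(2) R_positive by (simp add: unital_positive_map_def positive_op_iff)
    ultimately have low: "nonneg_op (\<Phi> C - c *\<^sub>R id_blinfun)" by simp
    have regC: "regular_op C" by (rule regular_opI[OF c(2,1)])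
    have "fk_det \<tau> C > 0" by (simp add: fk_det_regular[OF C regC])
    then have "inverse (fk_det \<tau> (\<Phi> C)) \<le> inverse (fk_det \<tau> C)"
      using le[OF C] by (intro le_imp_inverse_le)
    also have "inverse (fk_det \<tau> C) = fk_det \<tau> A"
      by (simp add: C_def fk_det_inv_op[OF A(1) a(2,1)])
    finally show "fk_det \<tau> (inv_op (\<Phi> (inv_op A))) \<le> fk_det \<tau> A"
      by (simp add: fk_det_inv_op[OF \<Phi>C low c(1)] flip: C_def)
  qed
qed

end
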